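(* Let $n\geq 6$ be an integer such that $p=(2n-1)(2n+1)$, $q=(2n-1)(2n+3)$ and $r=(2n+1)(2n+3)$ are square-free integers, and let $K=\mathbb{Q}(\sqrt{p},\sqrt{q})$. Then $\mathcal{P}(\mathcal{O}_K)=7$.
   Context: $\mathcal{O}_K$ denotes the ring of algebraic integers of $K$. For a commutative ring $\mathcal{O}$, let $\sum\mathcal{O}^2$ be the set of elements of $\mathcal{O}$ that are sums of squares of elements of $\mathcal{O}$, and $\sum^m\mathcal{O}^2$ the set of those that are sums of at most $m$ squares. The Pythagoras number is $\mathcal{P}(\mathcal{O})=\inf\{m\in\mathbb{N}\cup\{+\infty\} : \sum\mathcal{O}^2=\sum^m\mathcal{O}^2\}$. *)

theory Defs
  imports
    "HOL-Algebra.Generated_Fields"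
    "HOL-Algebra.Algebraic_Closure_Type"
    "HOL-Computational_Algebra.Squarefree"
    "HOL-Library.Extended_Nat"
begin

text \<open>
  Number fields are rendered as subfields of an ambient field type of characteristic 0, and rings
  as subsets (carriers of subrings) of an ambient commutative ring type.
\<close>

definition rat_adjoin :: "'a::field_char_0 set \<Rightarrow> 'a set" where
  "rat_adjoin S = generate_field ring_of_type_algebra (\<rat> \<union> S)"

definition ring_of_integers :: "'a::field_char_0 set \<Rightarrow> 'a set" where
  "ring_of_integers K = {x \<in> K. algebraic_int x}"

definition sums_of_squares :: "'a::comm_ring_1 set \<Rightarrow> 'a set" where
  "sums_of_squares R = {(\<Sum>a\<leftarrow>xs. a\<^sup>2) | xs. set xs \<subseteq> R}"

definition sums_of_at_most_squares :: "enat \<Rightarrow> 'a::comm_ring_1 set \<Rightarrow> 'a set" where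
  "sums_of_at_most_squares m R = {(\<Sum>a\<leftarrow>xs. a\<^sup>2) | xs. set xs \<subseteq> R \<and> enat (length xs) \<le> m}"

definition pythagoras_number :: "'a::comm_ring_1 set \<Rightarrow> enat" where
  "pythagoras_number R = Inf {m. sums_of_squares R = sums_of_at_most_squares m R}"

end

theory Submission
  imports Defs "HOL-Analysis.Analysis" "HOL-Number_Theory.Number_Theory"
begin

text \<open>
  Upper bound. The ring of integers is a free \<open>\<int>\<close>-module of rank 4, so a sum of eight squares in it is
  given by four integer vectors in \<open>\<int>\<^sup>8\<close>, and only their Gram matrix matters. By Meyer's theorem on
  indefinite quinary forms, the orthogonal complement of these vectors contains a rational vector \<open>v\<close> of
  length 1. The neighbour of \<open>\<int>\<^sup>8\<close> at \<open>v\<close> is again self-dual and splits off \<open>v\<close>, which leaves a self-dual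
  lattice of rank 7 that contains the four vectors. By the inequality of Korkine and Zolotareff such a lattice
  has a vector of norm 1; splitting off such vectors repeatedly, it is isometric to \<open>\<int>\<^sup>7\<close>, and the
  four vectors have the same Gram matrix as four integer vectors in \<open>\<int>\<^sup>7\<close>.

  Meyer's theorem is reduced to three conics, each solvable by Legendre's theorem. The conics contain
  auxiliary primes with prescribed quadratic residue symbols. These exist by Mertens' argument, applied to
  real characters only; the local condition at the auxiliary primes follows from the product formula.

  Lower bound. Write \<open>sp\<close>, \<open>sq\<close>, \<open>sr\<close> for the square roots of \<open>p\<close>, \<open>q\<close>, \<open>r\<close>. The element
  \<open>1 + 1 + 1 + 4 + ((1 + sq)/2)\<^sup>2 + (1 + (sr - sp)/2)\<^sup>2 + (1 + (sr + sp)/2)\<^sup>2\<close> is not a sum of six squares: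
  for \<open>n \<ge> 6\<close> its trace leaves so little room that the coordinates of the summands are almost determined,
  and at the end 7 would have to be a sum of three integer squares.
\<close>

section \<open>Real characters and primes\<close>

text \<open>The rank count is tight. Four vectors in Z^8 leave a complement of dimension at least 4,
  and asking for a combination of four orthogonal vectors there with square norm adds the
  coefficient -1: five variables, just enough for Meyer's theorem. Descending to rank 7 matters
  because E8 is self-dual of rank 8 without vectors of norm 1, while in rank 7 the minimum
  \<open>m\<close> satisfies \<open>m * m \<le> 27/8\<close>, so it is 1. The three conics share
  their auxiliary primes, so these must meet symbol conditions at finitely many primes and a class
  modulo 4. All these conditions are real characters, whose L(1) is nonzero by positivity of divisor
  sums. The reciprocity step is set up for odd coefficients not all congruent modulo 4, which is why
  a long 2-adic rearrangement of the quinary form precedes it. In doubled coordinates the rational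
  part of the witness is 37 = 4 * 7 + 1 + 4 + 4. The last three summands of the witness tie up 9 of
  it in any rival representation by six squares, and 28 is left for only three even numbers.\<close>

lemma abs_sum_mult_decreasing_le:
  fixes f g :: "nat \<Rightarrow> real"
  assumes bd: "\<And>i. \<bar>\<Sum>j\<in>{a..<i}. f j\<bar> \<le> C"
    and nonneg: "\<And>i. a \<le> i \<Longrightarrow> 0 \<le> g i"
    and decr: "\<And>i. a \<le> i \<Longrightarrow> g (Suc i) \<le> g i"
  shows "\<bar>\<Sum>i\<in>{a..<b}. f i * g i\<bar> \<le> C * g a"
proof (cases "a \<le> b")
  case True
  define S where "S i = (\<Sum>j\<in>{a..<i}. f j)" for i
  have parts: "(\<Sum>i\<in>{a..<b}. f i * g i)
      = S b * g b + (\<Sum>i\<in>{a..<b}. S (Suc i) * (g i - g (Suc i)))"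
    using True
  proof (induction b rule: dec_induct)
    case base
    then show ?case by (simp add: S_def)
  next
    case (step b)
    then show ?case by (simp add: S_def algebra_simps)
  qed
  have "\<bar>\<Sum>i\<in>{a..<b}. f i * g i\<bar>
      \<le> \<bar>S b * g b\<bar> + (\<Sum>i\<in>{a..<b}. \<bar>S (Suc i) * (g i - g (Suc i))\<bar>)"
    unfolding parts using sum_abs[of "\<lambda>i. S (Suc i) * (g i - g (Suc i))" "{a..<b}"]
    by linarith
  also have "\<dots> \<le> C * g b + (\<Sum>i\<in>{a..<b}. C * (g i - g (Suc i)))"
  proof (intro add_mono sum_mono)
    show "\<bar>S b * g b\<bar> \<le> C * g b"
      using bd[of b] nonneg[OF True] by (auto simp: abs_mult S_def intro!: mult_right_mono)
  next
    fix i assume "i \<in> {a..<b}"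
    then show "\<bar>S (Suc i) * (g i - g (Suc i))\<bar> \<le> C * (g i - g (Suc i))"
      using bd[of "Suc i"] decr[of i] by (auto simp: abs_mult S_def intro!: mult_right_mono)
  qed
  also have "(\<Sum>i\<in>{a..<b}. C * (g i - g (Suc i))) = C * (g a - g b)"
    using True by (induction b rule: dec_induct) (auto simp: algebra_simps)
  finally show ?thesis by (simp add: algebra_simps)
next
  case False
  have "0 \<le> C" using bd[of a] by auto
  with False nonneg[of a] show ?thesis by auto
qed

section \<open>Elementary estimates of Chebyshev and Mertens\<close>

lemma sum_divisors_swap:
  fixes h :: "nat \<Rightarrow> nat \<Rightarrow> 'a::comm_monoid_add"
  shows "(\<Sum>n=1..N. \<Sum>d | d dvd n. h d (n div d)) = (\<Sum>d=1..N. \<Sum>k=1..N div d. h d k)"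
proof -
  have "(\<Sum>n=1..N. \<Sum>d | d dvd n. h d (n div d))
      = (\<Sum>(n,d)\<in>(SIGMA n:{1..N}. {d. d dvd n}). h d (n div d))"
    by (rule sum.Sigma) auto
  also have "\<dots> = (\<Sum>(d,k)\<in>(SIGMA d:{1..N}. {1..N div d}). h d k)"
  proof (rule sum.reindex_bij_witness[of _ "\<lambda>(d,k). (d * k, d)" "\<lambda>(n,d). (d, n div d)"], goal_cases)
    case (1 a) then show ?case by auto
  next
    case (2 a)
    then obtain n d where a: "a = (n, d)" "1 \<le> n" "n \<le> N" "d dvd n" by auto
    then have "d > 0" by (auto intro: dvd_pos_nat)
    moreover have "d \<le> n" using a by (auto dest: dvd_imp_le)
    ultimately show ?case using a by (auto simp: div_le_mono Suc_le_eq div_greater_zero_iff)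
  next
    case (3 b) then show ?case by auto
  next
    case (4 b) then show ?case
      by (auto simp: less_eq_div_iff_mult_less_eq Suc_le_eq mult.commute)
  next
    case (5 a) then show ?case by auto
  qed
  also have "\<dots> = (\<Sum>d=1..N. \<Sum>k=1..N div d. h d k)"
    by (rule sum.Sigma[symmetric]) auto
  finally show ?thesis .
qed

lemma ln_fact_eq_sum_mangoldt:
  "ln (fact N) = (\<Sum>d=1..N. mangoldt d * real (N div d))"
proof -
  have "ln (fact N) = (\<Sum>n=1..N. ln (real n))"
    by (induction N) (auto simp: ln_mult)
  also have "\<dots> = (\<Sum>n=1..N. \<Sum>d | d dvd n. mangoldt d)"
    by (intro sum.cong refl) (subst mangoldt_sum, auto)
  also have "\<dots> = (\<Sum>d=1..N. \<Sum>k=1..N div d. mangoldt d)"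
    by (rule sum_divisors_swap)
  finally show ?thesis by (simp add: mult.commute)
qed

text \<open>Chebyshev's bound through the central binomial coefficient: the weight floor(2n/d) - 2
  floor(n/d) is never negative and is at least 1 for n < d \<le> 2n, and the weighted sum is the
  logarithm of a binomial coefficient below 4^n.\<close>

lemma sum_mangoldt_double_le:
  assumes "n > 0"
  shows "(\<Sum>d=1..2*n. mangoldt d) \<le> (\<Sum>d=1..n. mangoldt d) + 2 * real n * ln 2"
proof -
  have ext: "(\<Sum>d=1..2*n. mangoldt d * real (n div d)) = ln (fact n)"
    unfolding ln_fact_eq_sum_mangoldt
    by (rule sum.mono_neutral_right) auto
  have "(\<Sum>d=1..2*n. mangoldt d) - (\<Sum>d=1..n. mangoldt d) = (\<Sum>d=n+1..2*n. mangoldt d :: real)"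
    using sum.ub_add_nat[of 1 n "mangoldt :: nat \<Rightarrow> real" n] by (simp add: mult_2)
  also have "\<dots> \<le> (\<Sum>d=n+1..2*n. mangoldt d * (real (2*n div d) - 2 * real (n div d)))"
  proof (rule sum_mono)
    fix d assume d: "d \<in> {n+1..2*n}"
    then have "2 * n div d \<ge> 1" "n div d = 0"
      by (auto simp: Suc_le_eq div_greater_zero_iff)
    then show "mangoldt d \<le> mangoldt d * (real (2*n div d) - 2 * real (n div d))"
      using mult_left_mono[of 1 "real (2 * n div d)" "mangoldt d"] mangoldt_nonneg[of d] by simp
  qed
  also have "\<dots> \<le> (\<Sum>d=1..2*n. mangoldt d * (real (2*n div d) - 2 * real (n div d)))"
  proof (rule sum_mono2)
    fix d assume "d \<in> {1..2*n} - {n+1..2*n}"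
    have "2 * (n div d) \<le> 2 * n div d"
      by (metis div_mult1_eq le_add1)
    then have "2 * real (n div d) \<le> real (2*n div d)"
      by (metis of_nat_le_iff of_nat_mult of_nat_numeral)
    then show "0 \<le> mangoldt d * (real (2*n div d) - 2 * real (n div d))"
      by (auto intro!: mult_nonneg_nonneg mangoldt_nonneg)
  qed auto
  also have "\<dots> = ln (fact (2*n)) - 2 * ln (fact n)"
    unfolding right_diff_distrib sum_subtractf ln_fact_eq_sum_mangoldt[of "2*n"] ext[symmetric]
    by (simp add: sum_distrib_left mult_ac)
  also have "\<dots> = ln (real ((2*n) choose n))"
  proof -
    have "fact (2*n) = real ((2*n) choose n) * (fact n * fact n)"
      by (metis binomial_fact_lemma diff_add_inverse le_add1 mult.commute mult_2 of_nat_fact of_nat_mult)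
    moreover have "real ((2*n) choose n) > 0" by simp
    ultimately show ?thesis by (simp add: ln_mult)
  qed
  also have "\<dots> \<le> ln (2 ^ (2*n))"
  proof -
    have "(2*n) choose n \<le> 2 ^ (2*n)" by (rule binomial_le_pow2)
    then have "real ((2*n) choose n) \<le> 2 ^ (2*n)"
      by (metis of_nat_le_iff of_nat_numeral of_nat_power)
    then show ?thesis by (subst ln_le_cancel_iff) auto
  qed
  also have "\<dots> = 2 * real n * ln 2" by (simp add: ln_realpow)
  finally show ?thesis by simp
qed

lemma sum_mangoldt_power2_le: "(\<Sum>d=1..2^k. mangoldt d) \<le> 2 * 2^k * ln (2::real)"
proof (induction k)
  case 0
  then show ?case by simp
next
  case (Suc k)
  have "(\<Sum>d=1..2*2^k. mangoldt d) \<le> (\<Sum>d=1..2^k. mangoldt d) + 2 * real (2^k) * ln 2"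
    by (rule sum_mangoldt_double_le) simp
  with Suc show ?case by simp
qed

text \<open>Half of Mertens' first theorem: ln N! is at most N times the sum in question. Powers of
  two suffice, because the sum only has to become unbounded.\<close>

lemma sum_mangoldt_div_power2_ge:
  "(\<Sum>d=1..2^k. mangoldt d / real d) \<ge> (real k - 2) / 2 * ln 2"
proof (cases k)
  case 0
  then show ?thesis by simp
next
  case (Suc j)
  define N where "N = (2::nat)^k"
  have N: "N = 2 * 2^j" by (simp add: N_def Suc)
  have "(\<Sum>d=1..N. mangoldt d * real (N div d)) \<le> (\<Sum>d=1..N. mangoldt d * (real N / real d))"
    by (intro sum_mono mult_left_mono mangoldt_nonneg of_nat_div_le_of_nat)
  also have "\<dots> = real N * (\<Sum>d=1..N. mangoldt d / real d)"
    by (simp add: sum_distrib_left mult_ac)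
  finally have 1: "ln (fact N) \<le> real N * (\<Sum>d=1..N. mangoldt d / real d)"
    by (simp add: ln_fact_eq_sum_mangoldt)
  \<comment> \<open>The 2^j factors of N! above 2^j contribute at least \<open>j * ln 2\<close>
    each; this crude count replaces Stirling's formula.\<close>
  have "(\<Sum>n=2^j+1..N. ln (real n)) \<ge> (\<Sum>n=2^j+1..N. real j * ln 2)"
  proof (rule sum_mono)
    fix n assume n: "n \<in> {2^j+1..N}"
    then have "real (2^j) \<le> real n" by (subst of_nat_le_iff) auto
    then have "ln (2^j) \<le> ln (real n)" by (subst ln_le_cancel_iff) (use n in auto)
    then show "real j * ln 2 \<le> ln (real n)" by (simp add: ln_realpow)
  qed
  moreover have "(\<Sum>n=2^j+1..N. ln (real n)) \<le> (\<Sum>n=1..N. ln (real n))"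
    by (rule sum_mono2) auto
  moreover have "ln (fact N) = (\<Sum>n=1..N. ln (real n))"
    by (induction N) (auto simp: ln_mult)
  moreover have "(\<Sum>n=2^j+1..N. real j * ln 2) = 2^j * (real j * ln 2)"
    by (simp add: N)
  ultimately have "2^j * (real j * ln 2) \<le> real N * (\<Sum>d=1..N. mangoldt d / real d)"
    using 1 by linarith
  then have "2^j * (real j * ln 2) \<le> 2^j * (2 * (\<Sum>d=1..N. mangoldt d / real d))"
    by (simp add: N)
  then have "real j * ln 2 \<le> 2 * (\<Sum>d=1..N. mangoldt d / real d)"
    by (subst (asm) mult_le_cancel_left_pos) auto
  moreover have "(real k - 2) * ln 2 \<le> real j * ln 2"
    using Suc by (intro mult_right_mono) auto
  ultimately have "(real k - 2) * ln 2 \<le> 2 * (\<Sum>d=1..2^k. mangoldt d / real d)"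
    unfolding N_def by linarith
  then show ?thesis by simp
qed

section \<open>Real characters and the nonvanishing of L(1)\<close>

locale quadratic_character =
  fixes f :: "nat \<Rightarrow> real" and m :: nat
  assumes m_pos: "m > 0"
    and vals: "f n \<in> {-1, 0, 1}"
    and mult: "f (a * b) = f a * f b"
    and one: "f 1 = 1"
    and period: "f (n + m) = f n"
    and sum_period: "(\<Sum>n<m. f n) = 0"
begin

lemma abs_le_1: "\<bar>f n\<bar> \<le> 1"
  using vals[of n] by auto

lemma sum_window: "(\<Sum>i\<in>{a..<a+m}. f i) = 0"
proof (induction a)
  case 0
  then show ?case using sum_period by (simp add: lessThan_atLeast0)
next
  case (Suc a)
  have "(\<Sum>i\<in>{a..<Suc (a+m)}. f i) = f a + (\<Sum>i\<in>{Suc a..<Suc (a+m)}. f i)"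
    by (rule sum.atLeast_Suc_lessThan) simp
  moreover have "(\<Sum>i\<in>{a..<Suc (a+m)}. f i) = (\<Sum>i\<in>{a..<a+m}. f i) + f (a+m)"
    by (rule sum.atLeastLessThan_Suc) simp
  ultimately show ?case using Suc period[of a] by simp
qed

text \<open>Whole periods cancel: non-principality of the character enters as
  \<open>sum_period\<close>. What remains has fewer than \<open>m\<close> terms of size at most
  1.\<close>

lemma abs_sum_le: "\<bar>\<Sum>i\<in>{a..<b}. f i\<bar> \<le> real m"
proof (induction "b - a" arbitrary: b rule: less_induct)
  case less
  show ?case
  proof (cases "b < a + m")
    case True
    have "\<bar>\<Sum>i\<in>{a..<b}. f i\<bar> \<le> (\<Sum>i\<in>{a..<b}. \<bar>f i\<bar>)" by (rule sum_abs)
    also have "\<dots> \<le> (\<Sum>i\<in>{a..<b}. 1)" by (intro sum_mono abs_le_1)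
    also have "\<dots> \<le> real m" using True by auto
    finally show ?thesis .
  next
    case False
    define c where "c = b - m"
    have c: "b = c + m" "a \<le> c" using False by (auto simp: c_def)
    have "(\<Sum>i\<in>{a..<b}. f i) = (\<Sum>i\<in>{a..<c}. f i) + (\<Sum>i\<in>{c..<b}. f i)"
      using c by (intro sum.atLeastLessThan_concat[symmetric]) auto
    then have "(\<Sum>i\<in>{a..<b}. f i) = (\<Sum>i\<in>{a..<c}. f i)" using sum_window[of c] c by simp
    moreover have "c - a < b - a" using c m_pos by auto
    ultimately show ?thesis using less by simp
  qed
qed

lemma abs_sum_div_le:
  assumes "a > 0"
  shows "\<bar>\<Sum>i\<in>{a..<b}. f i / real i\<bar> \<le> real m / real a"
proof -
  have "\<bar>\<Sum>i\<in>{a..<b}. f i * (1 / real i)\<bar> \<le> real m * (1 / real a)"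
    by (rule abs_sum_mult_decreasing_le[OF abs_sum_le]) (use assms in \<open>auto simp: field_simps\<close>)
  then show ?thesis by simp
qed

lemma summable_div: "summable (\<lambda>n. f n / real n)"
  unfolding summable_Cauchy
proof (intro allI impI)
  fix e :: real assume e: "e > 0"
  obtain N where N: "real N > real m / e" using reals_Archimedean2 by blast
  show "\<exists>N. \<forall>k\<ge>N. \<forall>n. norm (\<Sum>i = k..<n. f i / real i) < e"
  proof (intro exI allI impI)
    fix k n assume k: "Suc N \<le> k"
    have "norm (\<Sum>i = k..<n. f i / real i) \<le> real m / real k"
      using abs_sum_div_le[of k n] k by simp
    also have "\<dots> < e" using N e k m_pos
      by (simp add: field_simps) (smt (verit) mult_left_mono of_nat_le_iff Suc_leD)
    finally show "norm (\<Sum>i = k..<n. f i / real i) < e" .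
  qed
qed

text \<open>The value at 1 of the L-series, only conditionally convergent. The term at 0 is a
  division by zero, hence 0, so the summation may start there.\<close>

definition L1 :: real where "L1 = (\<Sum>n. f n / real n)"

lemma L1_tail_le:
  assumes "a > 0"
  shows "\<bar>L1 - (\<Sum>n<a. f n / real n)\<bar> \<le> real m / real a"
proof -
  have "(\<lambda>b. \<Sum>n<b. f n / real n) \<longlonglongrightarrow> L1"
    unfolding L1_def by (rule summable_LIMSEQ[OF summable_div])
  then have "(\<lambda>b. \<bar>(\<Sum>n<b. f n / real n) - (\<Sum>n<a. f n / real n)\<bar>) \<longlonglongrightarrow> \<bar>L1 - (\<Sum>n<a. f n / real n)\<bar>"
    by (intro tendsto_intros)
  moreover have "\<forall>b\<ge>a. \<bar>(\<Sum>n<b. f n / real n) - (\<Sum>n<a. f n / real n)\<bar> \<le> real m / real a"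
  proof (intro allI impI)
    fix b assume "a \<le> b"
    then have "(\<Sum>n<b. f n / real n) - (\<Sum>n<a. f n / real n) = (\<Sum>n\<in>{a..<b}. f n / real n)"
      by (simp add: lessThan_atLeast0 sum_diff_nat_ivl)
    then show "\<bar>(\<Sum>n<b. f n / real n) - (\<Sum>n<a. f n / real n)\<bar> \<le> real m / real a"
      using abs_sum_div_le[OF assms, of b] by simp
  qed
  ultimately show ?thesis using LIMSEQ_le_const2 by blast
qed

lemma power_eq: "f (a ^ k) = f a ^ k"
  by (induction k) (use one mult in auto)

lemma sum_divisors_mult:
  assumes co: "coprime a b"
  shows "(\<Sum>d | d dvd a * b. f d) = (\<Sum>d | d dvd a. f d) * (\<Sum>d | d dvd b. f d)"
proof -
  have gcds: "gcd (x * y) a = x" "gcd (x * y) b = y" if "x dvd a" "y dvd b" for x y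
  proof -
    have "coprime y a" "coprime x b"
      using coprime_divisors[OF that(2) dvd_refl[of a]] coprime_divisors[OF that(1) dvd_refl[of b]] co
      by (simp_all add: coprime_commute)
    then have "gcd (x * y) a = gcd x a" "gcd (x * y) b = gcd y b"
      by (metis coprime_commute gcd_mult_left_right_cancel, metis coprime_commute gcd_mult_left_left_cancel)
    then show "gcd (x * y) a = x" "gcd (x * y) b = y"
      using that by (simp_all add: gcd_nat.absorb1)
  qed
  have "(\<Sum>d | d dvd a. f d) * (\<Sum>d | d dvd b. f d)
      = (\<Sum>(x,y)\<in>{d. d dvd a} \<times> {d. d dvd b}. f x * f y)"
    by (simp add: sum_product sum.cartesian_product)
  also have "\<dots> = (\<Sum>d | d dvd a * b. f d)"
  proof (rule sum.reindex_bij_witness[of _ "\<lambda>d. (gcd d a, gcd d b)" "\<lambda>(x,y). x * y"], goal_cases)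
    case (1 z) then show ?case using gcds by auto
  next
    case (2 z) then show ?case by (auto intro: mult_dvd_mono)
  next
    case (3 d)
    then obtain x y where "d = x * y" "x dvd a" "y dvd b" using division_decomp[of d a b] by auto
    then show ?case using gcds by auto
  next
    case (4 d) then show ?case by auto
  next
    case (5 z) then show ?case by (auto simp: mult)
  qed
  finally show ?thesis ..
qed

lemma sum_divisors_prime_power:
  assumes "prime p"
  shows "(\<Sum>d | d dvd p ^ k. f d) = (\<Sum>i\<le>k. f p ^ i)"
proof -
  have "{d. d dvd p ^ k} = (\<lambda>i. p ^ i) ` {..k}"
    using divides_primepow_nat[OF assms] by auto
  moreover have "inj_on (\<lambda>i. p ^ i) {..k}"
    using prime_gt_1_nat[OF assms] by (auto simp: inj_on_def)
  ultimately show ?thesis by (simp add: sum.reindex power_eq)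
qed

text \<open>These divisor sums are the coefficients of zeta(s) L(s, f). They are multiplicative, and
  at p^k they are geometric sums in f(p) of value k + 1, 1, or alternately 1 and 0; so they are
  nonnegative, and at least 1 for even k. One prime is stripped off at a time.\<close>

lemma sum_divisors_nonneg_aux:
  "n > 0 \<Longrightarrow> (\<Sum>d | d dvd n. f d) \<ge> 0 \<and> ((\<exists>k. n = k^2) \<longrightarrow> (\<Sum>d | d dvd n. f d) \<ge> 1)"
proof (induction n rule: less_induct)
  case (less n)
  show ?case
  proof (cases "n = 1")
    case True
    then show ?thesis using one by simp
  next
    case False
    obtain p where p: "prime p" "p dvd n" using False prime_factor_nat by blast
    define k where "k = multiplicity p n"
    define b where "b = n div p ^ k"
    have nb: "n = p ^ k * b"
      unfolding k_def b_def using less.prems p multiplicity_dvd[of p n] by simp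
    have pb: "\<not> p dvd b"
      unfolding k_def b_def using less.prems p multiplicity_decompose[of n p] not_prime_1 by (metis not_prime_unit not_gr_zero)
    have k0: "k > 0" unfolding k_def using p less.prems
      by (simp add: prime_multiplicity_gt_zero_iff)
    have b0: "b > 0" using nb less.prems by (auto intro: gr0I)
    have bn: "b < n"
    proof -
      have "p ^ k > 1" using k0 prime_gt_1_nat[OF p(1)] by (intro one_less_power)
      then show ?thesis using b0 nb by simp
    qed
    have co: "coprime (p ^ k) b" using pb p by (simp add: prime_imp_coprime)
    have r: "(\<Sum>d | d dvd n. f d) = (\<Sum>i\<le>k. f p ^ i) * (\<Sum>d | d dvd b. f d)"
      unfolding nb sum_divisors_mult[OF co] sum_divisors_prime_power[OF p(1)] ..
    have e: "(\<Sum>i\<le>k. (-1::real) ^ i) = (if even k then 1 else 0)" for k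
      by (induction k) auto
    have z: "(\<Sum>i\<le>k. (0::real) ^ i) = 1"
      by (subst sum.mono_neutral_right[of _ "{0}"]) auto
    have ge: "(\<Sum>i\<le>k. f p ^ i) \<ge> 0" "even k \<Longrightarrow> (\<Sum>i\<le>k. f p ^ i) \<ge> 1"
      using vals[of p] by (auto simp: e z)
    show ?thesis
    proof (intro conjI impI)
      show "(\<Sum>d | d dvd n. f d) \<ge> 0"
        unfolding r using ge(1) less.IH[OF bn b0] by auto
    next
      assume "\<exists>k. n = k^2"
      then obtain c where c: "n = c^2" by auto
      have ek: "even k" unfolding k_def c using p(1) c less.prems
        by (subst prime_elem_multiplicity_power_distrib) auto
      have "\<exists>j. b = j^2"
      proof -
        obtain i where i: "k = 2 * i" using ek by auto
        have "(p ^ i)^2 dvd c^2" using nb c i by (simp add: power_mult[symmetric] mult.commute)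
        then have "p ^ i dvd c" by simp
        then obtain j where "c = p ^ i * j" by auto
        then have "p ^ k * b = p ^ k * j^2"
          using nb c i by (metis power_mult power_mult_distrib mult.commute)
        then have "b = j^2" using p(1) by (simp only: mult_cancel_left) auto
        then show ?thesis by blast
      qed
      then have "(\<Sum>d | d dvd b. f d) \<ge> 1" using less.IH[OF bn b0] by auto
      then show "(\<Sum>d | d dvd n. f d) \<ge> 1"
        unfolding r using ge(2)[OF ek] mult_mono[of 1 "\<Sum>i\<le>k. f p ^ i" 1 "\<Sum>d | d dvd b. f d"] by auto
    qed
  qed
qed

lemma sum_divisors_nonneg: "n > 0 \<Longrightarrow> (\<Sum>d | d dvd n. f d) \<ge> 0"
  and sum_divisors_square_ge_1: "k > 0 \<Longrightarrow> (\<Sum>d | d dvd k^2. f d) \<ge> 1"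
  using sum_divisors_nonneg_aux by auto

end

text \<open>Pair the exponent i with n - 1 - i: the inequality between arithmetic and geometric mean
  bounds each pair below by 2 y^(n-1).\<close>

lemma geometric_sum_ge:
  fixes y :: real
  assumes "0 < y" "n > 0"
  shows "(\<Sum>i<n. (y^2) ^ i) \<ge> real n * y ^ (n - 1)"
proof -
  have "2 * (\<Sum>i<n. (y^2) ^ i) = (\<Sum>i<n. (y^2) ^ i) + (\<Sum>i<n. (y^2) ^ (n - Suc i))"
    by (subst sum.nat_diff_reindex) simp
  also have "\<dots> = (\<Sum>i<n. (y^i)^2 + (y^(n - Suc i))^2)"
    by (simp add: sum.distrib power_mult[symmetric] mult.commute)
  also have "\<dots> \<ge> (\<Sum>i<n. 2 * y ^ (n - 1))"
  proof (rule sum_mono)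
    fix i assume "i \<in> {..<n}"
    then have "y ^ (n - 1) = y ^ i * y ^ (n - Suc i)" by (simp add: power_add[symmetric])
    then show "2 * y ^ (n - 1) \<le> (y^i)^2 + (y^(n - Suc i))^2"
      using sum_squares_bound[of "y^i" "y^(n - Suc i)"] by (simp add: mult.assoc)
  qed
  finally show ?thesis by (simp add: mult_ac)
qed

text \<open>These are \<open>(1 - x)\<close> times the coefficients in Monsky's proof that \<open>L(1) \<noteq> 0\<close>; the substitution
  \<open>x = y\<^sup>2\<close> keeps the arithmetic-geometric mean inequality free of roots.\<close>

lemma monsky_coefficient_decreasing:
  fixes y :: real
  assumes y: "0 < y" "y < 1" and n: "n > 0"
  defines "b \<equiv> \<lambda>n. 1 / real n - (y^2)^n / (\<Sum>i<n. (y^2)^i)"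
  shows "b (Suc n) \<le> b n" "0 \<le> b n"
proof -
  define x where "x = y^2"
  define s where "s n = (\<Sum>i<n. x ^ i)" for n
  have x: "0 < x" "x < 1" using y by (auto simp: x_def power_less_one_iff abs_square_less_1)
  have s1: "s n \<ge> real n * y ^ (n - 1)" "s (Suc n) \<ge> real (Suc n) * y ^ n"
    unfolding s_def x_def using geometric_sum_ge[of y n] geometric_sum_ge[of y "Suc n"] y n by auto
  have spos: "s n > 0" "s (Suc n) > 0"
    using s1 y n by (smt (verit) mult_pos_pos of_nat_0_less_iff zero_less_Suc zero_less_power)+
  have rec: "s (Suc n) = 1 + x * s n"
    unfolding s_def sum.lessThan_Suc_shift by (simp add: sum_distrib_left)
  have xn: "x ^ n = y ^ n * y ^ n" by (simp add: x_def power_mult_distrib[symmetric] power2_eq_square)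
  have yn: "y ^ n \<le> y ^ (n - 1)" using y by (intro power_decreasing) auto
  \<comment> \<open>Since \<open>rec\<close> collapses the difference of consecutive quotients to
    \<open>x ^ n / (s n * s (Suc n))\<close>, this inequality is exactly what the decrease of
    \<open>b\<close> requires.\<close>
  have prod: "real n * real (Suc n) * x ^ n \<le> s n * s (Suc n)"
  proof -
    have "(real n * y ^ n) * (real (Suc n) * y ^ n) \<le> s n * s (Suc n)"
    proof (rule mult_mono)
      show "real n * y ^ n \<le> s n" using s1(1) yn by (meson mult_left_mono of_nat_0_le_iff order_trans)
    qed (use s1 spos y in auto)
    then show ?thesis by (simp add: xn mult_ac)
  qed
  have "x ^ n / s n - x ^ Suc n / s (Suc n) = x ^ n * (s (Suc n) - x * s n) / (s n * s (Suc n))"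
    using spos by (simp add: field_simps)
  also have "\<dots> = x ^ n / (s n * s (Suc n))" by (simp add: rec)
  also have "\<dots> \<le> 1 / (real n * real (Suc n))"
  proof -
    have "0 < real n * real (Suc n)" "0 < s n * s (Suc n)" using n spos by auto
    then show ?thesis using prod
      by (metis (no_types, lifting) divide_le_eq divide_inverse inverse_eq_divide mult.commute mult.left_commute mult_1 pos_le_divide_eq)
  qed
  also have "\<dots> = 1 / real n - 1 / real (Suc n)" using n by (simp add: field_simps)
  finally show "b (Suc n) \<le> b n" unfolding b_def s_def x_def by linarith
  have "real n * x ^ n \<le> s n"
  proof -
    have "y ^ n * y ^ n \<le> y ^ n" using y by (simp add: mult_left_le_one_le power_le_one)
    then have "x ^ n \<le> y ^ (n - 1)" using xn yn by linarith
    then show ?thesis using s1(1) by (meson mult_left_mono of_nat_0_le_iff order_trans)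
  qed
  then have "x ^ n / s n \<le> 1 / real n" using spos n by (simp add: field_simps)
  then show "0 \<le> b n" unfolding b_def s_def x_def by linarith
qed

context quadratic_character
begin

text \<open>The sum of (1 * f)(n) x^n dominates the sum of x^(k^2), which is unbounded as x tends to
  1. As a Lambert series it is the sum of f(d) x^d / (1 - x^d). If L(1) = 0, subtracting L(1) / (1 -
  x) changes nothing but turns the coefficients into multiples of the decreasing \<open>b\<close>,
  and partial summation bounds everything by \<open>m\<close>.\<close>

lemma L1_nonzero: "L1 \<noteq> 0"
proof
  assume L0: "L1 = 0"
  have sq_bound: "(\<Sum>k=1..M. (y^2) ^ (k^2)) \<le> real m" if y: "0 < y" "y < 1" for y :: real and M
  proof -
    define x where "x = y^2"
    define s where "s n = (\<Sum>i<n. x ^ i)" for n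
    have x: "0 < x" "x < 1" using y by (auto simp: x_def power_less_one_iff abs_square_less_1)
    have geo: "(1 - x) * s n = 1 - x ^ n" for n unfolding s_def using x by (simp add: sum_gp_strict)
    define b where "b n = 1 / real n - x ^ n / s n" for n
    have b: "b (Suc n) \<le> b n" "0 \<le> b n" if "n > 0" for n
      unfolding b_def s_def x_def using monsky_coefficient_decreasing[OF y that] by auto
    \<comment> \<open>A version truncated at \<open>N\<close> keeps all sums finite. Its two error
      terms, the tail of L(1) and the geometric tails, vanish for fixed \<open>x\<close> as
      \<open>N\<close> grows.\<close>
    have bound: "(1 - x) * (\<Sum>k=1..M. x ^ (k^2)) \<le> (1 - x) * real m + real m / real N + real N * x ^ N"
      if N: "N \<ge> M^2" "N > 0" for N
    proof -
      have sum_fb: "\<bar>\<Sum>n\<in>{1..<Suc N}. f n * b n\<bar> \<le> real m * b 1"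
        by (rule abs_sum_mult_decreasing_le[OF abs_sum_le]) (use b in auto)
      have b1: "b 1 = 1 - x" by (simp add: b_def s_def)
      have tail: "\<bar>\<Sum>n\<in>{1..<Suc N}. f n / real n\<bar> \<le> real m / real N"
      proof -
        have "(\<Sum>n\<in>{1..<Suc N}. f n / real n) = (\<Sum>n<Suc N. f n / real n)"
          by (rule sum.mono_neutral_left) auto
        then have "\<bar>\<Sum>n\<in>{1..<Suc N}. f n / real n\<bar> \<le> real m / real (Suc N)"
          using L1_tail_le[of "Suc N"] L0 by simp
        also have "\<dots> \<le> real m / real N" using N by (intro divide_left_mono) auto
        finally show ?thesis .
      qed
      have "(\<Sum>k=1..M. x ^ (k^2)) = (\<Sum>n\<in>(\<lambda>k. k^2) ` {1..M}. x ^ n)"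
        by (subst sum.reindex) (auto simp: inj_on_def)
      also have "\<dots> \<le> (\<Sum>n\<in>(\<lambda>k. k^2) ` {1..M}. (\<Sum>d | d dvd n. f d) * x ^ n)"
        using x sum_divisors_square_ge_1 by (intro sum_mono) auto
      also have "\<dots> \<le> (\<Sum>n=1..N. (\<Sum>d | d dvd n. f d) * x ^ n)"
      proof (rule sum_mono2)
        show "(\<lambda>k. k^2) ` {1..M} \<subseteq> {1..N}"
        proof (rule image_subsetI)
          fix k assume "k \<in> {1..M}"
          then show "k\<^sup>2 \<in> {1..N}" using le_trans[OF power_mono[of k M 2] N(1)] by (auto simp: Suc_le_eq)
        qed
      qed (use x sum_divisors_nonneg in auto)
      also have "\<dots> = (\<Sum>n=1..N. \<Sum>d | d dvd n. f d * x ^ (d * (n div d)))"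
        by (intro sum.cong refl) (auto simp: sum_distrib_right)
      also have "\<dots> = (\<Sum>d=1..N. \<Sum>k=1..N div d. f d * x ^ (d * k))"
        by (rule sum_divisors_swap)
      also have "\<dots> \<le> (\<Sum>d=1..N. (f d * (x ^ d / s d) + x ^ N) / (1 - x))"
      proof (rule sum_mono)
        fix d assume d: "d \<in> {1..N}"
        define K where "K = N div d"
        have xd: "0 < x ^ d" "x ^ d < 1" using x d by (auto simp: power_less_one_iff)
        have sd: "s d > 0" using geo[of d] x xd by (smt (verit) mult_nonneg_nonpos)
        have g: "(\<Sum>k=1..K. x ^ (d * k)) = (x ^ d - x ^ (d * Suc K)) / (1 - x ^ d)"
          using xd by (subst power_mult, subst sum_gp) (auto simp: power_add power_mult)
        have gd: "1 - x ^ d = (1 - x) * s d" using geo by simp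
        have e: "(\<Sum>k=1..K. f d * x ^ (d * k)) = f d * (x ^ d / s d) / (1 - x) - f d * x ^ (d * Suc K) / ((1 - x) * s d)"
          unfolding sum_distrib_left[symmetric] g gd by (simp add: diff_divide_distrib right_diff_distrib) (simp add: algebra_simps)
        have s1: "s d \<ge> 1"
        proof -
          have "x ^ 0 \<le> s d" unfolding s_def by (rule member_le_sum) (use x d in auto)
          then show ?thesis by simp
        qed
        have "\<bar>f d * x ^ (d * Suc K) / ((1 - x) * s d)\<bar> \<le> x ^ N / (1 - x)"
        proof -
          have "N \<le> d * Suc K"
            unfolding K_def using d by (metis atLeastAtMost_iff dividend_less_times_div less_imp_le_nat less_le_trans mult_Suc_right zero_less_one add.commute)
          then have xx: "x ^ (d * Suc K) \<le> x ^ N" using x by (intro power_decreasing) auto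
          have "\<bar>f d * x ^ (d * Suc K) / ((1 - x) * s d)\<bar> = \<bar>f d\<bar> * x ^ (d * Suc K) / ((1 - x) * s d)"
            using x sd by (simp add: abs_mult)
          also have "\<dots> \<le> 1 * x ^ N / ((1 - x) * 1)"
            using xx abs_le_1[of d] s1 x by (intro frac_le mult_mono) auto
          finally show ?thesis by simp
        qed
        then show "(\<Sum>k=1..N div d. f d * x ^ (d * k)) \<le> (f d * (x ^ d / s d) + x ^ N) / (1 - x)"
          using e unfolding K_def add_divide_distrib by linarith
      qed
      also have "\<dots> = ((\<Sum>d=1..N. f d * (x ^ d / s d)) + real N * x ^ N) / (1 - x)"
        by (simp add: sum_divide_distrib[symmetric] sum.distrib)
      also have "(\<Sum>d=1..N. f d * (x ^ d / s d)) = (\<Sum>d=1..N. f d / real d) - (\<Sum>d=1..N. f d * b d)"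
        unfolding sum_subtractf[symmetric] by (intro sum.cong refl) (simp add: b_def algebra_simps)
      finally have "(1 - x) * (\<Sum>k=1..M. x ^ (k^2))
          \<le> (\<Sum>d=1..N. f d / real d) - (\<Sum>d=1..N. f d * b d) + real N * x ^ N"
        using x by (simp add: field_simps)
      then show ?thesis using tail sum_fb b1
        by (simp add: atLeastLessThanSuc_atLeastAtMost mult.commute)
    qed
    have "(1 - x) * (\<Sum>k=1..M. x ^ (k^2)) \<le> (1 - x) * real m + 0 + 0"
    proof (rule tendsto_lowerbound)
      show "(\<lambda>N. (1 - x) * real m + real m / real N + real N * x ^ N) \<longlonglongrightarrow> (1 - x) * real m + 0 + 0"
        using x by (intro tendsto_intros lim_const_over_n powser_times_n_limit_0) auto
      show "\<forall>\<^sub>F N in sequentially. (1 - x) * (\<Sum>k=1..M. x ^ (k^2))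
          \<le> (1 - x) * real m + real m / real N + real N * x ^ N"
        using eventually_ge_at_top[of "M^2 + 1"] by eventually_elim (rule bound, auto)
    qed simp
    then show ?thesis using x by (simp add: x_def)
  qed
  \<comment> \<open>One more square than the bound allows: letting \<open>y\<close> tend to 1 gives
    m + 1 \<le> m.\<close>
  define M where "M = Suc m"
  have "(\<Sum>k=1..M. (1^2) ^ (k^2)) \<le> real m"
  proof (rule tendsto_upperbound)
    show "((\<lambda>y. \<Sum>k=1..M. (y^2) ^ (k^2)) \<longlongrightarrow> (\<Sum>k=1..M. (1^2) ^ (k^2))) (at_left (1::real))"
      by (intro tendsto_intros)
    show "\<forall>\<^sub>F y in at_left 1. (\<Sum>k=1..M. (y^2) ^ (k^2)) \<le> real m"
      using eventually_at_left_real[of 0 "1::real", OF zero_less_one] by eventually_elim (rule sq_bound, auto)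
  qed simp
  then show False by (simp add: M_def)
qed

lemma ln_div_decreasing:
  assumes "n \<ge> 3"
  shows "ln (real (Suc n)) / real (Suc n) \<le> ln (real n) / real n"
proof (rule ln_x_over_x_mono)
  show "exp 1 \<le> real n" using exp_le assms by linarith
qed simp

text \<open>As ln is the convolution of 1 and the Mangoldt function, the bounded sum of f(n) ln n /
  n equals the sum over d of \<open>f d * mangoldt d / d\<close> times a truncation of L(1).
  Completing the truncation costs at most m d / N relative to each factor, which Chebyshev's bound
  turns into a bounded total. It remains to divide by L(1).\<close>

lemma sum_mangoldt_div_bounded:
  obtains C where "\<And>k. \<bar>\<Sum>d=1..2^k. f d * mangoldt d / real d\<bar> \<le> C"
proof -
  define D where "D = real m * (ln 3 / 3) + 3"
  have logsum: "\<bar>\<Sum>n=1..N. f n * (ln (real n) / real n)\<bar> \<le> D" for N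
  proof -
    have small: "\<bar>f n * (ln (real n) / real n)\<bar> \<le> 1" for n
    proof (cases "n = 0")
      case False
      have "ln (real n) \<le> real n" "0 \<le> ln (real n)" using False ln_bound[of "real n"] by auto
      then have "\<bar>ln (real n) / real n\<bar> \<le> 1" using False by simp
      then show ?thesis unfolding abs_mult using abs_le_1[of n] by (intro mult_le_one) auto
    qed simp
    have tl: "\<bar>\<Sum>n\<in>{3..<Suc N}. f n * (ln (real n) / real n)\<bar> \<le> real m * (ln (real 3) / real 3)"
      by (rule abs_sum_mult_decreasing_le[OF abs_sum_le]) (use ln_div_decreasing in auto)
    \<comment> \<open>The terms 1 and 2 are split off because ln x / x decreases only from e
      on.\<close>
    have "{1..N} = {n. n \<in> {1,2} \<and> n \<le> N} \<union> {3..<Suc N}" by auto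
    then have "(\<Sum>n=1..N. f n * (ln (real n) / real n)) =
      (\<Sum>n\<in>{n. n \<in> {1,2} \<and> n \<le> N}. f n * (ln (real n) / real n)) + (\<Sum>n\<in>{3..<Suc N}. f n * (ln (real n) / real n))"
      by (simp only:) (rule sum.union_disjoint, auto)
    moreover have "\<bar>\<Sum>n\<in>{n. n \<in> {1,2} \<and> n \<le> N}. f n * (ln (real n) / real n)\<bar> \<le> 2"
    proof -
      have "\<bar>\<Sum>n\<in>{n. n \<in> {1,2} \<and> n \<le> N}. f n * (ln (real n) / real n)\<bar>
          \<le> (\<Sum>n\<in>{n. n \<in> {1,2} \<and> n \<le> N}. \<bar>f n * (ln (real n) / real n)\<bar>)" by (rule sum_abs)
      also have "\<dots> \<le> (\<Sum>n\<in>{1,2}. \<bar>f n * (ln (real n) / real n)\<bar>)"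
        by (rule sum_mono2) auto
      also have "\<dots> \<le> (\<Sum>n\<in>{1::nat,2}. 1)" by (intro sum_mono small)
      finally show ?thesis by simp
    qed
    ultimately show ?thesis using tl unfolding D_def by simp
  qed
  have "\<bar>\<Sum>d=1..2^k. f d * mangoldt d / real d\<bar> \<le> (D + real m * (2 * ln 2)) / \<bar>L1\<bar>" for k
  proof -
    define N where "N = (2::nat)^k"
    define T where "T d = (\<Sum>j=1..N div d. f j / real j)" for d
    have "(\<Sum>n=1..N. f n * (ln (real n) / real n))
        = (\<Sum>n=1..N. \<Sum>d | d dvd n. (f d * mangoldt d / real d) * (f (n div d) / real (n div d)))"
    proof (rule sum.cong[OF refl])
      fix n assume n: "n \<in> {1..N}"
      have "f n * (ln (real n) / real n) = (\<Sum>d | d dvd n. mangoldt d * (f n / real n))"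
      proof -
        have "(\<Sum>d | d dvd n. mangoldt d * (f n / real n)) = (\<Sum>d | d dvd n. mangoldt d) * (f n / real n)"
          by (rule sum_distrib_right[symmetric])
        then show ?thesis using n by (simp add: mangoldt_sum)
      qed
      also have "\<dots> = (\<Sum>d | d dvd n. (f d * mangoldt d / real d) * (f (n div d) / real (n div d)))"
      proof (rule sum.cong[OF refl])
        fix d assume "d \<in> {d. d dvd n}"
        then obtain c where "n = d * c" by auto
        then show "mangoldt d * (f n / real n) = (f d * mangoldt d / real d) * (f (n div d) / real (n div d))"
          using n by (auto simp: mult)
      qed
      finally show "f n * (ln (real n) / real n) = \<dots>" .
    qed
    also have "\<dots> = (\<Sum>d=1..N. \<Sum>j=1..N div d. (f d * mangoldt d / real d) * (f j / real j))"
      by (rule sum_divisors_swap)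
    also have "\<dots> = (\<Sum>d=1..N. (f d * mangoldt d / real d) * T d)"
      by (simp add: T_def sum_distrib_left)
    finally have eq: "(\<Sum>n=1..N. f n * (ln (real n) / real n)) = (\<Sum>d=1..N. (f d * mangoldt d / real d) * T d)" .
    have "\<bar>\<Sum>d=1..N. (f d * mangoldt d / real d) * (L1 - T d)\<bar>
        \<le> (\<Sum>d=1..N. \<bar>(f d * mangoldt d / real d) * (L1 - T d)\<bar>)" by (rule sum_abs)
    also have "\<dots> \<le> (\<Sum>d=1..N. mangoldt d * (real m / real N))"
    proof (rule sum_mono)
      fix d assume d: "d \<in> {1..N}"
      have "T d = (\<Sum>n<Suc (N div d). f n / real n)"
        unfolding T_def by (rule sum.mono_neutral_left) auto
      then have "\<bar>L1 - T d\<bar> \<le> real m / real (Suc (N div d))" using L1_tail_le[of "Suc (N div d)"] by simp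
      also have "\<dots> \<le> real m * (real d / real N)"
      proof -
        have "N \<le> d * Suc (N div d)"
          using d by (metis atLeastAtMost_iff dividend_less_times_div less_imp_le_nat less_le_trans mult_Suc_right zero_less_one add.commute)
        then have "real N \<le> real d * real (Suc (N div d))" by (metis of_nat_le_iff of_nat_mult)
        then have "real m * real N \<le> real m * (real d * real (Suc (N div d)))" by (intro mult_left_mono) auto
        moreover have "real N > 0" using d by simp
        ultimately show ?thesis by (simp add: divide_simps mult_ac del: of_nat_Suc)
      qed
      finally have "\<bar>f d * mangoldt d / real d\<bar> * \<bar>L1 - T d\<bar> \<le> (1 * mangoldt d / real d) * (real m * (real d / real N))"
        using abs_le_1[of d] mangoldt_nonneg[of d]
        using mult_right_mono[OF abs_le_1[of d] mangoldt_nonneg[of d]]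
        by (intro mult_mono) (auto simp: abs_mult intro!: divide_right_mono)
      then show "\<bar>(f d * mangoldt d / real d) * (L1 - T d)\<bar> \<le> mangoldt d * (real m / real N)"
        using d by (simp add: abs_mult)
    qed
    also have "\<dots> = (\<Sum>d=1..N. mangoldt d) * (real m / real N)" by (rule sum_distrib_right[symmetric])
    also have "\<dots> \<le> (2 * 2^k * ln 2) * (real m / real N)"
      using sum_mangoldt_power2_le[of k] unfolding N_def by (intro mult_right_mono) auto
    also have "\<dots> = real m * (2 * ln 2)" by (simp add: N_def)
    finally have err: "\<bar>\<Sum>d=1..N. (f d * mangoldt d / real d) * (L1 - T d)\<bar> \<le> real m * (2 * ln 2)" .
    have "(\<Sum>d=1..N. f d * mangoldt d / real d) * L1
        = (\<Sum>d=1..N. (f d * mangoldt d / real d) * (L1 - T d)) + (\<Sum>d=1..N. (f d * mangoldt d / real d) * T d)"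
      unfolding sum_distrib_right sum.distrib[symmetric] distrib_left[symmetric] by simp
    then have "\<bar>(\<Sum>d=1..N. f d * mangoldt d / real d) * L1\<bar> \<le> D + real m * (2 * ln 2)"
      using err logsum[of N] eq by linarith
    then show ?thesis using L1_nonzero unfolding N_def by (simp add: abs_mult field_simps)
  qed
  then show ?thesis using that by blast
qed

end

section \<open>Legendre symbols as real characters\<close>

lemma Legendre_vals: "Legendre a p \<in> {-1, 0, 1}"
  by (auto simp: Legendre_def)

lemma Legendre_eq_0_iff: "Legendre a p = 0 \<longleftrightarrow> p dvd a"
  by (auto simp: Legendre_def cong_0_iff)

lemma Legendre_eq_1_iff: "\<not> p dvd a \<Longrightarrow> Legendre a p = 1 \<longleftrightarrow> QuadRes p a"
  by (auto simp: Legendre_def cong_0_iff)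

lemma Legendre_cong: "[a = b] (mod p) \<Longrightarrow> Legendre a p = Legendre b p"
  unfolding Legendre_def QuadRes_def by (auto simp: cong_def)

lemma Legendre_square: "\<not> p dvd a \<Longrightarrow> prime p \<Longrightarrow> Legendre (a\<^sup>2) p = 1"
  by (auto simp: Legendre_eq_1_iff QuadRes_def prime_dvd_power_iff intro: cong_refl)

text \<open>Euler's criterion gives a congruence; both sides lie between -1 and 1, so for p > 2 it
  is an equality.\<close>

lemma Legendre_mult:
  fixes p :: nat
  assumes "prime p" "2 < p"
  shows "Legendre (a * b) p = Legendre a p * Legendre b p"
proof -
  define k where "k = (p - 1) div 2"
  have e: "[Legendre c p = c ^ k] (mod p)" for c
    unfolding k_def using euler_criterion[OF assms] .
  have "[Legendre (a * b) p = Legendre a p * Legendre b p] (mod p)"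
    using cong_trans[OF e[of "a * b"] cong_sym[OF cong_mult[OF e[of a] e[of b], folded power_mult_distrib]]] .
  then have "int p dvd Legendre (a * b) p - Legendre a p * Legendre b p"
    by (simp add: cong_iff_dvd_diff)
  moreover have "\<bar>Legendre (a * b) p - Legendre a p * Legendre b p\<bar> < int p"
    using Legendre_vals[of "a*b" p] Legendre_vals[of a p] Legendre_vals[of b p] assms(2) by auto
  ultimately show ?thesis by (metis dvd_imp_le_int eq_iff_diff_eq_0 leD abs_of_nat)
qed

text \<open>Squaring identifies 1 with p - 1, so on the finite set of nonzero residues it is not
  injective, hence not surjective.\<close>

lemma Legendre_nonresidue_exists:
  fixes p :: nat
  assumes "prime p" "2 < p"
  obtains a :: nat where "Legendre (int a) (int p) = -1"
proof -
  let ?sq = "\<lambda>x::nat. x^2 mod p"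
  have sub: "?sq ` {1..<p} \<subseteq> {1..<p}"
  proof (rule image_subsetI)
    fix x assume x: "x \<in> {1..<p}"
    then have "\<not> p dvd x" by (auto dest: dvd_imp_le)
    then have "\<not> p dvd x^2" using assms by (simp add: prime_dvd_power_iff)
    then show "?sq x \<in> {1..<p}" using assms by (auto simp: Suc_le_eq mod_greater_zero_iff_not_dvd)
  qed
  have "?sq 1 = ?sq (p - 1)"
  proof -
    obtain n where "p = n + 2" using assms(2) by (metis add.commute le_Suc_ex less_imp_le_nat)
    then have "(p - 1)^2 = 1 + (p - 2) * p" by (simp add: power2_eq_square algebra_simps)
    then have "(p - 1)^2 mod p = 1 mod p" by (simp only: mod_mult_self1)
    then show ?thesis by simp
  qed
  moreover have "1 \<in> {1..<p}" "p - 1 \<in> {1..<p}" "1 \<noteq> p - 1" using assms(2) by auto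
  ultimately have "\<not> inj_on ?sq {1..<p}" unfolding inj_on_def by blast
  then have "?sq ` {1..<p} \<noteq> {1..<p}" by (metis eq_card_imp_inj_on finite_atLeastLessThan)
  then obtain a where a: "a \<in> {1..<p}" "a \<notin> ?sq ` {1..<p}" using sub by blast
  have "\<not> QuadRes (int p) (int a)"
  proof
    assume "QuadRes (int p) (int a)"
    then obtain y where y: "[y^2 = int a] (mod int p)" by (auto simp: QuadRes_def)
    define x where "x = nat (y mod int p)"
    have x: "int x = y mod int p" using assms by (simp add: x_def)
    have "int (?sq x) = (y mod int p)^2 mod int p" by (simp add: x zmod_int)
    also have "\<dots> = int a mod int p" using y by (simp add: cong_def power_mod)
    also have "\<dots> = int a" using a by simp
    finally have ax: "?sq x = a" by simp
    moreover have "x < p" using x assms by (metis of_nat_less_iff pos_mod_bound prime_gt_0_nat of_nat_0_less_iff)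
    moreover have "x \<noteq> 0" using ax a(1) by (intro notI) auto
    ultimately show False using a(2) by force
  qed
  moreover have "\<not> int p dvd int a" using a(1) by (auto dest: dvd_imp_le)
  ultimately have "Legendre (int a) (int p) = -1" by (auto simp: Legendre_def cong_0_iff)
  then show ?thesis using that by blast
qed

text \<open>The character attached to the prime 2 is the nontrivial character modulo 4.\<close>

definition qchar :: "nat \<Rightarrow> nat \<Rightarrow> real" where
  "qchar q n = (if q = 2 then (if even n then 0 else if n mod 4 = 1 then 1 else -1)
     else of_int (Legendre (int n) (int q)))"

definition qmod :: "nat \<Rightarrow> nat" where
  "qmod q = (if q = 2 then 4 else q)"

lemma qchar_vals: "qchar q n \<in> {-1, 0, 1}"
  using Legendre_vals[of "int n" "int q"] by (auto simp: qchar_def)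

lemma qchar_eq_0_iff: "qchar q n = 0 \<longleftrightarrow> q dvd n"
  by (auto simp: qchar_def Legendre_eq_0_iff)

lemma odd_mult_mod_4:
  fixes a b :: nat
  assumes "odd a" "odd b"
  shows "(a * b) mod 4 = 1 \<longleftrightarrow> (a mod 4 = 1 \<longleftrightarrow> b mod 4 = 1)"
proof -
  have "a mod 4 = 1 \<or> a mod 4 = 3" "b mod 4 = 1 \<or> b mod 4 = 3"
    using assms by presburger+
  then show ?thesis by (auto simp: mod_mult_eq[of a 4 b, symmetric])
qed

lemma qchar_mult: "prime q \<Longrightarrow> qchar q (a * b) = qchar q a * qchar q b"
  using Legendre_mult[of q "int a" "int b"] prime_gt_1_nat[of q] odd_mult_mod_4[of a b]
  by (cases "q = 2") (auto simp: qchar_def)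

lemma qchar_one: "prime q \<Longrightarrow> qchar q 1 = 1"
  using Legendre_square[of "int q" 1] prime_gt_1_nat[of q] by (auto simp: qchar_def)

lemma qchar_power: "prime q \<Longrightarrow> qchar q (a ^ k) = qchar q a ^ k"
  using qchar_one by (induction k) (auto simp: qchar_mult)

lemma qchar_cong:
  assumes "[a = b] (mod qmod q)"
  shows "qchar q a = qchar q b"
proof (cases "q = 2")
  case True
  then have "a mod 4 = b mod 4" using assms by (simp add: cong_def qmod_def)
  moreover from this have "even a = even b" by presburger
  ultimately show ?thesis using True by (simp add: qchar_def)
next
  case False
  then show ?thesis using assms Legendre_cong[of "int a" "int b" "int q"]
    by (simp add: qchar_def qmod_def cong_int_iff)
qed

lemma qchar_minus_one_exists:
  assumes "prime q"
  obtains a where "qchar q a = -1"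
proof (cases "q = 2")
  case True
  have "qchar 2 3 = -1" by (simp add: qchar_def)
  then show ?thesis using True that by blast
next
  case False
  then have "2 < q" using prime_ge_2_nat[OF assms] by simp
  then obtain a where "Legendre (int a) (int q) = -1" using Legendre_nonresidue_exists[OF assms] by blast
  then have "qchar q a = -1" using False by (simp add: qchar_def)
  then show ?thesis using that by blast
qed

lemma coprime_qmod:
  assumes "prime p" "prime q" "p \<noteq> q"
  shows "coprime (qmod p) (qmod q)"
proof -
  have "qmod r dvd r^2" if "prime r" for r :: nat by (auto simp: qmod_def)
  moreover have "coprime (p^2) (q^2)" using assms by (simp add: primes_coprime)
  ultimately show ?thesis using assms coprime_divisors[of "qmod p" "p^2" "qmod q" "q^2"] by simp
qed

text \<open>By the Chinese remainder theorem some \<open>a\<close> has value -1 at one prime of the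
  nonempty set \<open>S\<close> and 1 at the others. Multiplication by \<open>a\<close> permutes the
  residues and negates the product, so the sum over a period equals its own negative.\<close>

lemma quadratic_character_prod_qchar:
  assumes S: "finite S" "S \<noteq> {}" "\<And>q. q \<in> S \<Longrightarrow> prime q"
  shows "quadratic_character (\<lambda>n. \<Prod>q\<in>S. qchar q n) (\<Prod>q\<in>S. qmod q)"
proof -
  define f where "f n = (\<Prod>q\<in>S. qchar q n)" for n
  define m where "m = (\<Prod>q\<in>S. qmod q)"
  have mpos: "m > 0" unfolding m_def using S(3) by (auto simp: qmod_def prod_pos prime_gt_0_nat)
  have f_cong: "f a = f b" if "[a = b] (mod m)" for a b
    unfolding f_def using that S
    by (intro prod.cong refl qchar_cong) (auto simp: m_def intro: cong_dvd_modulus_nat)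
  have f_mult: "f (a * b) = f a * f b" for a b
    unfolding f_def prod.distrib[symmetric] using S(3) by (intro prod.cong refl qchar_mult)
  have f_vals: "f n \<in> {-1, 0, 1}" for n
    unfolding f_def using S(1)
  proof (induction S rule: finite_induct)
    case (insert q S)
    then show ?case using qchar_vals[of q n] by auto
  qed simp
  obtain a where a: "f a = -1"
  proof -
    obtain q where q: "q \<in> S" using S(2) by blast
    obtain b where b: "qchar q b = -1" using qchar_minus_one_exists S(3) q by blast
    obtain a where a: "\<forall>p\<in>S. [a = (if p = q then b else 1)] (mod qmod p)"
      using chinese_remainder_nat[OF S(1), of qmod "\<lambda>p. if p = q then b else 1"] coprime_qmod S(3) by blast
    have "f a = (\<Prod>p\<in>S. if p = q then -1 else 1)"
      unfolding f_def
    proof (intro prod.cong refl)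
      fix p assume p: "p \<in> S"
      then have "[a = (if p = q then b else 1)] (mod qmod p)" using a by blast
      then have "qchar p a = qchar p (if p = q then b else 1)" by (rule qchar_cong)
      then show "qchar p a = (if p = q then -1 else 1)" using b qchar_one[OF S(3)[OF p]] by auto
    qed
    also have "\<dots> = -1" using S(1) q by (simp add: prod.delta)
    finally show ?thesis using that by blast
  qed
  have coa: "coprime a m"
    unfolding m_def
  proof (rule prod_coprime_right)
    fix q assume q: "q \<in> S"
    have "qchar q a \<noteq> 0" using a q S(1) prod_zero[of S "\<lambda>q. qchar q a"] by (auto simp: f_def)
    then have "coprime q a" using S(3)[OF q] by (auto simp: qchar_eq_0_iff intro: prime_imp_coprime)
    then have "coprime a (q^2)" by (simp add: coprime_commute)
    moreover have "qmod q dvd q^2" by (auto simp: qmod_def)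
    ultimately show "coprime a (qmod q)" using coprime_divisors[of a a "qmod q" "q^2"] by simp
  qed
  have "(\<Sum>n<m. f n) = (\<Sum>n<m. f (a * n mod m))"
  proof (rule sum.reindex_bij_betw[symmetric])
    have "inj_on (\<lambda>n. a * n mod m) {..<m}"
    proof (rule inj_onI)
      fix x y assume xy: "x \<in> {..<m}" "y \<in> {..<m}" "a * x mod m = a * y mod m"
      then have "[a * x = a * y] (mod m)" by (simp add: cong_def)
      then have "[x = y] (mod m)" using coa by (simp add: cong_mult_lcancel_nat)
      then show "x = y" using xy by (auto simp: cong_def)
    qed
    moreover from this have "(\<lambda>n. a * n mod m) ` {..<m} = {..<m}"
      using mpos by (intro endo_inj_surj) auto
    ultimately show "bij_betw (\<lambda>n. a * n mod m) {..<m} {..<m}" by (simp add: bij_betw_def)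
  qed
  also have "\<dots> = (\<Sum>n<m. - f n)"
  proof (rule sum.cong[OF refl])
    fix n
    have "f (a * n mod m) = f (a * n)" by (rule f_cong) (simp add: cong_def)
    then show "f (a * n mod m) = - f n" using f_mult a by simp
  qed
  finally have sum0: "(\<Sum>n<m. f n) = 0" by (simp add: sum_negf)
  have "quadratic_character f m"
  proof
    show "f 1 = 1" unfolding f_def using S(3) qchar_one by simp
    show "f (n + m) = f n" for n by (rule f_cong) (simp add: cong_def)
  qed (use mpos f_vals f_mult sum0 in auto)
  then show ?thesis unfolding f_def m_def .
qed

section \<open>Primes with prescribed quadratic symbols\<close>

lemma sum_inverse_powers_le_1:
  fixes p :: nat
  assumes "2 \<le> p"
  shows "(\<Sum>j=1..N. 1 / real (p ^ j)) \<le> 1"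
proof -
  have "(\<Sum>j=1..N. 1 / real (p ^ j)) \<le> (\<Sum>j=1..N. 1 / 2 ^ j)"
  proof (rule sum_mono)
    fix j
    have "(2::real) ^ j \<le> real (p ^ j)" using assms by (simp add: power_mono)
    then show "1 / real (p ^ j) \<le> 1 / 2 ^ j" by (intro divide_left_mono) (use assms in auto)
  qed
  also have "\<dots> = 1 - 1 / 2 ^ N" by (induction N) (auto simp: field_simps)
  finally show ?thesis by (smt (verit) divide_nonneg_pos zero_less_power)
qed

text \<open>Weight d by the product of the factors \<open>e q * qchar q d + 1\<close>. If no prime
  had the prescribed symbols, only powers of primes in \<open>P\<close> would survive and the
  weighted Mertens sum would stay bounded. Expanded over subsets of \<open>P\<close>, the empty set
  contributes the unbounded sum of \<open>mangoldt d / d\<close>, every other subset a bounded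
  character sum.\<close>

lemma exists_prime_with_qchar_aux:
  assumes P: "finite P" "\<And>q. q \<in> P \<Longrightarrow> prime q"
    and eps: "\<And>q. q \<in> P \<Longrightarrow> e q \<in> {-1, 1}"
    and q0: "q0 \<in> P" "e q0 = -1"
  shows "\<exists>l. prime l \<and> (\<forall>q\<in>P. qchar q l = e q)"
proof (rule ccontr)
  assume none: "\<not> ?thesis"
  define c where "c = (2::real) ^ card P"
  define t where "t d = (\<Prod>q\<in>P. e q * qchar q d + 1) * mangoldt d / real d" for d
  have factor: "0 \<le> e q * qchar q d + 1 \<and> e q * qchar q d + 1 \<le> 2" if "q \<in> P" for q d
    using eps[OF that] qchar_vals[of q d] by auto
  have t_le: "t d \<le> c * mangoldt d / real d" for d
  proof -
    have "(\<Prod>q\<in>P. e q * qchar q d + 1) \<le> (\<Prod>q\<in>P. 2)" by (rule prod_mono) (use factor in auto)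
    then have "(\<Prod>q\<in>P. e q * qchar q d + 1) \<le> c" by (simp add: c_def)
    then show ?thesis unfolding t_def using mangoldt_nonneg[of d] by (intro divide_right_mono mult_right_mono) auto
  qed
  have t_0: "t d = 0" if d: "d \<notin> (\<lambda>(p,j). p ^ j) ` (P \<times> {1..N})" "d \<in> {1..N}" for d N
  proof (cases "primepow d")
    case True
    then obtain p k where pk: "prime p" "k > 0" "d = p ^ k" by (auto simp: primepow_def)
    have "k < p ^ k" using prime_gt_1_nat[OF pk(1)] by (simp add: power_gt_expt)
    then have "k \<le> N" using d(2) pk by auto
    then have pP: "p \<notin> P" using d(1) pk by force
    have "\<exists>q\<in>P. qchar q d \<noteq> e q"
    proof (rule ccontr)
      assume "\<not> ?thesis"
      then have all: "qchar q p ^ k = e q" if "q \<in> P" for q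
        using that pk P(2) by (simp add: qchar_power)
      \<comment> \<open>This is the purpose of \<open>q0\<close>: an even power has no symbol -1.
        With odd exponent the prime itself has the same symbols as its power.\<close>
      have "odd k"
      proof (rule ccontr)
        assume "\<not> odd k"
        then have "qchar q0 p ^ k \<ge> 0" by (simp add: zero_le_even_power)
        then show False using all[OF q0(1)] q0(2) by simp
      qed
      have "qchar q p = e q" if "q \<in> P" for q
        using all[OF that] qchar_vals[of q p] \<open>odd k\<close> pk(2) by (auto simp: zero_power)
      then show False using none pk(1) by blast
    qed
    then obtain q where q: "q \<in> P" "qchar q d \<noteq> e q" by blast
    have "\<not> q dvd d"
    proof
      assume "q dvd d"
      then have "q dvd p" using pk P(2)[OF q(1)] prime_dvd_power by blast
      then show False using pk(1) P(2)[OF q(1)] pP q(1) primes_dvd_imp_eq by blast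
    qed
    then have "e q * qchar q d + 1 = 0"
      using q eps[OF q(1)] qchar_vals[of q d] qchar_eq_0_iff[of q d] by auto
    then have "(\<Prod>q\<in>P. e q * qchar q d + 1) = 0" using q(1) P(1) by (auto simp: prod_zero_iff)
    then show ?thesis by (simp add: t_def)
  next
    case False
    then show ?thesis by (simp add: t_def mangoldt_def)
  qed
  define U where "U = (\<Sum>p\<in>P. c * ln (real p))"
  have upper: "(\<Sum>d=1..N. t d) \<le> U" for N
  proof -
    define B where "B = (\<lambda>(p,j). p ^ j) ` (P \<times> {1..N})"
    have fB: "finite B" using P(1) by (simp add: B_def)
    have g0: "0 \<le> c * mangoldt d / real d" for d using mangoldt_nonneg[of d] by (simp add: c_def)
    have "(\<Sum>d=1..N. t d) = (\<Sum>d\<in>{1..N} \<inter> B. t d)"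
      by (rule sum.mono_neutral_right) (use t_0[of _ N] in \<open>auto simp: B_def\<close>)
    also have "\<dots> \<le> (\<Sum>d\<in>{1..N} \<inter> B. c * mangoldt d / real d)" by (intro sum_mono t_le)
    also have "\<dots> \<le> (\<Sum>d\<in>B. c * mangoldt d / real d)" by (rule sum_mono2) (use fB g0 in auto)
    also have "\<dots> \<le> sum ((\<lambda>d. c * mangoldt d / real d) \<circ> (\<lambda>(p,j). p ^ j)) (P \<times> {1..N})"
      unfolding B_def by (rule sum_image_le) (use P(1) g0 in auto)
    also have "\<dots> = (\<Sum>p\<in>P. \<Sum>j=1..N. c * mangoldt (p ^ j) / real (p ^ j))"
      unfolding sum.cartesian_product by (intro sum.cong refl) auto
    also have "\<dots> \<le> U"
      unfolding U_def
    proof (rule sum_mono)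
      fix p assume p: "p \<in> P"
      have "(\<Sum>j=1..N. c * mangoldt (p ^ j) / real (p ^ j)) = (\<Sum>j=1..N. c * ln (real p) * (1 / real (p ^ j)))"
        using P(2)[OF p] by (intro sum.cong refl) auto
      also have "\<dots> = c * ln (real p) * (\<Sum>j=1..N. 1 / real (p ^ j))" by (rule sum_distrib_left[symmetric])
      also have "\<dots> \<le> c * ln (real p) * 1"
        using prime_ge_2_nat[OF P(2)[OF p]]
        by (intro mult_left_mono sum_inverse_powers_le_1) (auto simp: c_def)
      finally show "(\<Sum>j=1..N. c * mangoldt (p ^ j) / real (p ^ j)) \<le> c * ln (real p)" by simp
    qed
    finally show ?thesis .
  qed
  define W where "W S k = (\<Sum>d=1..2^k. (\<Prod>q\<in>S. qchar q d) * mangoldt d / real d)" for S and k :: nat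
  have "\<exists>C. \<forall>k. \<bar>W S k\<bar> \<le> C" if S: "S \<in> Pow P - {{}}" for S
  proof -
    interpret quadratic_character "\<lambda>n. \<Prod>q\<in>S. qchar q n" "\<Prod>q\<in>S. qmod q"
      using S P finite_subset by (intro quadratic_character_prod_qchar) auto
    show ?thesis using sum_mangoldt_div_bounded unfolding W_def by metis
  qed
  then obtain C where C: "\<bar>W S k\<bar> \<le> C S" if "S \<in> Pow P - {{}}" for S k by metis
  have fin: "finite (Pow P)" using P(1) by simp
  have expand: "(\<Sum>d=1..2^k. t d) = (\<Sum>S\<in>Pow P. prod e S * W S k)" for k :: nat
  proof -
    have "(\<Sum>d=1..2^k. t d) = (\<Sum>d=1..2^k. \<Sum>S\<in>Pow P. prod e S * ((\<Prod>q\<in>S. qchar q d) * mangoldt d / real d))"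
    proof (rule sum.cong[OF refl])
      fix d :: nat
      have "(\<Prod>q\<in>P. e q * qchar q d + 1) = (\<Sum>S\<in>Pow P. (\<Prod>q\<in>S. e q * qchar q d) * (\<Prod>q\<in>P - S. 1))"
        by (rule prod_add[OF P(1)])
      then have "(\<Prod>q\<in>P. e q * qchar q d + 1) = (\<Sum>S\<in>Pow P. prod e S * (\<Prod>q\<in>S. qchar q d))"
        by (simp add: prod.distrib)
      then show "t d = (\<Sum>S\<in>Pow P. prod e S * ((\<Prod>q\<in>S. qchar q d) * mangoldt d / real d))"
        unfolding t_def by (simp only: sum_distrib_right sum_divide_distrib mult.assoc times_divide_eq_right)
    qed
    also have "\<dots> = (\<Sum>S\<in>Pow P. \<Sum>d=1..2^k. prod e S * ((\<Prod>q\<in>S. qchar q d) * mangoldt d / real d))"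
      by (rule sum.swap)
    also have "\<dots> = (\<Sum>S\<in>Pow P. prod e S * W S k)" unfolding W_def by (simp add: sum_distrib_left)
    finally show ?thesis .
  qed
  have lower: "(\<Sum>d=1..2^k. t d) \<ge> (real k - 2) / 2 * ln 2 - (\<Sum>S\<in>Pow P - {{}}. C S)" for k :: nat
  proof -
    have "(\<Sum>S\<in>Pow P. prod e S * W S k) = W {} k + (\<Sum>S\<in>Pow P - {{}}. prod e S * W S k)"
      using fin by (subst sum.remove[of _ "{}"]) auto
    moreover have "W {} k \<ge> (real k - 2) / 2 * ln 2"
      unfolding W_def using sum_mangoldt_div_power2_ge[of k] by simp
    moreover have "\<bar>\<Sum>S\<in>Pow P - {{}}. prod e S * W S k\<bar> \<le> (\<Sum>S\<in>Pow P - {{}}. C S)"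
    proof (rule order_trans[OF sum_abs], rule sum_mono)
      fix S assume S: "S \<in> Pow P - {{}}"
      have "\<bar>prod e S\<bar> = (\<Prod>q\<in>S. \<bar>e q\<bar>)" by (rule abs_prod)
      also have "\<dots> = 1" using S eps by (intro prod.neutral) fastforce
      finally show "\<bar>prod e S * W S k\<bar> \<le> C S" using C[OF S] by (simp add: abs_mult)
    qed
    ultimately show ?thesis unfolding expand by linarith
  qed
  define b where "b = U + (\<Sum>S\<in>Pow P - {{}}. C S)"
  obtain k :: nat where k: "real k > 2 * b / ln 2 + 2" using reals_Archimedean2 by blast
  have ln2: "ln 2 > (0::real)" by simp
  have "(real k - 2) * ln 2 > 2 * b / ln 2 * ln 2"
    by (rule mult_strict_right_mono[OF _ ln2]) (use k in linarith)
  moreover have "2 * b / ln 2 * ln 2 = 2 * b" using ln2 by simp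
  ultimately have "(real k - 2) / 2 * ln 2 > b" by linarith
  then show False using lower[of k] upper[of "2^k"] unfolding b_def by linarith
qed

text \<open>A fresh prime with prescribed value -1 supplies the negative sign that the auxiliary
  version asks for.\<close>

theorem exists_prime_with_qchar:
  assumes P: "finite P" "\<And>q. q \<in> P \<Longrightarrow> prime q"
    and eps: "\<And>q. q \<in> P \<Longrightarrow> e q \<in> {-1, 1}"
  shows "\<exists>l. prime l \<and> (\<forall>q\<in>P. qchar q l = e q)"
proof -
  have "\<exists>q::nat. prime q \<and> q \<notin> P" using primes_infinite P(1) by (metis finite_subset mem_Collect_eq subsetI)
  then obtain q0 :: nat where q0: "prime q0" "q0 \<notin> P" by blast
  have "\<exists>l. prime l \<and> (\<forall>q\<in>insert q0 P. qchar q l = (e(q0 := -1)) q)"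
    by (rule exists_prime_with_qchar_aux[of _ _ q0]) (use P eps q0 in auto)
  then show ?thesis using q0 by (metis fun_upd_other insertCI)
qed

section \<open>Legendre's theorem and the product formula\<close>

text \<open>Square roots modulo the prime factors are glued by the Chinese remainder theorem;
  squarefreeness keeps each prime coprime to its cofactor.\<close>

lemma QuadRes_squarefree:
  fixes a m :: int
  assumes "squarefree a" "a \<noteq> 0" "\<And>p. prime p \<Longrightarrow> p dvd a \<Longrightarrow> QuadRes p m"
  shows "QuadRes a m"
  using assms
proof (induction "nat \<bar>a\<bar>" arbitrary: a rule: less_induct)
  case less
  show ?case
  proof (cases "is_unit a")
    case True
    have "[0\<^sup>2 = m] (mod a)"
      unfolding cong_iff_dvd_diff using True by (rule unit_imp_dvd)
    then show ?thesis unfolding QuadRes_def by blast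
  next
    case False
    obtain p where p: "prime p" "p dvd a" using False less.prems(2) prime_divisor_exists by metis
    obtain b where b: "a = p * b" using p by blast
    have cop: "coprime p b"
    proof (rule prime_imp_coprime[OF p(1)], rule notI)
      assume "p dvd b"
      then have "p\<^sup>2 dvd a" unfolding b power2_eq_square by (rule mult_dvd_mono[OF dvd_refl])
      then show False using less.prems(1) p(1) by (auto simp: squarefree_def)
    qed
    have sqb: "squarefree b" using less.prems(1) squarefree_multD(2) unfolding b by blast
    have "b \<noteq> 0" using b less.prems(2) by auto
    moreover have "\<bar>p\<bar> > 1" using p(1) prime_gt_1_int by fastforce
    ultimately have "nat \<bar>b\<bar> < nat \<bar>a\<bar>" unfolding b abs_mult by auto
    then have "QuadRes b m" using less.hyps[of b] sqb \<open>b \<noteq> 0\<close> less.prems(3) b by simp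
    then obtain v where v: "[v\<^sup>2 = m] (mod b)" unfolding QuadRes_def by blast
    obtain u where u: "[u\<^sup>2 = m] (mod p)" using less.prems(3) p unfolding QuadRes_def by blast
    obtain x where x: "[x = u] (mod p)" "[x = v] (mod b)" using binary_chinese_remainder_int[OF cop] by blast
    have "[x\<^sup>2 = m] (mod p)" "[x\<^sup>2 = m] (mod b)"
      using x u v by (metis cong_pow cong_trans)+
    then have "[x\<^sup>2 = m] (mod p * b)" using cop by (simp add: coprime_cong_mult)
    then show ?thesis unfolding b QuadRes_def by blast
  qed
qed

definition isotropic3 :: "int \<Rightarrow> int \<Rightarrow> int \<Rightarrow> bool" where
  "isotropic3 a b c \<longleftrightarrow> (\<exists>x y z. (x, y, z) \<noteq> (0, 0, 0) \<and> a * x\<^sup>2 + b * y\<^sup>2 + c * z\<^sup>2 = 0)"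

lemma squarefree_square_eq_1:
  fixes k n :: int
  assumes "squarefree n" "n = k\<^sup>2"
  shows "n = 1"
proof -
  have "k\<^sup>2 dvd n" using assms(2) by simp
  then have "is_unit k" using assms(1) by (auto simp: squarefree_def)
  then show ?thesis using assms(2) by (auto simp: abs_if power2_eq_square split: if_splits)
qed

text \<open>Box sides for a pigeonhole argument: \<open>k\<close> values per coordinate give at
  least sqrt n of them, and the difference of two still has square strictly below \<open>n\<close>,
  also when \<open>n\<close> is a square.\<close>

lemma ceiling_sqrt_bounds:
  fixes n :: int
  assumes "n > 0"
  defines "k \<equiv> \<lceil>sqrt (of_int n)\<rceil>"
  shows "k > 0" "n \<le> k\<^sup>2" "\<And>x. \<bar>x\<bar> < k \<Longrightarrow> x\<^sup>2 < n"
proof -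
  show "k > 0" using assms by simp
  have s: "sqrt (of_int n) \<le> of_int k" unfolding k_def by (rule le_of_int_ceiling)
  have "real_of_int n = (sqrt (of_int n))\<^sup>2" using assms by simp
  also have "\<dots> \<le> (of_int k)\<^sup>2" using s assms by (intro power_mono) auto
  finally show "n \<le> k\<^sup>2" by (metis of_int_le_iff of_int_power)
  fix x :: int assume "\<bar>x\<bar> < k"
  then have "real_of_int \<bar>x\<bar> < sqrt (of_int n)" unfolding k_def by (simp add: less_ceiling_iff)
  then have "(real_of_int \<bar>x\<bar>)\<^sup>2 < (sqrt (of_int n))\<^sup>2" by (intro power_strict_mono) auto
  then have "real_of_int (x\<^sup>2) < real_of_int n" using assms by simp
  then show "x\<^sup>2 < n" by linarith
qed

text \<open>Modulo \<open>a\<close>, \<open>b\<close> times the form factors as (bx - uy)(bx + uy),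
  because u^2 is congruent to -bc.\<close>

lemma dvd_form_of_linear_congruence:
  fixes a b c u x y :: int
  assumes "[u\<^sup>2 = - b * c] (mod a)" "a dvd b * x - u * y" "coprime a b"
  shows "a dvd b * x\<^sup>2 + c * y\<^sup>2"
proof -
  have "a dvd (b * x - u * y) * (b * x + u * y) + (u\<^sup>2 - - b * c) * y\<^sup>2"
    using assms(1,2) by (simp add: cong_iff_dvd_diff)
  also have "\<dots> = b * (b * x\<^sup>2 + c * y\<^sup>2)" by (simp add: algebra_simps power2_eq_square)
  finally show ?thesis using assms(3) by (simp add: coprime_dvd_mult_right_iff)
qed

text \<open>Three linear congruences modulo a, b, c have abc joint residue classes, while a box with
  sides about sqrt(bc), sqrt(ac), sqrt(ab) has more points. The difference of two points in one
  class makes \<open>V\<close> a multiple of abc strictly between -abc and 2abc, so \<open>V\<close>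
  is 0 or abc.\<close>

lemma legendre_aux:
  fixes a b c :: int
  assumes pos: "a > 0" "b > 0" "c > 0"
    and sqf: "squarefree a" "squarefree b" "squarefree c"
    and cop: "coprime a b" "coprime b c" "coprime c a"
    and qa: "QuadRes a (b * c)" and qb: "QuadRes b (c * a)" and qc: "QuadRes c (- a * b)"
  shows "isotropic3 a b (- c)"
proof (cases "a = 1 \<and> b = 1 \<and> c = 1")
  case True
  then show ?thesis unfolding isotropic3_def by (intro exI[of _ 1] exI[of _ 0] exI[of _ 1]) auto
next
  case False
  obtain u where u: "[u\<^sup>2 = b * c] (mod a)" using qa unfolding QuadRes_def by blast
  obtain v where v: "[v\<^sup>2 = c * a] (mod b)" using qb unfolding QuadRes_def by blast
  obtain w where w: "[w\<^sup>2 = - a * b] (mod c)" using qc unfolding QuadRes_def by blast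
  define k1 where "k1 = \<lceil>sqrt (of_int (b * c))\<rceil>"
  define k2 where "k2 = \<lceil>sqrt (of_int (a * c))\<rceil>"
  define k3 where "k3 = \<lceil>sqrt (of_int (a * b))\<rceil>"
  have p: "b * c > 0" "a * c > 0" "a * b > 0" using pos by auto
  note K1 = ceiling_sqrt_bounds[OF p(1), folded k1_def]
  note K2 = ceiling_sqrt_bounds[OF p(2), folded k2_def]
  note K3 = ceiling_sqrt_bounds[OF p(3), folded k3_def]
  \<comment> \<open>The box must have strictly more points than there are classes. A squarefree
    product that is a square equals 1, and bc and ac cannot both be 1 once a = b = c = 1 is set
    aside.\<close>
  have "(a * b * c)\<^sup>2 < (k1 * k2 * k3)\<^sup>2"
  proof -
    have sq: "squarefree (b * c)" "squarefree (a * c)" "squarefree (a * b)"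
      using sqf cop by (auto simp: squarefree_mult_coprime coprime_commute)
    have "b * c \<noteq> 1 \<or> a * c \<noteq> 1" using False pos by (auto simp: zmult_eq_1_iff)
    then have strict: "b * c < k1\<^sup>2 \<or> a * c < k2\<^sup>2"
      using squarefree_square_eq_1[OF sq(1), of k1] squarefree_square_eq_1[OF sq(2), of k2] K1(2) K2(2) by linarith
    have "(b * c) * (a * c) < k1\<^sup>2 * k2\<^sup>2"
      using strict
    proof
      assume "b * c < k1\<^sup>2"
      then show ?thesis using K2(2) p by (intro mult_less_le_imp_less) auto
    next
      assume "a * c < k2\<^sup>2"
      then show ?thesis using K1(2) p by (intro mult_le_less_imp_less) auto
    qed
    then have "(b * c) * (a * c) * (a * b) < k1\<^sup>2 * k2\<^sup>2 * k3\<^sup>2"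
      by (rule mult_less_le_imp_less) (use K3(2) p in auto)
    then show ?thesis by (simp add: power2_eq_square mult_ac)
  qed
  then have big: "a * b * c < k1 * k2 * k3"
    by (rule power2_less_imp_less) (use K1(1) K2(1) K3(1) in simp)
  define F where "F = (\<lambda>(x, y, z). ((b * y - u * z) mod a, (c * z - v * x) mod b, (a * x - w * y) mod c))"
  define Bx where "Bx = {0..<k1} \<times> {0..<k2} \<times> {0..<k3}"
  have "F ` Bx \<subseteq> {0..<a} \<times> {0..<b} \<times> {0..<c}" using pos by (auto simp: F_def)
  then have "card (F ` Bx) \<le> card ({0..<a} \<times> {0..<b} \<times> {0..<c})" by (intro card_mono) auto
  also have "\<dots> = nat (a * b * c)" using pos by (simp add: card_cartesian_product nat_mult_distrib mult_ac)
  also have "\<dots> < nat (k1 * k2 * k3)" using big pos by (subst nat_less_eq_zless) auto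
  also have "\<dots> = card Bx"
    using K1(1) K2(1) K3(1) by (simp add: Bx_def card_cartesian_product nat_mult_distrib mult_ac)
  finally have "\<not> inj_on F Bx" by (rule pigeonhole)
  then obtain P Q where PQ: "P \<in> Bx" "Q \<in> Bx" "P \<noteq> Q" "F P = F Q" unfolding inj_on_def by blast
  obtain x1 y1 z1 x2 y2 z2 where P: "P = (x1, y1, z1)" and Q: "Q = (x2, y2, z2)" by (metis prod_cases3)
  define x y z where "x = x1 - x2" and "y = y1 - y2" and "z = z1 - z2"
  have nz: "(x, y, z) \<noteq> (0, 0, 0)" using PQ(3) P Q by (auto simp: x_def y_def z_def)
  have bounds: "x\<^sup>2 < b * c" "y\<^sup>2 < a * c" "z\<^sup>2 < a * b"
    using PQ(1,2) P Q by (auto simp: Bx_def x_def y_def z_def intro!: K1(3) K2(3) K3(3))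
  have m: "(b * y1 - u * z1) mod a = (b * y2 - u * z2) mod a"
    "(c * z1 - v * x1) mod b = (c * z2 - v * x2) mod b"
    "(a * x1 - w * y1) mod c = (a * x2 - w * y2) mod c"
    using PQ(4) P Q by (auto simp: F_def)
  have d: "a dvd b * y - u * z" "b dvd (- c) * z - (- v) * x" "c dvd a * x - w * y"
  proof -
    have "b * y - u * z = (b * y1 - u * z1) - (b * y2 - u * z2)" by (simp add: y_def z_def algebra_simps)
    then show "a dvd b * y - u * z" using m(1) by (simp only: mod_eq_dvd_iff)
    have "(- c) * z - (- v) * x = - ((c * z1 - v * x1) - (c * z2 - v * x2))" by (simp add: x_def z_def algebra_simps)
    then show "b dvd (- c) * z - (- v) * x" using m(2) by (simp only: mod_eq_dvd_iff dvd_minus_iff)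
    have "a * x - w * y = (a * x1 - w * y1) - (a * x2 - w * y2)" by (simp add: x_def y_def algebra_simps)
    then show "c dvd a * x - w * y" using m(3) by (simp only: mod_eq_dvd_iff)
  qed
  define V where "V = a * x\<^sup>2 + b * y\<^sup>2 - c * z\<^sup>2"
  have Va: "a dvd V"
  proof -
    have "a dvd b * y\<^sup>2 + (- c) * z\<^sup>2"
      by (rule dvd_form_of_linear_congruence[of u]) (use u d(1) cop in auto)
    then have "a dvd a * x\<^sup>2 + (b * y\<^sup>2 + (- c) * z\<^sup>2)" by (rule dvd_add[OF dvd_triv_left])
    then show ?thesis by (simp add: V_def algebra_simps)
  qed
  have Vb: "b dvd V"
  proof -
    have "b dvd (- c) * z\<^sup>2 + a * x\<^sup>2"
      by (rule dvd_form_of_linear_congruence[of "- v"]) (use v d(2) cop in auto)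
    then have "b dvd b * y\<^sup>2 + ((- c) * z\<^sup>2 + a * x\<^sup>2)" by (rule dvd_add[OF dvd_triv_left])
    then show ?thesis by (simp add: V_def algebra_simps)
  qed
  have Vc: "c dvd V"
  proof -
    have "c dvd a * x\<^sup>2 + b * y\<^sup>2"
      by (rule dvd_form_of_linear_congruence[of w]) (use w d(3) cop in auto)
    then have "c dvd (a * x\<^sup>2 + b * y\<^sup>2) - c * z\<^sup>2" by (rule dvd_diff[OF _ dvd_triv_left])
    then show ?thesis by (simp add: V_def)
  qed
  have "a * b dvd V" using Va Vb cop(1) by (simp add: divides_mult)
  then have "a * b * c dvd V" using Vc cop by (intro divides_mult) (auto simp: coprime_commute)
  then obtain q where q: "V = a * b * c * q" by blast
  have ax: "a * x\<^sup>2 < a * (b * c)" "b * y\<^sup>2 < b * (a * c)" "c * z\<^sup>2 < c * (a * b)"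
    using bounds pos by auto
  moreover have "0 \<le> a * x\<^sup>2" "0 \<le> b * y\<^sup>2" "0 \<le> c * z\<^sup>2" using pos by auto
  ultimately have "- (a * b * c) < V" "V < 2 * (a * b * c)"
    unfolding V_def by (simp_all add: mult_ac)
  then have "(a * b * c) * (-1) < (a * b * c) * q" "(a * b * c) * q < (a * b * c) * 2"
    using q by (simp_all add: mult_ac)
  moreover have "a * b * c > 0" using pos by simp
  ultimately have "-1 < q" "q < 2" by (simp_all only: mult_less_cancel_left_pos)
  then have "q = 0 \<or> q = 1" by linarith
  then consider "V = 0" | "V = a * b * c" using q by auto
  then show ?thesis
  proof cases
    case 1
    then show ?thesis using nz unfolding isotropic3_def V_def by (intro exI[of _ x] exI[of _ y] exI[of _ z]) auto
  next
    case 2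
    \<comment> \<open>A composition identity: it turns a x^2 + b y^2 = c (z^2 + ab) into a zero of
      the form whose last coordinate z^2 + ab is positive.\<close>
    have "a * (x * z + b * y)\<^sup>2 + b * (y * z - a * x)\<^sup>2 = (a * x\<^sup>2 + b * y\<^sup>2) * (z\<^sup>2 + a * b)"
      by (simp add: power2_eq_square algebra_simps)
    also have "a * x\<^sup>2 + b * y\<^sup>2 = c * (z\<^sup>2 + a * b)" using 2 unfolding V_def by (simp add: algebra_simps)
    finally have "a * (x * z + b * y)\<^sup>2 + b * (y * z - a * x)\<^sup>2 + (- c) * (z\<^sup>2 + a * b)\<^sup>2 = 0"
      by (simp add: power2_eq_square)
    moreover have "z\<^sup>2 + a * b \<noteq> 0" using p(3) by (smt (verit) zero_le_power2)
    ultimately show ?thesis unfolding isotropic3_def by blast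
  qed
qed

lemma isotropic3_rotate: "isotropic3 a b c \<Longrightarrow> isotropic3 b c a"
proof -
  assume "isotropic3 a b c"
  then obtain x y z where "(x, y, z) \<noteq> (0, 0, 0)" "a * x\<^sup>2 + b * y\<^sup>2 + c * z\<^sup>2 = 0"
    unfolding isotropic3_def by blast
  then show ?thesis unfolding isotropic3_def by (intro exI[of _ y] exI[of _ z] exI[of _ x]) auto
qed

lemma isotropic3_uminus: "isotropic3 (- a) (- b) (- c) \<Longrightarrow> isotropic3 a b c"
proof -
  assume "isotropic3 (- a) (- b) (- c)"
  then obtain x y z where "(x, y, z) \<noteq> (0, 0, 0)" "- a * x\<^sup>2 + - b * y\<^sup>2 + - c * z\<^sup>2 = 0"
    unfolding isotropic3_def by blast
  then show ?thesis unfolding isotropic3_def by (intro exI[of _ x] exI[of _ y] exI[of _ z]) auto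
qed

lemma legendre_two_signs:
  fixes a b c :: int
  assumes "a > 0" "b > 0" "c < 0"
    and "squarefree a" "squarefree b" "squarefree c"
    and "coprime a b" "coprime b c" "coprime c a"
    and "\<And>p. prime p \<Longrightarrow> p dvd a \<Longrightarrow> QuadRes p (- (b * c))"
    and "\<And>p. prime p \<Longrightarrow> p dvd b \<Longrightarrow> QuadRes p (- (c * a))"
    and "\<And>p. prime p \<Longrightarrow> p dvd c \<Longrightarrow> QuadRes p (- (a * b))"
  shows "isotropic3 a b c"
proof -
  have c: "squarefree (- c)" using assms(6) by (simp add: squarefree_def)
  have "isotropic3 a b (- (- c))"
  proof (rule legendre_aux)
    show "QuadRes a (b * - c)" using assms QuadRes_squarefree[of a "b * - c"] by simp
    show "QuadRes b (- c * a)" using assms QuadRes_squarefree[of b "- c * a"] by simp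
    show "QuadRes (- c) (- a * b)" using assms c QuadRes_squarefree[of "- c" "- a * b"] by simp
  qed (use assms c in auto)
  then show ?thesis by simp
qed

theorem legendre:
  fixes a b c :: int
  assumes nz: "a \<noteq> 0" "b \<noteq> 0" "c \<noteq> 0"
    and signs: "\<not> (sgn a = sgn b \<and> sgn b = sgn c)"
    and sqf: "squarefree a" "squarefree b" "squarefree c"
    and cop: "coprime a b" "coprime b c" "coprime c a"
    and qr: "\<And>p. prime p \<Longrightarrow> p dvd a \<Longrightarrow> QuadRes p (- (b * c))"
      "\<And>p. prime p \<Longrightarrow> p dvd b \<Longrightarrow> QuadRes p (- (c * a))"
      "\<And>p. prime p \<Longrightarrow> p dvd c \<Longrightarrow> QuadRes p (- (a * b))"
  shows "isotropic3 a b c"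
proof -
  have sqf': "squarefree (- a)" "squarefree (- b)" "squarefree (- c)"
    using sqf by (simp_all add: squarefree_def)
  have "a < 0 \<or> a > 0" "b < 0 \<or> b > 0" "c < 0 \<or> c > 0" using nz by auto
  then consider "a > 0" "b > 0" "c < 0" | "a > 0" "b < 0" "c > 0" | "a < 0" "b > 0" "c > 0"
    | "a < 0" "b < 0" "c > 0" | "a < 0" "b > 0" "c < 0" | "a > 0" "b < 0" "c < 0"
    using signs by (elim disjE) (simp_all add: sgn_if)
  then show ?thesis
  proof cases
    case 1
    then show ?thesis using legendre_two_signs[of a b c] sqf cop qr by simp
  next
    case 2
    then have "isotropic3 c a b" using legendre_two_signs[of c a b] sqf cop qr by simp
    then show ?thesis using isotropic3_rotate by blast
  next
    case 3
    then have "isotropic3 b c a" using legendre_two_signs[of b c a] sqf cop qr by simp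
    then show ?thesis using isotropic3_rotate by blast
  next
    case 4
    then have "isotropic3 (-a) (-b) (-c)" using legendre_two_signs[of "-a" "-b" "-c"] sqf' cop qr by simp
    then show ?thesis using isotropic3_uminus by blast
  next
    case 5
    then have "isotropic3 (-c) (-a) (-b)" using legendre_two_signs[of "-c" "-a" "-b"] sqf' cop qr by simp
    then show ?thesis using isotropic3_rotate isotropic3_uminus by blast
  next
    case 6
    then have "isotropic3 (-b) (-c) (-a)" using legendre_two_signs[of "-b" "-c" "-a"] sqf' cop qr by simp
    then show ?thesis using isotropic3_rotate isotropic3_uminus by blast
  qed
qed

section \<open>Residue symbols, reciprocity and the product formula\<close>

definition chi4 :: "int \<Rightarrow> int" where
  "chi4 a = (if a mod 4 = 1 then 1 else - 1)"

text \<open>On odd arguments this is (-1)^((a-1)/2 * (b-1)/2), the sign in quadratic reciprocity; at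
  even arguments \<open>chi4\<close> is only a default value.\<close>

definition hilbert2 :: "int \<Rightarrow> int \<Rightarrow> int" where
  "hilbert2 a b = (if chi4 a = - 1 \<and> chi4 b = - 1 then - 1 else 1)"

text \<open>This is the Jacobi symbol for squarefree \<open>n\<close> only.\<close>

definition jacobi :: "int \<Rightarrow> int \<Rightarrow> int" where
  "jacobi a n = (\<Prod>p\<in>prime_factors n. Legendre a p)"

lemma chi4_vals: "chi4 a = 1 \<or> chi4 a = - 1"
  by (simp add: chi4_def)

lemma chi4_mult:
  assumes "odd a" "odd b"
  shows "chi4 (a * b) = chi4 a * chi4 b"
proof -
  have "a mod 4 = 1 \<or> a mod 4 = 3" "b mod 4 = 1 \<or> b mod 4 = 3"
    using assms by presburger+
  then show ?thesis by (auto simp: chi4_def mod_mult_eq[of a 4 b, symmetric])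
qed

lemma chi4_uminus: "odd a \<Longrightarrow> chi4 (- a) = - chi4 a"
  unfolding chi4_def by presburger

lemma chi4_abs: "odd a \<Longrightarrow> chi4 a = (if a > 0 then chi4 \<bar>a\<bar> else - chi4 \<bar>a\<bar>)"
  using chi4_uminus[of a] by (auto simp: abs_if)

lemma chi4_prod:
  assumes "finite A" "\<And>p. p \<in> A \<Longrightarrow> odd p"
  shows "chi4 (\<Prod>A) = (\<Prod>p\<in>A. chi4 p)"
  using assms
proof (induction A rule: finite_induct)
  case (insert p A)
  then have "odd (\<Prod>A)" by (simp add: even_prod_iff)
  then show ?case using insert chi4_mult[of p "\<Prod>A"] by simp
qed (simp add: chi4_def)

lemma hilbert2_commute: "hilbert2 a b = hilbert2 b a"
  by (auto simp: hilbert2_def)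

lemma hilbert2_prod:
  assumes "finite A" "\<And>p. p \<in> A \<Longrightarrow> odd p"
  shows "hilbert2 (\<Prod>A) b = (\<Prod>p\<in>A. hilbert2 p b)"
  using assms
proof (induction A rule: finite_induct)
  case (insert p A)
  then have "odd (\<Prod>A)" by (simp add: even_prod_iff)
  then have "chi4 (p * \<Prod>A) = chi4 p * chi4 (\<Prod>A)" using insert chi4_mult by simp
  then have "hilbert2 (p * \<Prod>A) b = hilbert2 p b * hilbert2 (\<Prod>A) b"
    using chi4_vals[of p] chi4_vals[of "\<Prod>A"] by (auto simp: hilbert2_def)
  then show ?case using insert by simp
qed (simp add: chi4_def hilbert2_def)

lemma prime_int_gt_2: "prime (p::int) \<Longrightarrow> odd p \<Longrightarrow> 2 < p"
  using prime_ge_2_int[of p] by (cases "p = 2") auto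

lemma prime_nat_of_int: "prime (p::int) \<Longrightarrow> prime (nat p)"
  using prime_int_nat_transfer by blast

lemma Legendre_mult_int:
  fixes p :: int
  assumes "prime p" "odd p"
  shows "Legendre (a * b) p = Legendre a p * Legendre b p"
proof -
  have "2 < p" using assms by (rule prime_int_gt_2)
  then show ?thesis using Legendre_mult[of "nat p" a b] prime_nat_of_int[OF assms(1)] by simp
qed

lemma Legendre_one: "prime (p::int) \<Longrightarrow> Legendre 1 p = 1"
  using Legendre_square[of p 1] by (auto dest: not_prime_unit)

lemma Legendre_minus_one:
  fixes p :: int
  assumes "prime p" "odd p"
  shows "Legendre (- 1) p = chi4 p"
proof -
  have p: "2 < p" using assms by (rule prime_int_gt_2)
  define k where "k = (nat p - 1) div 2"
  have "[Legendre (- 1) p = (- 1) ^ k] (mod p)"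
    unfolding k_def using euler_criterion[of "nat p" "- 1"] prime_nat_of_int[OF assms(1)] p by simp
  moreover have "(- 1) ^ k = chi4 p"
  proof -
    have "p mod 4 = 1 \<or> p mod 4 = 3" using assms(2) by presburger
    moreover have "even k \<longleftrightarrow> p mod 4 = 1"
    proof -
      have "int k = (p - 1) div 2" unfolding k_def using p by (simp add: zdiv_int of_nat_diff)
      then show ?thesis using assms(2) by presburger
    qed
    ultimately show ?thesis by (auto simp: chi4_def)
  qed
  ultimately have "p dvd Legendre (- 1) p - chi4 p" by (simp add: cong_iff_dvd_diff)
  moreover have "\<bar>Legendre (- 1) p - chi4 p\<bar> < p"
    using Legendre_vals[of "- 1" p] chi4_vals[of p] p by auto
  ultimately show ?thesis by (metis dvd_imp_le_int eq_iff_diff_eq_0 leD abs_of_pos p less_trans zero_less_numeral)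
qed

lemma Legendre_reciprocity:
  fixes p q :: int
  assumes "prime p" "odd p" "prime q" "odd q" "p \<noteq> q"
  shows "Legendre p q * Legendre q p = hilbert2 p q"
proof -
  have p: "2 < p" "2 < q" using assms by (auto intro: prime_int_gt_2)
  have "Legendre p q * Legendre q p = (- 1) ^ nat ((p - 1) div 2 * ((q - 1) div 2))"
    using Quadratic_Reciprocity_int[of p q] prime_nat_of_int assms p by simp
  also have "\<dots> = hilbert2 p q"
  proof -
    have "p mod 4 = 1 \<or> p mod 4 = 3" "q mod 4 = 1 \<or> q mod 4 = 3" using assms by presburger+
    moreover have "even ((p - 1) div 2) \<longleftrightarrow> p mod 4 = 1" "even ((q - 1) div 2) \<longleftrightarrow> q mod 4 = 1"
      using assms by presburger+
    moreover have "even (nat ((p - 1) div 2 * ((q - 1) div 2))) \<longleftrightarrow> even ((p - 1) div 2 * ((q - 1) div 2))"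
      using p by (simp add: even_nat_iff)
    ultimately show ?thesis by (auto simp: hilbert2_def chi4_def)
  qed
  finally show ?thesis .
qed

lemma prod_prime_factors_squarefree:
  fixes n :: int
  assumes "squarefree n"
  shows "\<Prod>(prime_factors n) = \<bar>n\<bar>"
proof -
  have n: "n \<noteq> 0" using assms by auto
  have "(\<Prod>p\<in>prime_factors n. p ^ multiplicity p n) = \<bar>n\<bar>"
    using prod_prime_factors[OF n] by (simp add: normalize_int_def)
  moreover have "multiplicity p n = 1" if "p \<in> prime_factors n" for p
    using that squarefree_factorial_semiring'[OF n] assms by blast
  ultimately show ?thesis by simp
qed

lemma prime_factors_odd: "odd (n::int) \<Longrightarrow> p \<in> prime_factors n \<Longrightarrow> prime p \<and> odd p"
  by (auto simp: in_prime_factors_iff dvd_trans)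

lemma jacobi_mult: "odd n \<Longrightarrow> jacobi (a * b) n = jacobi a n * jacobi b n"
  unfolding jacobi_def prod.distrib[symmetric]
  by (intro prod.cong refl Legendre_mult_int) (auto dest: prime_factors_odd)

lemma jacobi_minus_one:
  assumes "odd n" "squarefree n"
  shows "jacobi (- 1) n = chi4 \<bar>n\<bar>"
proof -
  have "jacobi (- 1) n = (\<Prod>p\<in>prime_factors n. chi4 p)"
    unfolding jacobi_def by (intro prod.cong refl Legendre_minus_one) (use assms in \<open>auto dest: prime_factors_odd\<close>)
  also have "\<dots> = chi4 (\<Prod>(prime_factors n))"
    by (rule chi4_prod[symmetric]) (use assms in \<open>auto dest: prime_factors_odd\<close>)
  finally show ?thesis by (simp add: prod_prime_factors_squarefree[OF assms(2)])
qed

lemma jacobi_abs_prod: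
  assumes "odd a" "squarefree a" "odd b"
  shows "jacobi \<bar>a\<bar> b = (\<Prod>q\<in>prime_factors b. \<Prod>p\<in>prime_factors a. Legendre p q)"
  unfolding jacobi_def
proof (rule prod.cong[OF refl])
  fix q assume q: "q \<in> prime_factors b"
  have "Legendre (\<Prod>A) q = (\<Prod>p\<in>A. Legendre p q)" if "finite A" for A
    using that
  proof (induction A rule: finite_induct)
    case (insert p A)
    then show ?case using Legendre_mult_int[of q p "\<Prod>A"] prime_factors_odd[OF assms(3) q] by simp
  qed (use prime_factors_odd[OF assms(3) q] Legendre_one in auto)
  then show "Legendre \<bar>a\<bar> q = (\<Prod>p\<in>prime_factors a. Legendre p q)"
    by (metis finite_set_mset prod_prime_factors_squarefree[OF assms(2)])
qed

lemma jacobi_reciprocity: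
  assumes a: "odd a" "squarefree a" and b: "odd b" "squarefree b" and cop: "coprime a b"
  shows "jacobi \<bar>a\<bar> b * jacobi \<bar>b\<bar> a = hilbert2 \<bar>a\<bar> \<bar>b\<bar>"
proof -
  have "jacobi \<bar>b\<bar> a = (\<Prod>q\<in>prime_factors b. \<Prod>p\<in>prime_factors a. Legendre q p)"
    unfolding jacobi_abs_prod[OF b a(1)] by (rule prod.swap)
  then have "jacobi \<bar>a\<bar> b * jacobi \<bar>b\<bar> a
      = (\<Prod>q\<in>prime_factors b. \<Prod>p\<in>prime_factors a. Legendre p q * Legendre q p)"
    unfolding jacobi_abs_prod[OF a b(1)] prod.distrib by simp
  also have "\<dots> = (\<Prod>q\<in>prime_factors b. \<Prod>p\<in>prime_factors a. hilbert2 p q)"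
  proof (intro prod.cong refl Legendre_reciprocity)
    fix p q assume pq: "q \<in> prime_factors b" "p \<in> prime_factors a"
    show "prime p" "odd p" "prime q" "odd q"
      using pq prime_factors_odd[OF a(1)] prime_factors_odd[OF b(1)] by auto
    show "p \<noteq> q"
    proof
      assume "p = q"
      then have "p dvd a" "p dvd b" using pq by (auto simp: in_prime_factors_iff)
      then have "is_unit p" using cop by (rule coprime_common_divisor[rotated])
      then show False using pq(2) by (auto simp: in_prime_factors_iff)
    qed
  qed
  also have "\<dots> = (\<Prod>q\<in>prime_factors b. hilbert2 q \<bar>a\<bar>)"
  proof (rule prod.cong[OF refl])
    fix q
    have "(\<Prod>p\<in>prime_factors a. hilbert2 p q) = hilbert2 (\<Prod>(prime_factors a)) q"
      by (rule hilbert2_prod[symmetric]) (use a in \<open>auto dest: prime_factors_odd\<close>)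
    then show "(\<Prod>p\<in>prime_factors a. hilbert2 p q) = hilbert2 q \<bar>a\<bar>"
      by (simp add: prod_prime_factors_squarefree[OF a(2)] hilbert2_commute)
  qed
  also have "\<dots> = hilbert2 (\<Prod>(prime_factors b)) \<bar>a\<bar>"
    by (rule hilbert2_prod[symmetric]) (use b in \<open>auto dest: prime_factors_odd\<close>)
  finally show ?thesis by (simp add: prod_prime_factors_squarefree[OF b(2)] hilbert2_commute)
qed

text \<open>Separates signs from reciprocity, which is available for absolute values only: the first
  factor \<open>chi4 \<bar>a\<bar>\<close> is the symbol of -1, and each negative factor contributes
  one more.\<close>

lemma jacobi_neg_mult:
  assumes "odd a" "squarefree a" "b \<noteq> 0" "c \<noteq> 0"
  shows "jacobi (- (b * c)) a = chi4 \<bar>a\<bar> * (if b > 0 then 1 else chi4 \<bar>a\<bar>)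
    * (if c > 0 then 1 else chi4 \<bar>a\<bar>) * jacobi \<bar>b\<bar> a * jacobi \<bar>c\<bar> a"
proof -
  have s: "jacobi x a = (if x > 0 then 1 else chi4 \<bar>a\<bar>) * jacobi \<bar>x\<bar> a" if "x \<noteq> 0" for x
  proof (cases "x > 0")
    case False
    then have "x = - 1 * \<bar>x\<bar>" by simp
    then have "jacobi x a = jacobi (- 1) a * jacobi \<bar>x\<bar> a"
      by (metis jacobi_mult[OF assms(1)])
    then show ?thesis using False jacobi_minus_one[OF assms(1,2)] by simp
  qed simp
  have "- (b * c) = - 1 * (b * c)" by simp
  then have "jacobi (- (b * c)) a = jacobi (- 1) a * (jacobi b a * jacobi c a)"
    using jacobi_mult[OF assms(1)] by metis
  then show ?thesis using s[OF assms(3)] s[OF assms(4)] jacobi_minus_one[OF assms(1,2)] by simp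
qed

text \<open>For odd coefficients, \<open>signs\<close> and \<open>chi\<close> say that the form is
  isotropic over the reals and over the 2-adic numbers. Reciprocity pairs the symbols of each two
  coefficients, so the product of the obstructions at odd primes depends only on signs and classes
  modulo 4, and a finite check shows that it is 1.\<close>

lemma product_formula:
  fixes a b c :: int
  assumes odd: "odd a" "odd b" "odd c"
    and sqf: "squarefree a" "squarefree b" "squarefree c"
    and cop: "coprime a b" "coprime b c" "coprime c a"
    and signs: "\<not> (sgn a = sgn b \<and> sgn b = sgn c)"
    and chi: "\<not> (chi4 a = chi4 b \<and> chi4 b = chi4 c)"
  shows "jacobi (- (b * c)) a * jacobi (- (c * a)) b * jacobi (- (a * b)) c = 1"
proof -
  have nz: "a \<noteq> 0" "b \<noteq> 0" "c \<noteq> 0" using odd by auto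
  define A B C where "A = chi4 \<bar>a\<bar>" and "B = chi4 \<bar>b\<bar>" and "C = chi4 \<bar>c\<bar>"
  define sa sb sc where "sa \<longleftrightarrow> a > 0" and "sb \<longleftrightarrow> b > 0" and "sc \<longleftrightarrow> c > 0"
  note J = jacobi_neg_mult[OF odd(1) sqf(1) nz(2,3)] jacobi_neg_mult[OF odd(2) sqf(2) nz(3,1)]
    jacobi_neg_mult[OF odd(3) sqf(3) nz(1,2)]
  have "jacobi (- (b * c)) a * jacobi (- (c * a)) b * jacobi (- (a * b)) c
      = (A * (if sb then 1 else A) * (if sc then 1 else A))
      * (B * (if sc then 1 else B) * (if sa then 1 else B))
      * (C * (if sa then 1 else C) * (if sb then 1 else C))
      * (jacobi \<bar>a\<bar> b * jacobi \<bar>b\<bar> a) * (jacobi \<bar>b\<bar> c * jacobi \<bar>c\<bar> b) * (jacobi \<bar>c\<bar> a * jacobi \<bar>a\<bar> c)"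
    unfolding J A_def B_def C_def sa_def sb_def sc_def by (simp only: mult_ac)
  also have "\<dots> = (A * (if sb then 1 else A) * (if sc then 1 else A))
      * (B * (if sc then 1 else B) * (if sa then 1 else B))
      * (C * (if sa then 1 else C) * (if sb then 1 else C))
      * (if A = - 1 \<and> B = - 1 then - 1 else 1) * (if B = - 1 \<and> C = - 1 then - 1 else 1)
      * (if C = - 1 \<and> A = - 1 then - 1 else 1)"
    using jacobi_reciprocity[OF odd(1) sqf(1) odd(2) sqf(2) cop(1)]
      jacobi_reciprocity[OF odd(2) sqf(2) odd(3) sqf(3) cop(2)]
      jacobi_reciprocity[OF odd(3) sqf(3) odd(1) sqf(1) cop(3)]
    unfolding hilbert2_def A_def B_def C_def by (simp only:)
  also have "\<dots> = 1"
  proof -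
    have vals: "A = 1 \<or> A = - 1" "B = 1 \<or> B = - 1" "C = 1 \<or> C = - 1"
      unfolding A_def B_def C_def using chi4_vals by auto
    have s: "\<not> (sa = sb \<and> sb = sc)"
      using signs nz unfolding sa_def sb_def sc_def by (auto simp: sgn_if split: if_splits)
    have k: "\<not> ((if sa then A else - A) = (if sb then B else - B) \<and> (if sb then B else - B) = (if sc then C else - C))"
      using chi unfolding A_def B_def C_def sa_def sb_def sc_def
        chi4_abs[OF odd(1), symmetric] chi4_abs[OF odd(2), symmetric] chi4_abs[OF odd(3), symmetric] .
    show ?thesis
      using vals s k by (elim disjE) (cases sa; cases sb; cases sc; simp)+
  qed
  finally show ?thesis .
qed

text \<open>By the product formula, the local condition at a single prime follows from the others.\<close>

lemma legendre_all_but_one: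
  fixes a b c l :: int
  assumes odd: "odd a" "odd b" "odd c"
    and sqf: "squarefree a" "squarefree b" "squarefree c"
    and cop: "coprime a b" "coprime b c" "coprime c a"
    and signs: "\<not> (sgn a = sgn b \<and> sgn b = sgn c)"
    and chi: "\<not> (chi4 a = chi4 b \<and> chi4 b = chi4 c)"
    and l: "prime l"
    and La: "\<And>p. prime p \<Longrightarrow> p \<noteq> l \<Longrightarrow> p dvd a \<Longrightarrow> Legendre (- (b * c)) p = 1"
    and Lb: "\<And>p. prime p \<Longrightarrow> p \<noteq> l \<Longrightarrow> p dvd b \<Longrightarrow> Legendre (- (c * a)) p = 1"
    and Lc: "\<And>p. prime p \<Longrightarrow> p \<noteq> l \<Longrightarrow> p dvd c \<Longrightarrow> Legendre (- (a * b)) p = 1"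
  shows "isotropic3 a b c"
proof -
  have nz: "a \<noteq> 0" "b \<noteq> 0" "c \<noteq> 0" using odd by auto
  have J: "jacobi m n = (if l dvd n then Legendre m l else 1)"
    if "n \<noteq> 0" "\<And>p. prime p \<Longrightarrow> p \<noteq> l \<Longrightarrow> p dvd n \<Longrightarrow> Legendre m p = 1" for m n
  proof -
    have "jacobi m n = (\<Prod>p\<in>prime_factors n. if p = l then Legendre m l else 1)"
      unfolding jacobi_def using that(2) by (intro prod.cong refl) (auto simp: in_prime_factors_iff)
    also have "\<dots> = (if l \<in> prime_factors n then Legendre m l else 1)"
      by (subst prod.delta) auto
    finally show ?thesis using l that(1) by (simp add: in_prime_factors_iff)
  qed
  have pf: "(if l dvd a then Legendre (- (b * c)) l else 1) * (if l dvd b then Legendre (- (c * a)) l else 1)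
      * (if l dvd c then Legendre (- (a * b)) l else 1) = 1"
    using product_formula[OF odd sqf cop signs chi] J[OF nz(1) La] J[OF nz(2) Lb] J[OF nz(3) Lc] by simp
  have ex: "\<not> (l dvd a \<and> l dvd b)" "\<not> (l dvd b \<and> l dvd c)" "\<not> (l dvd c \<and> l dvd a)"
    using cop l coprime_common_divisor not_prime_unit by blast+
  \<comment> \<open>By coprimality \<open>l\<close> divides at most one coefficient, so at most one
    factor of \<open>pf\<close> is a genuine symbol, and it must be 1.\<close>
  have L: "l dvd a \<Longrightarrow> Legendre (- (b * c)) l = 1" "l dvd b \<Longrightarrow> Legendre (- (c * a)) l = 1"
    "l dvd c \<Longrightarrow> Legendre (- (a * b)) l = 1"
    using pf ex by auto
  have QR: "QuadRes p m" if "Legendre m p = 1" for m p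
    using that by (auto simp: Legendre_def split: if_splits)
  show ?thesis
    by (rule legendre[OF nz signs sqf cop]; rule QR) (use La Lb Lc L in metis)+
qed

section \<open>Meyer's theorem\<close>

text \<open>Adjoining 2 to the index set lets the same existence theorem prescribe the class of
  \<open>l\<close> modulo 4.\<close>

lemma exists_prime_with_Legendre:
  fixes P :: "int set"
  assumes P: "finite P" "\<And>p. p \<in> P \<Longrightarrow> prime p \<and> odd p"
    and e: "\<And>p. p \<in> P \<Longrightarrow> e p = 1 \<or> e p = - 1" and k: "k = 1 \<or> k = - 1"
  obtains l :: int where "prime l" "odd l" "chi4 l = k" "\<And>p. p \<in> P \<Longrightarrow> Legendre l p = e p"
proof -
  define Q where "Q = insert 2 (nat ` P)"
  define e' where "e' q = real_of_int (if q = 2 then k else e (int q))" for q :: nat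
  have Q: "finite Q" "prime q" if "q \<in> Q" for q
    using P prime_nat_of_int that by (auto simp: Q_def)
  have ipos: "int (nat p) = p" "nat p \<noteq> 2" if "p \<in> P" for p
  proof -
    have "2 < p" using P(2)[OF that] prime_int_gt_2 by blast
    then show "int (nat p) = p" "nat p \<noteq> 2" by auto
  qed
  have e': "e' q \<in> {-1, 1}" if "q \<in> Q" for q
  proof (cases "q = 2")
    case True
    then show ?thesis using k by (auto simp: e'_def)
  next
    case False
    then obtain p where p: "p \<in> P" "q = nat p" using \<open>q \<in> Q\<close> by (auto simp: Q_def)
    then have "e' q = of_int (e p)" using False ipos(1)[OF p(1)] by (simp add: e'_def)
    then show ?thesis using e[OF p(1)] by auto
  qed
  have "finite Q" using P by (simp add: Q_def)
  then obtain m where m: "prime m" "\<And>q. q \<in> Q \<Longrightarrow> qchar q m = e' q"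
    using exists_prime_with_qchar[of Q e'] Q(2) e' by blast
  have two: "qchar 2 m = of_int k" using m(2)[of 2] by (simp add: Q_def e'_def)
  then have oddm: "odd m" using k by (auto simp: qchar_def)
  then have "m mod 4 = 1 \<or> m mod 4 = 3" by presburger
  moreover have "int m mod 4 = int (m mod 4)" by (simp add: zmod_int)
  ultimately have chi: "chi4 (int m) = k" using two oddm by (auto simp: qchar_def chi4_def split: if_splits)
  have "Legendre (int m) p = e p" if p: "p \<in> P" for p
  proof -
    have "nat p \<in> Q" using p by (simp add: Q_def)
    then have "qchar (nat p) m = e' (nat p)" by (rule m(2))
    then show ?thesis using ipos[OF p] by (simp add: qchar_def e'_def)
  qed
  moreover have "prime (int m)" using m(1) by simp
  ultimately show ?thesis using that[of "int m"] oddm chi by simp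
qed

lemma coprimeI_primes:
  fixes x y :: int
  assumes "\<And>p. prime p \<Longrightarrow> p dvd x \<Longrightarrow> \<not> p dvd y" "x \<noteq> 0"
  shows "coprime x y"
proof (rule coprimeI, rule ccontr)
  fix d assume d: "d dvd x" "d dvd y" "\<not> is_unit d"
  then have "d \<noteq> 0" using assms(2) by auto
  then obtain p where "prime p" "p dvd d" using d(3) prime_divisor_exists by blast
  then show False using assms(1) d(1,2) dvd_trans by blast
qed

lemma Legendre_nonzero_vals: "\<not> p dvd a \<Longrightarrow> Legendre a p = 1 \<or> Legendre a p = - 1"
  using Legendre_vals[of a p] Legendre_eq_0_iff[of a p] by auto

lemma Legendre_mult_eq_1:
  fixes p :: int
  assumes "prime p" "odd p" "\<not> p dvd a" "Legendre b p = Legendre a p"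
  shows "Legendre (a * b) p = 1"
  using Legendre_mult_int[OF assms(1,2), of a b] Legendre_nonzero_vals[OF assms(3)] assms(4) by auto

lemma isotropic3_scale: "isotropic3 a b c \<Longrightarrow> isotropic3 (g * a) (g * b) (g * c)"
proof -
  assume "isotropic3 a b c"
  then obtain x y z where xyz: "(x, y, z) \<noteq> (0, 0, 0)" "a * x\<^sup>2 + b * y\<^sup>2 + c * z\<^sup>2 = 0"
    unfolding isotropic3_def by blast
  then have "g * (a * x\<^sup>2 + b * y\<^sup>2 + c * z\<^sup>2) = 0" by simp
  then have "g * a * x\<^sup>2 + g * b * y\<^sup>2 + g * c * z\<^sup>2 = 0" by (simp add: algebra_simps)
  then show ?thesis unfolding isotropic3_def using xyz(1) by blast
qed

text \<open>Dividing by the common factor \<open>g\<close> leaves the conic a x^2 + b y^2 = s l z^2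
  with pairwise coprime coefficients. \<open>La\<close> and \<open>Lb\<close> are its local
  conditions at the primes of \<open>a\<close> and \<open>b\<close>, read as demands on
  \<open>l\<close>; the one at \<open>l\<close> itself comes from the product formula.\<close>

lemma binary_represents_prime_multiple:
  fixes a b g s l :: int
  assumes odd: "odd (g * a)" "odd (g * b)" and sqf: "squarefree (g * a)" "squarefree (g * b)"
    and cop: "coprime a b" and g: "g > 0"
    and s: "s = 1 \<or> s = - 1" and l: "prime l" "odd l" "\<not> l dvd a" "\<not> l dvd b"
    and signs: "\<not> (sgn (g * a) = sgn (g * b) \<and> sgn (g * b) = - s)"
    and chi: "\<not> (chi4 (g * a) = chi4 (g * b) \<and> chi4 (g * b) = - chi4 (s * g * l))"
    and La: "\<And>p. prime p \<Longrightarrow> p dvd a \<Longrightarrow> Legendre l p = Legendre (s * b) p"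
    and Lb: "\<And>p. prime p \<Longrightarrow> p dvd b \<Longrightarrow> Legendre l p = Legendre (s * a) p"
  shows "isotropic3 (g * a) (g * b) (- (s * g * l))"
proof -
  have oddab: "odd a" "odd b" "odd g" using odd by auto
  have odds: "odd s" using s by auto
  have cl: "coprime l a" "coprime l b" using l prime_imp_coprime by blast+
  have sq: "squarefree (- (s * l))"
    using s l(1) squarefree_prime[of l] by auto
  have chis: "chi4 (s * g * l) = chi4 g * chi4 (s * l)"
    using chi4_mult[of g "s * l"] oddab odds l(2) by (simp add: mult_ac)
  have "isotropic3 a b (- (s * l))"
  proof (rule legendre_all_but_one[of _ _ _ l])
    show "odd a" "odd b" "odd (- (s * l))" using oddab odds l(2) by auto
    show "squarefree a" "squarefree b" using sqf squarefree_multD(2) by blast+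
    show "squarefree (- (s * l))" by (rule sq)
    show "coprime a b" by (rule cop)
    show "coprime b (- (s * l))" "coprime (- (s * l)) a"
      using cl s by (auto simp: coprime_commute)
    show "\<not> (sgn a = sgn b \<and> sgn b = sgn (- (s * l)))"
      using signs g s prime_gt_0_int[OF l(1)] by (auto simp: sgn_mult)
    show "\<not> (chi4 a = chi4 b \<and> chi4 b = chi4 (- (s * l)))"
      using chi chi4_mult[of g a] chi4_mult[of g b] oddab chis chi4_uminus[of "s * l"] odds l(2) by auto
    show "prime l" by (rule l)
    show "Legendre (- (b * - (s * l))) p = 1" if p: "prime p" "p \<noteq> l" "p dvd a" for p
    proof -
      have "odd p" using oddab(1) p(3) dvd_trans by blast
      moreover have "\<not> p dvd b" using cop p coprime_common_divisor not_prime_unit by blast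
      then have "\<not> p dvd s * b" using s by auto
      ultimately have "Legendre (s * b * l) p = 1"
        using Legendre_mult_eq_1[OF p(1)] La[OF p(1,3)] by blast
      then show ?thesis by (simp add: mult_ac)
    qed
    show "Legendre (- (- (s * l) * a)) p = 1" if p: "prime p" "p \<noteq> l" "p dvd b" for p
    proof -
      have "odd p" using oddab(2) p(3) dvd_trans by blast
      moreover have "\<not> p dvd a" using cop p coprime_common_divisor not_prime_unit by blast
      then have "\<not> p dvd s * a" using s by auto
      ultimately have "Legendre (s * a * l) p = 1"
        using Legendre_mult_eq_1[OF p(1)] Lb[OF p(1,3)] by blast
      then show ?thesis by (simp add: mult_ac)
    qed
    show "Legendre (- (a * b)) p = 1" if p: "prime p" "p \<noteq> l" "p dvd - (s * l)" for p
    proof -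
      have "p dvd l" using p(3) s by auto
      then show ?thesis using primes_dvd_imp_eq[OF p(1) l(1)] p(2) by blast
    qed
  qed
  then have "isotropic3 (g * a) (g * b) (g * - (s * l))" by (rule isotropic3_scale)
  then show ?thesis by (simp add: mult_ac)
qed

text \<open>Applied to real signs and to classes modulo 4 alike. A pair with equal entries dictates
  its sign, any other pair is given the opposite of \<open>e5\<close>; the three signs can agree
  only if both pairs are rigid and equal to \<open>e5\<close>, which is excluded.\<close>

lemma sign_choice:
  fixes e1 e2 e3 e4 e5 :: int
  assumes "e1 = 1 \<or> e1 = - 1" "e2 = 1 \<or> e2 = - 1" "e3 = 1 \<or> e3 = - 1" "e4 = 1 \<or> e4 = - 1" "e5 = 1 \<or> e5 = - 1"
    and "\<not> (e1 = e2 \<and> e2 = e3 \<and> e3 = e4 \<and> e4 = e5)"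
  obtains s t where "s = 1 \<or> s = - 1" "t = 1 \<or> t = - 1" "\<not> (e1 = e2 \<and> e2 = - s)" "\<not> (e3 = e4 \<and> e4 = - t)"
    "\<not> (s = t \<and> t = e5)"
proof -
  have nz: "e1 \<noteq> - e1" "e3 \<noteq> - e3" "- e5 \<noteq> e5" using assms(1-5) by auto
  define s t where "s = (if e1 = e2 then e1 else - e5)" and "t = (if e3 = e4 then e3 else - e5)"
  have "s = 1 \<or> s = - 1" "t = 1 \<or> t = - 1" using assms(1,3,5) unfolding s_def t_def by auto
  moreover have "\<not> (e1 = e2 \<and> e2 = - s)" "\<not> (e3 = e4 \<and> e4 = - t)" "\<not> (s = t \<and> t = e5)"
    using nz assms(6) unfolding s_def t_def by (auto split: if_splits)
  ultimately show ?thesis by (rule that)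
qed

text \<open>The form splits as \<open>f\<^sub>1,f\<^sub>2\<close> against \<open>f\<^sub>3,f\<^sub>4\<close> against \<open>f\<^sub>5\<close>: two primes \<open>l, l'\<close> are chosen such
  that \<open>s g l\<close> and \<open>t h l'\<close> are represented by the two binary parts and the resulting ternary form is
  isotropic.\<close>

lemma quinary_normalized:
  fixes f1 f2 f3 f4 f5 :: int
  assumes odd: "odd f1" "odd f2" "odd f3" "odd f4" "odd f5"
    and sqf: "squarefree f1" "squarefree f2" "squarefree f3" "squarefree f4" "squarefree f5"
    and two: "\<And>p. prime p \<Longrightarrow> length (filter (\<lambda>f. p dvd f) [f1, f2, f3, f4, f5]) \<le> 2"
    and signs: "\<not> (sgn f1 = sgn f2 \<and> sgn f2 = sgn f3 \<and> sgn f3 = sgn f4 \<and> sgn f4 = sgn f5)"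
    and chi: "\<not> (chi4 f1 = chi4 f2 \<and> chi4 f2 = chi4 f3 \<and> chi4 f3 = chi4 f4 \<and> chi4 f4 = chi4 f5)"
  obtains t1 t2 where "t1 \<noteq> 0" "t2 \<noteq> 0" "isotropic3 f1 f2 (- t1)" "isotropic3 f3 f4 (- t2)" "isotropic3 t1 t2 f5"
proof -
  define g h where "g = gcd f1 f2" and "h = gcd f3 f4"
  have nz: "f1 \<noteq> 0" "f2 \<noteq> 0" "f3 \<noteq> 0" "f4 \<noteq> 0" "f5 \<noteq> 0" using odd by auto
  have gh: "g > 0" "h > 0" using nz by (auto simp: g_def h_def)
  obtain a1 a2 where a12: "f1 = g * a1" "f2 = g * a2" "coprime a1 a2"
    using gcd_coprime_exists[of f1 f2] nz unfolding g_def by (metis gcd_eq_0_iff mult.commute)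
  obtain a3 a4 where a34: "f3 = h * a3" "f4 = h * a4" "coprime a3 a4"
    using gcd_coprime_exists[of f3 f4] nz unfolding h_def by (metis gcd_eq_0_iff mult.commute)
  have odd': "odd g" "odd h" "odd a1" "odd a2" "odd a3" "odd a4" using odd a12 a34 by auto
  \<comment> \<open>By \<open>two\<close>, a prime common to both members of a pair divides no other
    coefficient, so no prime imposes conflicting demands on the two auxiliary primes.\<close>
  have excl: "p dvd f1 \<Longrightarrow> p dvd f2 \<Longrightarrow> \<not> p dvd f3 \<and> \<not> p dvd f4 \<and> \<not> p dvd f5"
    "p dvd f3 \<Longrightarrow> p dvd f4 \<Longrightarrow> \<not> p dvd f1 \<and> \<not> p dvd f2 \<and> \<not> p dvd f5"
    "p dvd f5 \<Longrightarrow> p dvd f1 \<or> p dvd f2 \<Longrightarrow> \<not> p dvd f3 \<and> \<not> p dvd f4"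
    if "prime p" for p
    using two[OF that] by (auto split: if_splits)
  have dvdf: "p dvd g \<Longrightarrow> p dvd f1 \<and> p dvd f2" "p dvd h \<Longrightarrow> p dvd f3 \<and> p dvd f4"
    "p dvd a1 \<Longrightarrow> p dvd f1" "p dvd a2 \<Longrightarrow> p dvd f2" "p dvd a3 \<Longrightarrow> p dvd f3" "p dvd a4 \<Longrightarrow> p dvd f4" for p
    using a12 a34 by auto
  have ca: "\<not> (p dvd a1 \<and> p dvd a2)" "\<not> (p dvd a3 \<and> p dvd a4)" if "prime p" for p
    using a12(3) a34(3) that coprime_common_divisor not_prime_unit by blast+
  obtain s t where s: "s = 1 \<or> s = - 1" and t: "t = 1 \<or> t = - 1"
    and sg: "\<not> (sgn f1 = sgn f2 \<and> sgn f2 = - s)" "\<not> (sgn f3 = sgn f4 \<and> sgn f4 = - t)" "\<not> (s = t \<and> t = sgn f5)"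
  proof -
    have "sgn x = 1 \<or> sgn x = - 1" if "x \<noteq> 0" for x :: int using that by (simp add: sgn_if)
    from sign_choice[OF this[OF nz(1)] this[OF nz(2)] this[OF nz(3)] this[OF nz(4)] this[OF nz(5)] signs]
    show ?thesis using that by blast
  qed
  obtain k k' where k: "k = 1 \<or> k = - 1" and k': "k' = 1 \<or> k' = - 1"
    and kk: "\<not> (chi4 f1 = chi4 f2 \<and> chi4 f2 = - k)" "\<not> (chi4 f3 = chi4 f4 \<and> chi4 f4 = - k')" "\<not> (k = k' \<and> k' = chi4 f5)"
    by (rule sign_choice[OF chi4_vals chi4_vals chi4_vals chi4_vals chi4_vals chi])
  define P where "P = prime_factors (f1 * f2 * f3 * f4 * f5)"
  have P: "finite P" "p \<in> P \<longleftrightarrow> prime p \<and> (p dvd f1 \<or> p dvd f2 \<or> p dvd f3 \<or> p dvd f4 \<or> p dvd f5)" for p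
    using nz by (auto simp: P_def in_prime_factors_iff prime_dvd_mult_iff)
  have Podd: "odd p" if "p \<in> P" for p
    using that odd by (auto simp: P dest: dvd_trans)
  have st: "p dvd s * x \<longleftrightarrow> p dvd x" "p dvd t * x \<longleftrightarrow> p dvd x" for p x
    using s t by auto
  \<comment> \<open>The symbol of \<open>l'\<close> at \<open>p\<close> that the second conic will
    force. It has to be known in advance, since \<open>l\<close> is chosen first and must compensate
    for it at primes of \<open>f5\<close>.\<close>
  define w where "w p = (if p dvd a3 then Legendre (t * a4) p else if p dvd a4 then Legendre (t * a3) p else 1)" for p
  \<comment> \<open>Demands on \<open>l\<close>: solvability of the first conic at \<open>a1\<close>
    and \<open>a2\<close>, of the third at \<open>h\<close> and at \<open>f5\<close>. At a prime of
    \<open>f5\<close> dividing neither \<open>a3\<close> nor \<open>a4\<close> the value is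
    arbitrary, because there \<open>l'\<close> will adapt to \<open>l\<close>.\<close>
  define e where "e p = (if p dvd a1 then Legendre (s * a2) p else if p dvd a2 then Legendre (s * a1) p
    else if p dvd h then Legendre (- (s * (g * f5))) p
    else if p dvd f5 then Legendre (- (s * (t * (g * h)))) p * w p else 1)" for p
  have wv: "w p = 1 \<or> w p = - 1" if "p \<in> P" for p
    using that ca[of p] Legendre_nonzero_vals st unfolding w_def P by (auto simp: st)
  have ev: "e p = 1 \<or> e p = - 1" if p: "p \<in> P" for p
  proof -
    have pp: "prime p" using p by (simp add: P)
    have "p dvd a1 \<Longrightarrow> \<not> p dvd s * a2" using ca(1)[OF pp] unfolding st by blast
    note n1 = Legendre_nonzero_vals[OF this]
    have "\<not> p dvd a1 \<Longrightarrow> \<not> p dvd s * a1" unfolding st .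
    note n2 = Legendre_nonzero_vals[OF this]
    have "p dvd h \<Longrightarrow> \<not> p dvd - (s * (g * f5))"
      using excl(2)[OF pp] dvdf(1,2)[of p] unfolding dvd_minus_iff st prime_dvd_mult_iff[OF pp] by blast
    note n3 = Legendre_nonzero_vals[OF this]
    have "p dvd f5 \<Longrightarrow> \<not> p dvd h \<Longrightarrow> \<not> p dvd - (s * (t * (g * h)))"
      using excl(1)[OF pp] dvdf(1)[of p] unfolding dvd_minus_iff st prime_dvd_mult_iff[OF pp] by blast
    note n4 = Legendre_nonzero_vals[OF this]
    have n5: "x * w p = 1 \<or> x * w p = - 1" if "x = 1 \<or> x = - 1" for x using wv[OF p] that by auto
    show ?thesis unfolding e_def by (cases "p dvd a1"; cases "p dvd a2"; cases "p dvd h"; cases "p dvd f5")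
      (simp_all only: if_True if_False simp_thms n1 n2 n3 n4 n5)
  qed
  have kv: "k * chi4 (s * g) = 1 \<or> k * chi4 (s * g) = - 1" "k' * chi4 (t * h) = 1 \<or> k' * chi4 (t * h) = - 1"
    using k k' chi4_vals[of "s * g"] chi4_vals[of "t * h"] by auto
  obtain l where l: "prime l" "odd l" "chi4 l = k * chi4 (s * g)" "\<And>p. p \<in> P \<Longrightarrow> Legendre l p = e p"
    using exists_prime_with_Legendre[of P e "k * chi4 (s * g)"] P Podd ev kv(1) by metis
  \<comment> \<open>All symbols prescribed on \<open>P\<close> are nonzero, whereas the symbol of a
    prime at itself is 0.\<close>
  have lP: "l \<notin> P"
  proof
    assume "l \<in> P"
    then have "Legendre l l = e l" "e l = 1 \<or> e l = - 1" using l(4) ev by auto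
    then show False using Legendre_eq_0_iff[of l l] by simp
  qed
  have lf: "\<not> l dvd f1" "\<not> l dvd f2" "\<not> l dvd f3" "\<not> l dvd f4" "\<not> l dvd f5" using lP l(1) by (auto simp: P)
  \<comment> \<open>Since \<open>l'\<close> is chosen after \<open>l\<close>, the condition of the
    third conic at \<open>l\<close> can be prescribed too. Only its condition at \<open>l'\<close>
    stays open, and that is the one left to the product formula.\<close>
  define e' where "e' p = (if p dvd a3 then Legendre (t * a4) p else if p dvd a4 then Legendre (t * a3) p
    else if p dvd g \<or> p = l then Legendre (- (t * (h * f5))) p
    else if p dvd f5 then Legendre (- (s * (t * (g * (h * l))))) p else 1)" for p
  have ev': "e' p = 1 \<or> e' p = - 1" if p: "p \<in> insert l P" for p
  proof -
    have pp: "prime p" using p l(1) by (auto simp: P)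
    have pl: "p dvd l \<Longrightarrow> p = l" using primes_dvd_imp_eq[OF pp l(1)] by blast
    have "p dvd a3 \<Longrightarrow> \<not> p dvd t * a4" using ca(2)[OF pp] unfolding st by blast
    note n1 = Legendre_nonzero_vals[OF this]
    have "\<not> p dvd a3 \<Longrightarrow> \<not> p dvd t * a3" unfolding st .
    note n2 = Legendre_nonzero_vals[OF this]
    have "p dvd g \<or> p = l \<Longrightarrow> \<not> p dvd - (t * (h * f5))"
      using excl(1)[OF pp] dvdf(1,2)[of p] lf unfolding dvd_minus_iff st prime_dvd_mult_iff[OF pp] by blast
    note n3 = Legendre_nonzero_vals[OF this]
    have "p dvd f5 \<Longrightarrow> \<not> (p dvd g \<or> p = l) \<Longrightarrow> \<not> p dvd - (s * (t * (g * (h * l))))"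
      using excl(2)[OF pp] dvdf(2)[of p] pl unfolding dvd_minus_iff st prime_dvd_mult_iff[OF pp] by blast
    note n4 = Legendre_nonzero_vals[OF this]
    show ?thesis unfolding e'_def by (cases "p dvd a3"; cases "p dvd a4"; cases "p dvd g \<or> p = l"; cases "p dvd f5")
      (simp_all only: if_True if_False simp_thms n1 n2 n3 n4)
  qed
  obtain l' where l': "prime l'" "odd l'" "chi4 l' = k' * chi4 (t * h)"
    "\<And>p. p \<in> insert l P \<Longrightarrow> Legendre l' p = e' p"
    using exists_prime_with_Legendre[of "insert l P" e' "k' * chi4 (t * h)"] P Podd ev' kv(2) l(1,2)
    by (metis finite_insert insert_iff)
  have lP': "l' \<notin> insert l P"
  proof
    assume "l' \<in> insert l P"
    then have "Legendre l' l' = e' l'" "e' l' = 1 \<or> e' l' = - 1" using l'(4) ev' by auto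
    then show False using Legendre_eq_0_iff[of l' l'] by simp
  qed
  have lf': "\<not> l' dvd f1" "\<not> l' dvd f2" "\<not> l' dvd f3" "\<not> l' dvd f4" "\<not> l' dvd f5" "l' \<noteq> l"
    using lP' l'(1) by (auto simp: P)
  have ods: "odd s" "odd t" using s t by auto
  have chi_t1: "chi4 (s * g * l) = k"
    using chi4_mult[of "s * g" l] l(2,3) odd' ods chi4_vals[of "s * g"] by auto
  have chi_t2: "chi4 (t * h * l') = k'"
    using chi4_mult[of "t * h" l'] l'(2,3) odd' ods chi4_vals[of "t * h"] by auto
  have c1: "isotropic3 (g * a1) (g * a2) (- (s * g * l))"
  proof (rule binary_represents_prime_multiple)
    show "Legendre l p = Legendre (s * a2) p" if "prime p" "p dvd a1" for p
      using l(4)[of p] that dvdf(3)[of p] by (simp add: P e_def)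
    show "Legendre l p = Legendre (s * a1) p" if "prime p" "p dvd a2" for p
      using l(4)[of p] that dvdf(4)[of p] ca(1)[of p] by (auto simp: P e_def)
    show "\<not> l dvd a1" "\<not> l dvd a2" using lf dvdf by blast+
  qed (use odd sqf a12 gh s l sg kk chi_t1 in \<open>simp_all\<close>)
  have c2: "isotropic3 (h * a3) (h * a4) (- (t * h * l'))"
  proof (rule binary_represents_prime_multiple)
    show "Legendre l' p = Legendre (t * a4) p" if "prime p" "p dvd a3" for p
      using l'(4)[of p] that dvdf(5)[of p] by (simp add: P e'_def)
    show "Legendre l' p = Legendre (t * a3) p" if "prime p" "p dvd a4" for p
      using l'(4)[of p] that dvdf(6)[of p] ca(2)[of p] by (auto simp: P e'_def)
    show "\<not> l' dvd a3" "\<not> l' dvd a4" using lf' dvdf by blast+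
  qed (use odd sqf a34 gh t l' sg kk chi_t2 in \<open>simp_all\<close>)
  have c3: "isotropic3 (s * g * l) (t * h * l') f5"
  proof (rule legendre_all_but_one[of _ _ _ l'])
    have pd: "p dvd s * g * l \<longleftrightarrow> p dvd g \<or> p = l" "p dvd t * h * l' \<longleftrightarrow> p dvd h \<or> p = l'" if "prime p" for p
      using that primes_dvd_imp_eq[OF that l(1)] primes_dvd_imp_eq[OF that l'(1)]
      by (auto simp: mult.assoc st prime_dvd_mult_iff)
    have gl: "coprime g l" "coprime h l'"
      using lf lf' dvdf prime_imp_coprime[OF l(1)] prime_imp_coprime[OF l'(1)] by (metis coprime_commute)+
    have sqgh: "squarefree g" "squarefree h" using sqf a12 a34 squarefree_multD(1) by metis+
    have sq1: "squarefree (g * l)" "squarefree (h * l')"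
      using gl sqgh squarefree_prime l(1) l'(1) by (auto intro!: squarefree_mult_coprime)
    show "odd (s * g * l)" "odd (t * h * l')" "odd f5" using odd odd' ods l(2) l'(2) by auto
    show "squarefree (s * g * l)" using s sq1 by (auto simp: mult.assoc)
    show "squarefree (t * h * l')" using t sq1 by (auto simp: mult.assoc)
    show "squarefree f5" by (rule sqf)
    have nz3: "s * g * l \<noteq> 0" "t * h * l' \<noteq> 0" using s t gh l(1) l'(1) by auto
    show "coprime (s * g * l) (t * h * l')"
    proof (rule coprimeI_primes[OF _ nz3(1)])
      fix p :: int assume p: "prime p" "p dvd s * g * l"
      then show "\<not> p dvd t * h * l'"
        using pd[OF p(1)] excl(1)[OF p(1)] dvdf(1,2)[of p] lf lf' by auto
    qed
    show "coprime (t * h * l') f5"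
    proof (rule coprimeI_primes[OF _ nz3(2)])
      fix p :: int assume p: "prime p" "p dvd t * h * l'"
      then show "\<not> p dvd f5"
        using pd[OF p(1)] excl(2)[OF p(1)] dvdf(2)[of p] lf' by auto
    qed
    have "coprime (s * g * l) f5"
    proof (rule coprimeI_primes[OF _ nz3(1)])
      fix p :: int assume p: "prime p" "p dvd s * g * l"
      then show "\<not> p dvd f5"
        using pd[OF p(1)] excl(1)[OF p(1)] dvdf(1)[of p] lf by auto
    qed
    then show "coprime f5 (s * g * l)" by (simp add: coprime_commute)
    have "sgn (s * g * l) = s" "sgn (t * h * l') = t"
      using s t gh prime_gt_0_int[OF l(1)] prime_gt_0_int[OF l'(1)] by (auto simp: sgn_mult)
    then show "\<not> (sgn (s * g * l) = sgn (t * h * l') \<and> sgn (t * h * l') = sgn f5)" using sg(3) by simp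
    show "\<not> (chi4 (s * g * l) = chi4 (t * h * l') \<and> chi4 (t * h * l') = chi4 f5)"
      using chi_t1 chi_t2 kk(3) by simp
    show "prime l'" by (rule l')
    show "Legendre (- (t * h * l' * f5)) p = 1" if p: "prime p" "p \<noteq> l'" "p dvd s * g * l" for p
    proof -
      have pg: "p dvd g \<or> p = l" using p pd by blast
      then have pP: "p \<in> insert l P" "odd p" using p(1) dvdf(1)[of p] l(2) odd'(1) by (auto simp: P dest: dvd_trans)
      have na: "\<not> p dvd a3" "\<not> p dvd a4" "\<not> p dvd h" "\<not> p dvd f5"
        using pg excl(1)[OF p(1)] dvdf[of p] lf by auto
      then have "Legendre l' p = Legendre (- (t * (h * f5))) p" using l'(4)[OF pP(1)] pg by (simp add: e'_def)
      moreover have "\<not> p dvd - (t * (h * f5))" using na p(1) by (simp add: st prime_dvd_mult_iff)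
      ultimately have "Legendre (- (t * (h * f5)) * l') p = 1" using Legendre_mult_eq_1[OF p(1) pP(2)] by blast
      then show ?thesis by (simp add: mult_ac)
    qed
    show "Legendre (- (f5 * (s * g * l))) p = 1" if p: "prime p" "p \<noteq> l'" "p dvd t * h * l'" for p
    proof -
      have pg: "p dvd h" using p pd by blast
      then have pP: "p \<in> P" "odd p" using p(1) dvdf(2)[of p] odd'(2) by (auto simp: P dest: dvd_trans)
      have na: "\<not> p dvd a1" "\<not> p dvd a2" "\<not> p dvd g" "\<not> p dvd f5"
        using pg excl(2)[OF p(1)] dvdf[of p] by auto
      then have "Legendre l p = Legendre (- (s * (g * f5))) p" using l(4)[OF pP(1)] pg by (simp add: e_def)
      moreover have "\<not> p dvd - (s * (g * f5))" using na p(1) by (simp add: st prime_dvd_mult_iff)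
      ultimately have "Legendre (- (s * (g * f5)) * l) p = 1" using Legendre_mult_eq_1[OF p(1) pP(2)] by blast
      then show ?thesis by (simp add: mult_ac)
    qed
    show "Legendre (- (s * g * l * (t * h * l'))) p = 1" if p: "prime p" "p \<noteq> l'" "p dvd f5" for p
    proof -
      have pP: "p \<in> P" using p by (simp add: P)
      have po: "odd p" using Podd[OF pP] .
      have pg: "\<not> p dvd g" "\<not> p dvd h" using excl(1,2)[OF p(1)] dvdf(1,2)[of p] p(3) by auto
      have pl: "p \<noteq> l" using lP pP by auto
      have nd: "\<not> p dvd - (s * (t * (g * (h * l))))" "\<not> p dvd - (s * (t * (g * h)))"
        using pg pl p(1) primes_dvd_imp_eq[OF p(1) l(1)] by (auto simp: st prime_dvd_mult_iff)
      show ?thesis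
      proof (cases "p dvd a3 \<or> p dvd a4")
        case True
        then have na: "\<not> p dvd a1" "\<not> p dvd a2" using excl(3)[OF p(1,3)] dvdf[of p] by auto
        have "Legendre l' p = w p" using True l'(4)[of p] pP by (auto simp: e'_def w_def)
        moreover have "Legendre l p = Legendre (- (s * (t * (g * h)))) p * w p"
          using l(4)[OF pP] na pg p(3) by (simp add: e_def)
        ultimately have "Legendre (l * l') p = Legendre (- (s * (t * (g * h)))) p"
          using Legendre_mult_int[OF p(1) po, of l l'] wv[OF pP] by auto
        then have "Legendre (- (s * (t * (g * h))) * (l * l')) p = 1"
          using Legendre_mult_eq_1[OF p(1) po nd(2)] by blast
        then show ?thesis by (simp add: mult_ac)
      next
        case False
        then have "Legendre l' p = Legendre (- (s * (t * (g * (h * l))))) p"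
          using l'(4)[of p] pP pg pl p(3) by (simp add: e'_def)
        then have "Legendre (- (s * (t * (g * (h * l)))) * l') p = 1"
          using Legendre_mult_eq_1[OF p(1) po nd(1)] by blast
        then show ?thesis by (simp add: mult_ac)
      qed
    qed
  qed
  have "s * g * l \<noteq> 0" "t * h * l' \<noteq> 0" using s t gh l(1) l'(1) by auto
  then show ?thesis by (rule that[OF _ _ c1[folded a12(1,2)] c2[folded a34(1,2)] c3])
qed

section \<open>Reductions of diagonal quinary forms\<close>

definition isotropic :: "(nat \<Rightarrow> int) \<Rightarrow> bool" where
  "isotropic f \<longleftrightarrow> (\<exists>x. (\<exists>i<5. x i \<noteq> 0) \<and> (\<Sum>i<5. f i * (x i)\<^sup>2) = 0)"

text \<open>An implication, so that chains of reductions need not carry indefiniteness along: each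
  step assumes it of the given form and re-derives it for the simpler one.\<close>

definition isotropic_if_indefinite :: "(nat \<Rightarrow> int) \<Rightarrow> bool" where
  "isotropic_if_indefinite f \<longleftrightarrow>
    ((\<forall>i<5. f i \<noteq> 0) \<and> (\<exists>i<5. f i > 0) \<and> (\<exists>i<5. f i < 0) \<longrightarrow> isotropic f)"

lemma sum_lessThan_5: "(\<Sum>i<5. f i) = f 0 + f 1 + f 2 + f 3 + f 4" for f :: "nat \<Rightarrow> int"
  by (simp add: eval_nat_numeral)

lemma all_less_5: "(\<forall>i<5. P i) \<longleftrightarrow> P 0 \<and> P 1 \<and> P 2 \<and> P 3 \<and> P (4::nat)"
  by (auto simp: eval_nat_numeral less_Suc_eq)

lemma scale_iso:
  assumes "c \<noteq> 0" "isotropic_if_indefinite (\<lambda>i. c * f i)"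
  shows "isotropic_if_indefinite f"
  unfolding isotropic_if_indefinite_def
proof (intro impI)
  assume f: "(\<forall>i<5. f i \<noteq> 0) \<and> (\<exists>i<5. 0 < f i) \<and> (\<exists>i<5. f i < 0)"
  then obtain i j where ij: "i < 5" "0 < f i" "j < 5" "f j < 0" by blast
  have "\<exists>i<5. 0 < c * f i" "\<exists>i<5. c * f i < 0"
    using ij assms(1) by (cases "c > 0"; force simp: zero_less_mult_iff mult_less_0_iff)+
  then have "isotropic (\<lambda>i. c * f i)"
    using assms f unfolding isotropic_if_indefinite_def by auto
  then obtain x where x: "\<exists>i<5. x i \<noteq> 0" "(\<Sum>i<5. c * f i * (x i)\<^sup>2) = 0" unfolding isotropic_def by blast
  then have "c * (\<Sum>i<5. f i * (x i)\<^sup>2) = 0" by (simp add: sum_distrib_left mult.assoc)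
  then show "isotropic f" unfolding isotropic_def using x(1) assms(1) by auto
qed

lemma square_iso:
  assumes k: "\<And>i. i < 5 \<Longrightarrow> k i \<noteq> 0 \<and> f i = g i * (k i)\<^sup>2" and g: "isotropic_if_indefinite g"
  shows "isotropic_if_indefinite f"
  unfolding isotropic_if_indefinite_def
proof (intro impI)
  assume f: "(\<forall>i<5. f i \<noteq> 0) \<and> (\<exists>i<5. 0 < f i) \<and> (\<exists>i<5. f i < 0)"
  have sg: "f i \<noteq> 0 \<longleftrightarrow> g i \<noteq> 0" "f i > 0 \<longleftrightarrow> g i > 0" "f i < 0 \<longleftrightarrow> g i < 0" if "i < 5" for i
    using k[OF that] by (auto simp: zero_less_mult_iff mult_less_0_iff)
  have "isotropic g" using g f sg unfolding isotropic_if_indefinite_def by blast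
  then obtain x where x: "\<exists>i<5. x i \<noteq> 0" "(\<Sum>i<5. g i * (x i)\<^sup>2) = 0" unfolding isotropic_def by blast
  \<comment> \<open>Scaling by the product of all \<open>k i\<close> keeps the quotients of
    \<open>x i\<close> by \<open>k i\<close> integral.\<close>
  define K where "K = (\<Prod>i<5. k i)"
  have K0: "K \<noteq> 0" using k by (auto simp: K_def)
  define y where "y i = x i * (K div k i)" for i
  have ky: "k i * y i = x i * K" if "i < 5" for i
  proof -
    have "k i dvd K" unfolding K_def using that by (intro dvd_prodI) auto
    then show ?thesis by (simp add: y_def mult.left_commute)
  qed
  have "(\<Sum>i<5. f i * (y i)\<^sup>2) = (\<Sum>i<5. g i * (x i)\<^sup>2 * K\<^sup>2)"
  proof (rule sum.cong[OF refl])
    fix i :: nat assume "i \<in> {..<5}"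
    then have i: "i < 5" by simp
    have "f i * (y i)\<^sup>2 = g i * (k i * y i)\<^sup>2" using k[OF i] by (simp add: power_mult_distrib)
    then show "f i * (y i)\<^sup>2 = g i * (x i)\<^sup>2 * K\<^sup>2" using ky[OF i] by (simp add: power_mult_distrib)
  qed
  also have "\<dots> = (\<Sum>i<5. g i * (x i)\<^sup>2) * K\<^sup>2" by (rule sum_distrib_right[symmetric])
  finally have "(\<Sum>i<5. f i * (y i)\<^sup>2) = 0" using x(2) by simp
  moreover obtain i where i: "i < 5" "x i \<noteq> 0" using x(1) by blast
  then have "k i * y i \<noteq> 0" using ky K0 by simp
  then have "y i \<noteq> 0" by auto
  ultimately show "isotropic f" unfolding isotropic_def using i(1) by blast
qed

lemma sum_split_two:
  fixes h :: "nat \<Rightarrow> int"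
  assumes "i < 5" "j < 5" "i \<noteq> j"
  shows "(\<Sum>k<5. h k) = h i + h j + (\<Sum>k\<in>{..<5} - {i, j}. h k)"
proof -
  have "(\<Sum>k<5. h k) = h i + (\<Sum>k\<in>{..<5} - {i}. h k)" using assms by (subst sum.remove[of _ i]) auto
  also have "(\<Sum>k\<in>{..<5} - {i}. h k) = h j + (\<Sum>k\<in>{..<5} - {i} - {j}. h k)"
    using assms by (subst sum.remove[of _ j]) auto
  also have "{..<5} - {i} - {j} = {..<5} - {i, j}" by auto
  finally show ?thesis by simp
qed

text \<open>Over the rationals \<open>\<langle>a, b\<rangle> \<cong> \<langle>t, abt\<rangle>\<close> for every nonzero value \<open>t = ax\<^sup>2 + by\<^sup>2\<close>.\<close>

lemma rediagonalise_iso: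
  assumes ij: "i < 5" "j < 5" "i \<noteq> j" and t: "t = f i * x\<^sup>2 + f j * y\<^sup>2" and xy: "x \<noteq> 0 \<or> y \<noteq> 0"
    and g: "isotropic_if_indefinite (f(i := t, j := f i * f j * t))"
  shows "isotropic_if_indefinite f"
  unfolding isotropic_if_indefinite_def
proof (intro impI)
  assume f: "(\<forall>i<5. f i \<noteq> 0) \<and> (\<exists>i<5. 0 < f i) \<and> (\<exists>i<5. f i < 0)"
  define g where "g = f(i := t, j := f i * f j * t)"
  have gs: "g i = t" "g j = f i * f j * t" "k \<noteq> i \<Longrightarrow> k \<noteq> j \<Longrightarrow> g k = f k" for k
    using ij by (auto simp: g_def)
  have fij: "f i \<noteq> 0" "f j \<noteq> 0" using f ij by auto
  show "isotropic f"
  proof (cases "t = 0")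
    case True
    define z where "z = (\<lambda>_::nat. 0::int)(i := x, j := y)"
    have zs: "z i = x" "z j = y" "k \<noteq> i \<Longrightarrow> k \<noteq> j \<Longrightarrow> z k = 0" for k
      using ij by (auto simp: z_def)
    have "(\<Sum>k<5. f k * (z k)\<^sup>2) = 0"
      unfolding sum_split_two[OF ij] using zs t True by simp
    then show ?thesis unfolding isotropic_def using zs ij xy by metis
  next
    case False
    have nz: "\<forall>k<5. g k \<noteq> 0"
    proof (intro allI impI)
      fix k :: nat assume "k < 5"
      then show "g k \<noteq> 0" using f False fij gs(1,2) gs(3)[of k] by (cases "k = i"; cases "k = j") auto
    qed
    have sgn_same: "(0 < g i \<or> 0 < g j) \<longleftrightarrow> (0 < f i \<or> 0 < f j)" "(g i < 0 \<or> g j < 0) \<longleftrightarrow> (f i < 0 \<or> f j < 0)"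
    proof -
      have sq: "0 \<le> x\<^sup>2" "0 \<le> y\<^sup>2" by auto
      consider "f i > 0" "f j > 0" | "f i < 0" "f j < 0" | "f i * f j < 0" using fij by (metis linorder_neqE_linordered_idom mult_neg_pos mult_pos_neg)
      then have "(0 < g i \<or> 0 < g j) = (0 < f i \<or> 0 < f j) \<and> (g i < 0 \<or> g j < 0) = (f i < 0 \<or> f j < 0)"
      proof cases
        case 1
        then have "t \<ge> 0" unfolding t using sq by (intro add_nonneg_nonneg mult_nonneg_nonneg) auto
        then have "t > 0" using False by simp
        then have "g i > 0" "g j > 0" using 1 unfolding gs by simp_all
        then show ?thesis using 1 by auto
      next
        case 2
        then have "t \<le> 0" unfolding t using sq by (intro add_nonpos_nonpos mult_nonpos_nonneg) auto
        then have "t < 0" using False by simp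
        moreover have "f i * f j > 0" using 2 by (simp add: mult_neg_neg)
        ultimately show ?thesis using 2 gs by (auto simp: mult_less_0_iff zero_less_mult_iff)
      next
        case 3
        then have "(0 < f i \<or> 0 < f j) \<and> (f i < 0 \<or> f j < 0)" by (auto simp: mult_less_0_iff)
        moreover have "(0 < g i \<or> 0 < g j) \<and> (g i < 0 \<or> g j < 0)"
          using 3 False gs by (cases "t > 0") (auto simp: mult_neg_pos mult_neg_neg)
        ultimately show ?thesis by blast
      qed
      then show "(0 < g i \<or> 0 < g j) \<longleftrightarrow> (0 < f i \<or> 0 < f j)" "(g i < 0 \<or> g j < 0) \<longleftrightarrow> (f i < 0 \<or> f j < 0)"
        by auto
    qed
    have "\<exists>k<5. 0 < g k" "\<exists>k<5. g k < 0" using f sgn_same gs ij by metis+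
    then have "isotropic g" using assms(6) nz unfolding isotropic_if_indefinite_def g_def by blast
    then obtain z where z: "\<exists>k<5. z k \<noteq> 0" "(\<Sum>k<5. g k * (z k)\<^sup>2) = 0" unfolding isotropic_def by blast
    define w where "w = z(i := x * z i - f j * y * z j, j := y * z i + f i * x * z j)"
    have ws: "w i = x * z i - f j * y * z j" "w j = y * z i + f i * x * z j" "k \<noteq> i \<Longrightarrow> k \<noteq> j \<Longrightarrow> w k = z k" for k
      using ij by (auto simp: w_def)
    have "f i * (w i)\<^sup>2 + f j * (w j)\<^sup>2 = g i * (z i)\<^sup>2 + g j * (z j)\<^sup>2"
      unfolding ws gs t by (simp add: power2_eq_square algebra_simps)
    moreover have "(\<Sum>k\<in>{..<5} - {i, j}. f k * (w k)\<^sup>2) = (\<Sum>k\<in>{..<5} - {i, j}. g k * (z k)\<^sup>2)"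
      by (rule sum.cong) (auto simp: ws gs)
    ultimately have "(\<Sum>k<5. f k * (w k)\<^sup>2) = (\<Sum>k<5. g k * (z k)\<^sup>2)"
      unfolding sum_split_two[OF ij] by simp
    moreover have "\<exists>k<5. w k \<noteq> 0"
    proof (rule ccontr)
      assume "\<not> ?thesis"
      then have w0: "w k = 0" if "k < 5" for k using that by blast
      \<comment> \<open>The substitution has determinant \<open>t\<close>, so it is invertible over
        the rationals; these are the adjugate relations.\<close>
      have "t * z i = f i * x * w i + f j * y * w j" "t * z j = x * w j - y * w i"
        unfolding ws t by (simp_all add: power2_eq_square algebra_simps)
      then have "z i = 0" "z j = 0" using w0 ij False by auto
      then have "z k = 0" if "k < 5" for k using that w0[OF that] ws(3)[of k] by metis
      then show False using z(1) by blast
    qed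
    ultimately show ?thesis unfolding isotropic_def using z(2) by metis
  qed
qed

lemma chi4_square: "odd k \<Longrightarrow> chi4 (k\<^sup>2) = 1"
  using chi4_mult[of k k] chi4_vals[of k] by (auto simp: power2_eq_square)

lemma chi4_add_double: "odd c \<Longrightarrow> odd s \<Longrightarrow> chi4 (c + 2 * s) = - chi4 c"
  unfolding chi4_def by presburger

lemma chi4_eq_half_sum_odd:
  assumes "odd x" "odd y" "chi4 x = chi4 y"
  obtains w where "odd w" "x + y = 2 * w"
proof -
  have "odd ((x + y) div 2)" "x + y = 2 * ((x + y) div 2)"
    using assms unfolding chi4_def by (auto split: if_splits) presburger+
  then show ?thesis using that by blast
qed

text \<open>The binary parts represent \<open>t1\<close> and \<open>t2\<close> up to squares, and a
  zero of the third conic combines these values. If \<open>z\<close> or \<open>w\<close> is 0, a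
  binary part is isotropic by itself.\<close>

lemma isotropic_from_ternaries:
  assumes t: "t1 \<noteq> 0" "t2 \<noteq> 0" and nz: "f 0 \<noteq> 0" "f 2 \<noteq> 0"
    and iso: "isotropic3 (f 0) (f 1) (- t1)" "isotropic3 (f 2) (f 3) (- t2)" "isotropic3 t1 t2 (f 4)"
  shows "isotropic f"
proof -
  obtain x y z where xyz: "(x, y, z) \<noteq> (0, 0, 0)" "f 0 * x\<^sup>2 + f 1 * y\<^sup>2 + - t1 * z\<^sup>2 = 0"
    using iso(1) unfolding isotropic3_def by blast
  obtain u v w where uvw: "(u, v, w) \<noteq> (0, 0, 0)" "f 2 * u\<^sup>2 + f 3 * v\<^sup>2 + - t2 * w\<^sup>2 = 0"
    using iso(2) unfolding isotropic3_def by blast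
  obtain a b c where abc: "(a, b, c) \<noteq> (0, 0, 0)" "t1 * a\<^sup>2 + t2 * b\<^sup>2 + f 4 * c\<^sup>2 = 0"
    using iso(3) unfolding isotropic3_def by blast
  have mk: "isotropic f" if "f 0 * x0\<^sup>2 + f 1 * x1\<^sup>2 + f 2 * x2\<^sup>2 + f 3 * x3\<^sup>2 + f 4 * x4\<^sup>2 = 0"
    "x0 \<noteq> 0 \<or> x1 \<noteq> 0 \<or> x2 \<noteq> 0 \<or> x3 \<noteq> 0 \<or> x4 \<noteq> 0" for x0 x1 x2 x3 x4 :: int
  proof -
    define h :: "nat \<Rightarrow> int" where "h = (\<lambda>_. 0)(0 := x0, 1 := x1, 2 := x2, 3 := x3, 4 := x4)"
    have "(\<Sum>i<5. f i * (h i)\<^sup>2) = 0" unfolding sum_lessThan_5 using that(1) by (simp add: h_def)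
    moreover have "h 0 \<noteq> 0 \<or> h 1 \<noteq> 0 \<or> h 2 \<noteq> 0 \<or> h 3 \<noteq> 0 \<or> h 4 \<noteq> 0" using that(2) by (simp add: h_def)
    then have "\<exists>i<5. h i \<noteq> 0" using all_less_5[of "\<lambda>i. h i = 0"] by blast
    ultimately show ?thesis unfolding isotropic_def by blast
  qed
  consider "z = 0" | "w = 0" | "z \<noteq> 0" "w \<noteq> 0" by blast
  then show ?thesis
  proof cases
    case 1
    then show ?thesis using mk[of x y 0 0 0] xyz by auto
  next
    case 2
    then show ?thesis using mk[of 0 0 u v 0] uvw by auto
  next
    case 3
    have 1: "f 0 * x\<^sup>2 + f 1 * y\<^sup>2 = t1 * z\<^sup>2" and 2: "f 2 * u\<^sup>2 + f 3 * v\<^sup>2 = t2 * w\<^sup>2"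
      using xyz(2) uvw(2) by auto
    have "f 0 * (x * a * w)\<^sup>2 + f 1 * (y * a * w)\<^sup>2 + f 2 * (u * b * z)\<^sup>2 + f 3 * (v * b * z)\<^sup>2 + f 4 * (c * z * w)\<^sup>2
      = (f 0 * x\<^sup>2 + f 1 * y\<^sup>2) * (a * w)\<^sup>2 + (f 2 * u\<^sup>2 + f 3 * v\<^sup>2) * (b * z)\<^sup>2 + f 4 * (c * z * w)\<^sup>2"
      by (simp add: power_mult_distrib algebra_simps)
    also have "\<dots> = (t1 * a\<^sup>2 + t2 * b\<^sup>2 + f 4 * c\<^sup>2) * (z * w)\<^sup>2"
      unfolding 1 2 by (simp add: power_mult_distrib algebra_simps)
    also have "\<dots> = 0" using abc(2) by simp
    finally have eq: "f 0 * (x * a * w)\<^sup>2 + f 1 * (y * a * w)\<^sup>2 + f 2 * (u * b * z)\<^sup>2 + f 3 * (v * b * z)\<^sup>2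
      + f 4 * (c * z * w)\<^sup>2 = 0" .
    have "t1 * z\<^sup>2 \<noteq> 0" "t2 * w\<^sup>2 \<noteq> 0" using t 3 by auto
    then have "x \<noteq> 0 \<or> y \<noteq> 0" "u \<noteq> 0 \<or> v \<noteq> 0" using 1 2 by auto
    then have "x * a * w \<noteq> 0 \<or> y * a * w \<noteq> 0 \<or> u * b * z \<noteq> 0 \<or> v * b * z \<noteq> 0 \<or> c * z * w \<noteq> 0"
      using abc(1) 3 by auto
    then show ?thesis using mk eq by blast
  qed
qed

text \<open>Descent on the absolute product of the coefficients. Square factors are removed; a prime
  dividing at least three coefficients is treated by multiplying the form with it and cancelling
  squares. The latter multiplies all classes modulo 4 by the same sign, so two classes remain
  present. What cannot be reduced satisfies the assumptions of
  \<open>quinary_normalized\<close>.\<close>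

lemma odd_mixed_iso:
  assumes "\<And>i. i < 5 \<Longrightarrow> odd (f i)" "\<not> (\<forall>i<5. chi4 (f i) = chi4 (f 0))"
  shows "isotropic_if_indefinite f"
  using assms
proof (induction "nat \<bar>\<Prod>i<5. f i\<bar>" arbitrary: f rule: less_induct)
  case less
  note odd = less.prems(1) and mixed = less.prems(2)
  have nz: "f i \<noteq> 0" if "i < 5" for i using odd[OF that] by auto
  have Pnz: "(\<Prod>i<5. f i) \<noteq> 0" using nz by auto
  show ?case
  proof (cases "\<forall>i<5. squarefree (f i)")
    case False
    then obtain i where i: "i < 5" "\<not> squarefree (f i)" by blast
    then obtain k where k: "k\<^sup>2 dvd f i" "\<not> is_unit k" by (auto simp: squarefree_def)
    then obtain b where b: "f i = b * k\<^sup>2" by (metis dvd_def mult.commute)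
    define g where "g = f(i := b)"
    have ob: "odd b" "odd k" using odd[OF i(1)] b by auto
    have chib: "chi4 (f i) = chi4 b" using chi4_mult[of b "k\<^sup>2"] chi4_square ob b by simp
    have prod: "(\<Prod>j<5. f j) = (\<Prod>j<5. g j) * k\<^sup>2"
    proof -
      have "(\<Prod>j<5. f j) = f i * (\<Prod>j\<in>{..<5} - {i}. f j)" "(\<Prod>j<5. g j) = g i * (\<Prod>j\<in>{..<5} - {i}. g j)"
        using i by (simp_all add: prod.remove)
      moreover have "(\<Prod>j\<in>{..<5} - {i}. f j) = (\<Prod>j\<in>{..<5} - {i}. g j)"
        by (rule prod.cong) (auto simp: g_def)
      moreover have "g i = b" by (simp add: g_def)
      ultimately show ?thesis by (simp only: b mult_ac)
    qed
    have "k\<^sup>2 > 1"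
    proof -
      have "\<bar>k\<bar> \<ge> 2" using k(2) ob(2) by (cases "k = 0") auto
      then have "\<bar>k\<bar>\<^sup>2 \<ge> 2\<^sup>2" by (intro power_mono) auto
      then show ?thesis by simp
    qed
    then have "nat \<bar>\<Prod>j<5. g j\<bar> < nat \<bar>\<Prod>j<5. f j\<bar>"
      using Pnz unfolding prod by (auto simp: abs_mult)
    moreover have "odd (g j)" if "j < 5" for j using odd[OF that] ob by (simp add: g_def)
    moreover have cg: "chi4 (g j) = chi4 (f j)" for j using chib by (simp add: g_def)
    ultimately have "isotropic_if_indefinite g" using less.hyps[of g] mixed by auto
    then show ?thesis
      by (rule square_iso[of "(\<lambda>_. 1)(i := k)", rotated]) (use ob b in \<open>auto simp: g_def\<close>)
  next
    case sqf: True
    show ?thesis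
    proof (cases "\<exists>p. prime p \<and> card {i. i < 5 \<and> p dvd f i} > 2")
      case True
      then obtain p where p: "prime p" "card {i. i < 5 \<and> p dvd f i} > 2" by blast
      define D where "D = {i. i < 5 \<and> p dvd f i}"
      have "D \<noteq> {}" using p(2) unfolding D_def by force
      then obtain i0 where "i0 < 5" "p dvd f i0" by (auto simp: D_def)
      then have po: "odd p" using odd dvd_trans by blast
      define g where "g i = (if p dvd f i then f i div p else p * f i)" for i
      have pg: "p * f i = g i * (if p dvd f i then p else 1)\<^sup>2" for i
        by (auto simp: g_def power2_eq_square mult_ac)
      have og: "odd (g i)" if "i < 5" for i
      proof -
        have "odd (p * f i)" using odd[OF that] po by simp
        then show ?thesis unfolding pg by simp
      qed
      have cg: "chi4 (g i) = chi4 p * chi4 (f i)" if "i < 5" for i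
      proof -
        have "chi4 (p * f i) = chi4 p * chi4 (f i)" using odd[OF that] po by (rule chi4_mult[rotated])
        moreover have "chi4 (p * f i) = chi4 (g i) * chi4 ((if p dvd f i then p else 1)\<^sup>2)"
          unfolding pg[of i] using og[OF that] po by (intro chi4_mult) auto
        moreover have "chi4 ((if p dvd f i then p else 1)\<^sup>2) = 1" using po by (intro chi4_square) auto
        ultimately show ?thesis by simp
      qed
      have "chi4 p \<noteq> 0" using chi4_vals[of p] by auto
      then have mg: "\<not> (\<forall>i<5. chi4 (g i) = chi4 (g 0))" using mixed cg by auto
      have "(\<Prod>i<5. p * f i) = (\<Prod>i<5. g i * (if p dvd f i then p else 1)\<^sup>2)" using pg by simp
      then have "p ^ 5 * (\<Prod>i<5. f i) = (\<Prod>i<5. g i) * (\<Prod>i<5. if p dvd f i then p else 1)\<^sup>2"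
        by (simp add: prod.distrib prod_power_distrib)
      moreover have "(\<Prod>i<5. if p dvd f i then p else 1) = p ^ card D"
      proof -
        have "(\<Prod>i<5. if p dvd f i then p else 1) = (\<Prod>i\<in>{i\<in>{..<5}. p dvd f i}. p)"
          by (rule prod.inter_filter[symmetric]) simp
        also have "{i\<in>{..<5}. p dvd f i} = D" by (auto simp: D_def)
        finally show ?thesis by simp
      qed
      ultimately have eq: "p ^ 5 * (\<Prod>i<5. f i) = (\<Prod>i<5. g i) * p ^ (2 * card D)"
        by (simp add: power_mult[symmetric] mult.commute)
      have "card D > 2" using p(2) by (simp only: D_def)
      \<comment> \<open>The scaling contributes five factors \<open>p\<close>, the cancelled squares
        remove \<open>2 * card D\<close>, which is at least six: this is where three indices are
        needed.\<close>
      then have "2 * card D = 5 + Suc (2 * card D - 6)" by linarith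
      then obtain m where m: "2 * card D = 5 + Suc m" by blast
      have "p ^ 5 * (\<Prod>i<5. f i) = p ^ 5 * ((\<Prod>i<5. g i) * p ^ Suc m)"
        unfolding eq m power_add by (simp add: mult_ac)
      then have fg: "(\<Prod>i<5. f i) = (\<Prod>i<5. g i) * p ^ Suc m" using p(1) by auto
      have "p ^ Suc m > 1" using prime_gt_1_int[OF p(1)] by (intro one_less_power) auto
      moreover from this have "\<bar>\<Prod>i<5. f i\<bar> = \<bar>\<Prod>i<5. g i\<bar> * p ^ Suc m"
        unfolding fg abs_mult[of "\<Prod>i<5. g i"] by linarith
      moreover have "\<bar>\<Prod>i<5. g i\<bar> > 0" using Pnz unfolding fg by simp
      ultimately have "\<bar>\<Prod>i<5. g i\<bar> < \<bar>\<Prod>i<5. f i\<bar>"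
        using mult_strict_left_mono[of 1 "p ^ Suc m" "\<bar>\<Prod>i<5. g i\<bar>"] by linarith
      then have "nat \<bar>\<Prod>i<5. g i\<bar> < nat \<bar>\<Prod>i<5. f i\<bar>" by linarith
      then have "isotropic_if_indefinite g" using less.hyps[of g] og mg by blast
      then have "isotropic_if_indefinite (\<lambda>i. p * f i)"
        by (rule square_iso[of "\<lambda>i. if p dvd f i then p else 1", rotated]) (use pg p(1) in auto)
      then show ?thesis using scale_iso[of p f] p(1) by auto
    next
      case False
      show ?thesis
        unfolding isotropic_if_indefinite_def
      proof (intro impI)
        assume f: "(\<forall>i<5. f i \<noteq> 0) \<and> (\<exists>i<5. 0 < f i) \<and> (\<exists>i<5. f i < 0)"
        have two: "length (filter (\<lambda>c. p dvd c) [f 0, f 1, f 2, f 3, f 4]) \<le> 2" if "prime p" for p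
        proof -
          have "[f 0, f 1, f 2, f 3, f 4] = map f [0..<5]" by (simp add: eval_nat_numeral)
          then have "length (filter (\<lambda>c. p dvd c) [f 0, f 1, f 2, f 3, f 4])
              = card {i. i < length (map f [0..<5]) \<and> p dvd map f [0..<5] ! i}"
            by (simp only: length_filter_conv_card)
          also have "{i. i < length (map f [0..<5]) \<and> p dvd map f [0..<5] ! i} = {i. i < 5 \<and> p dvd f i}"
            by auto
          finally show ?thesis using False that by (metis not_le)
        qed
        have sgns: "\<not> (sgn (f 0) = sgn (f 1) \<and> sgn (f 1) = sgn (f 2) \<and> sgn (f 2) = sgn (f 3) \<and> sgn (f 3) = sgn (f 4))"
        proof
          assume "sgn (f 0) = sgn (f 1) \<and> sgn (f 1) = sgn (f 2) \<and> sgn (f 2) = sgn (f 3) \<and> sgn (f 3) = sgn (f 4)"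
          then have "\<forall>i<5. sgn (f i) = sgn (f 0)" unfolding all_less_5 by simp
          moreover obtain i j where "i < 5" "0 < f i" "j < 5" "f j < 0" using f by blast
          ultimately show False by (metis sgn_1_neg sgn_1_pos one_neq_neg_one)
        qed
        have chis: "\<not> (chi4 (f 0) = chi4 (f 1) \<and> chi4 (f 1) = chi4 (f 2) \<and> chi4 (f 2) = chi4 (f 3) \<and> chi4 (f 3) = chi4 (f 4))"
          using mixed unfolding all_less_5 by auto
        obtain t1 t2 where "t1 \<noteq> 0" "t2 \<noteq> 0" "isotropic3 (f 0) (f 1) (- t1)" "isotropic3 (f 2) (f 3) (- t2)"
          "isotropic3 t1 t2 (f 4)"
          by (rule quinary_normalized[of "f 0" "f 1" "f 2" "f 3" "f 4", OF _ _ _ _ _ _ _ _ _ _ two sgns chis])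
             (use odd sqf in auto)
        then show "isotropic f" using isotropic_from_ternaries nz[of 0] nz[of 2] by simp
      qed
    qed
  qed
qed

text \<open>The value at (1, 1) is \<open>4 * w\<close> and the complementary coefficient is 16 u v
  w; both square factors drop out. For odd \<open>u\<close>, \<open>v\<close> congruent modulo 4 the
  result is a pair of odd coefficients.\<close>

lemma merge_even_iso:
  assumes ij: "i < 5" "j < 5" "i \<noteq> j" and uv: "f i = 2 * u" "f j = 2 * v" "u + v = 2 * w"
    and g: "isotropic_if_indefinite (f(i := w, j := u * v * w))"
  shows "isotropic_if_indefinite f"
proof (rule rediagonalise_iso[OF ij, of "4 * w" f 1 1])
  show "4 * w = f i * 1\<^sup>2 + f j * 1\<^sup>2" using uv by simp
  show "isotropic_if_indefinite (f(i := 4 * w, j := f i * f j * (4 * w)))"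
    by (rule square_iso[OF _ g, of "(\<lambda>_. 1)(i := 2, j := 4)"]) (use ij uv in auto)
qed simp

text \<open>Again the value at (1, 1). For odd \<open>u\<close> and \<open>f j\<close> the half of
  the even coefficient changes its class modulo 4, because \<open>f j\<close> and
  \<open>f j + 2 * u\<close> lie in different classes; this prepares a merge.\<close>

lemma flip_even_iso:
  assumes ij: "i < 5" "j < 5" "i \<noteq> j" and u: "f i = 2 * u"
    and g: "isotropic_if_indefinite (f(j := f j + 2 * u, i := 2 * (u * f j * (f j + 2 * u))))"
  shows "isotropic_if_indefinite f"
proof (rule rediagonalise_iso[OF ij(2,1) ij(3)[symmetric], of "f j + 2 * u" f 1 1])
  show "isotropic_if_indefinite (f(j := f j + 2 * u, i := f j * f i * (f j + 2 * u)))"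
    using g u by (simp add: mult_ac)
qed (use u in auto)

text \<open>If all classes modulo 4 agree, the form is rewritten until two occur: <a, b> becomes
  <2s, 2s'>, then <2s, c> and <2s', d> become <p, 2u> and <p', 2v>, and finally <2u, 2v> becomes <w,
  uvw>. As p = c + 2s with \<open>s\<close> odd, the class of \<open>p\<close> is not that of
  \<open>e\<close>.\<close>

lemma odd_iso:
  assumes odd: "\<And>i. i < 5 \<Longrightarrow> odd (f i)"
  shows "isotropic_if_indefinite f"
proof (cases "\<forall>i<5. chi4 (f i) = chi4 (f 0)")
  case False
  then show ?thesis using odd_mixed_iso odd by blast
next
  case True
  define a b c d e where "a = f 0" and "b = f 1" and "c = f 2" and "d = f 3" and "e = f 4"
  have oo: "odd a" "odd b" "odd c" "odd d" "odd e" using odd by (auto simp: a_def b_def c_def d_def e_def)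
  have ch: "chi4 b = chi4 a" "chi4 c = chi4 a" "chi4 d = chi4 a" "chi4 e = chi4 a"
    using True unfolding all_less_5 by (auto simp: a_def b_def c_def d_def e_def)
  obtain s where s: "odd s" "a + b = 2 * s" using chi4_eq_half_sum_odd[of a b] oo ch by metis
  define s' where "s' = a * b * s"
  have s': "odd s'" "chi4 s' = chi4 s"
    using oo s ch chi4_mult[of a b] chi4_mult[of "a * b" s] chi4_vals[of a] by (auto simp: s'_def)
  define p where "p = c + 2 * s"
  define p' where "p' = d + 2 * s'"
  define u where "u = s * c * p"
  define v where "v = s' * d * p'"
  have op: "odd p" "odd p'" "odd u" "odd v" using oo s s' by (auto simp: p_def p'_def u_def v_def)
  have cp: "chi4 p = - chi4 a" "chi4 p' = - chi4 a"
    using chi4_add_double oo s s' ch by (auto simp: p_def p'_def)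
  have "chi4 u = chi4 s * chi4 c * chi4 p"
    using chi4_mult[of "s * c" p] chi4_mult[of s c] oo s op by (simp add: u_def)
  moreover have "chi4 v = chi4 s' * chi4 d * chi4 p'"
    using chi4_mult[of "s' * d" p'] chi4_mult[of s' d] oo s' op by (simp add: v_def)
  ultimately have "chi4 u = chi4 v" using ch cp s' by simp
  then obtain w where w: "odd w" "u + v = 2 * w" using chi4_eq_half_sum_odd[of u v] op by metis
  define h where "h = f(0 := p, 1 := p', 2 := w, 3 := u * v * w)"
  have "isotropic_if_indefinite h"
  proof (rule odd_mixed_iso)
    have "\<forall>i<5. odd (h i)" unfolding all_less_5 h_def using op w oo by (simp add: e_def)
    then show "\<And>i. i < 5 \<Longrightarrow> odd (h i)" by blast
    have "chi4 (h 4) = chi4 a" "chi4 (h 0) = - chi4 a" using ch cp by (auto simp: h_def e_def)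
    then have "chi4 (h 4) \<noteq> chi4 (h 0)" using chi4_vals[of a] by auto
    then show "\<not> (\<forall>i<5. chi4 (h i) = chi4 (h 0))" unfolding all_less_5 by simp
  qed
  moreover have "(f(0 := p, 1 := p', 2 := 2 * u, 3 := 2 * v))(2 := w, 3 := u * v * w) = h"
    by (auto simp: h_def fun_eq_iff)
  ultimately have h: "isotropic_if_indefinite ((f(0 := p, 1 := p', 2 := 2 * u, 3 := 2 * v))(2 := w, 3 := u * v * w))"
    by (simp only:)
  have 3: "isotropic_if_indefinite (f(0 := p, 1 := p', 2 := 2 * u, 3 := 2 * v))"
    by (rule merge_even_iso[OF _ _ _ _ _ w(2) h]) simp_all
  have 2: "isotropic_if_indefinite (f(0 := 2 * s, 1 := 2 * s'))"
  proof (rule rediagonalise_iso[of 0 2 p _ 1 1])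
    show "isotropic_if_indefinite ((f(0 := 2 * s, 1 := 2 * s'))
        (0 := p, 2 := (f(0 := 2 * s, 1 := 2 * s')) 0 * (f(0 := 2 * s, 1 := 2 * s')) 2 * p))"
    proof (rule rediagonalise_iso[of 1 3 p' _ 1 1], goal_cases)
      case 6
      have "(f(0 := 2 * s, 1 := 2 * s'))(0 := p, 2 := 2 * s * c * p, 1 := p', 3 := 2 * s' * d * p')
          = f(0 := p, 1 := p', 2 := 2 * u, 3 := 2 * v)"
        by (auto simp: fun_eq_iff u_def v_def)
      then show ?case using 3 by (simp add: c_def d_def)
    qed (auto simp: p'_def d_def)
  qed (auto simp: p_def c_def)
  show ?thesis
  proof (rule rediagonalise_iso[of 0 1 "2 * s" _ 1 1])
    show "isotropic_if_indefinite (f(0 := 2 * s, 1 := f 0 * f 1 * (2 * s)))"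
      using 2 by (simp add: s'_def a_def b_def mult_ac)
  qed (use s in \<open>auto simp: a_def b_def\<close>)
qed

text \<open>If the halves of the even coefficients agree modulo 4 they merge into odd ones;
  otherwise one of them is first flipped with the help of an odd coefficient.\<close>

lemma two_even_iso:
  assumes four: "\<And>i. i < 5 \<Longrightarrow> \<not> 4 dvd f i" and ij: "i < 5" "j < 5" "i \<noteq> j"
    and even: "\<And>k. k < 5 \<Longrightarrow> even (f k) \<longleftrightarrow> k = i \<or> k = j"
  shows "isotropic_if_indefinite f"
proof -
  have same: "isotropic_if_indefinite f"
    if uv: "f i = 2 * u" "f j = 2 * v" "odd u" "odd v" "chi4 u = chi4 v"
      and o: "\<And>k. k < 5 \<Longrightarrow> k \<noteq> i \<Longrightarrow> k \<noteq> j \<Longrightarrow> odd (f k)" for f u v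
  proof -
    obtain w where w: "odd w" "u + v = 2 * w" using chi4_eq_half_sum_odd uv by metis
    show ?thesis
      by (rule merge_even_iso[OF ij uv(1,2) w(2)], rule odd_iso) (use uv w o in auto)
  qed
  obtain u v where uv: "f i = 2 * u" "f j = 2 * v" using even ij by (metis dvd_def)
  have o: "odd u" "odd v"
    using four[OF ij(1)] four[OF ij(2)] uv by auto
  show ?thesis
  proof (cases "chi4 u = chi4 v")
    case True
    then show ?thesis using same uv o even by blast
  next
    case False
    have "\<exists>k<5. k \<noteq> i \<and> k \<noteq> j"
    proof (rule ccontr)
      assume "\<not> ?thesis"
      then have "{..<5} \<subseteq> {i, j}" by auto
      then have "card {..<5::nat} \<le> card {i, j}" by (intro card_mono) auto
      also have "\<dots> \<le> 2" by (simp add: card_insert_if)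
      finally show False by simp
    qed
    then obtain k where k: "k < 5" "k \<noteq> i" "k \<noteq> j" by blast
    have ok: "odd (f k)" using even k by blast
    define u' where "u' = u * f k * (f k + 2 * u)"
    have ou: "odd u'" using o ok by (simp add: u'_def)
    have "chi4 u' = chi4 u * chi4 (f k) * chi4 (f k + 2 * u)"
      using chi4_mult[of "u * f k" "f k + 2 * u"] chi4_mult[of u "f k"] o ok by (simp add: u'_def)
    also have "\<dots> = - chi4 u" using chi4_add_double[OF ok o(1)] chi4_vals[of "f k"] by auto
    also have "\<dots> = chi4 v" using False chi4_vals[of u] chi4_vals[of v] by auto
    finally have "isotropic_if_indefinite (f(k := f k + 2 * u, i := 2 * u'))"
      by (intro same[of _ u' v]) (use uv ou o ok k ij even in auto)
    then show ?thesis unfolding u'_def using flip_even_iso[of i k f u] ij(1) k uv(1) by simp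
  qed
qed

text \<open>Even coefficients are removed in pairs. Among four of them two halves share a class
  modulo 4 and can be merged at once.\<close>

lemma even_card_even_iso:
  assumes four: "\<And>i. i < 5 \<Longrightarrow> \<not> 4 dvd f i" and card: "even (card {i. i < 5 \<and> even (f i)})"
  shows "isotropic_if_indefinite f"
proof -
  define E where "E = {i. i < 5 \<and> even (f i)}"
  have fE: "finite E" by (simp add: E_def)
  have "card E \<le> card {..<5::nat}" by (intro card_mono) (auto simp: E_def)
  then have "card E \<le> 5" by simp
  moreover have "even (card E)" using card by (simp only: E_def)
  ultimately have "card E = 0 \<or> card E = 2 \<or> card E = 4" by presburger
  then consider "card E = 0" | "card E = 2" | "card E = 4" by auto
  then show ?thesis
  proof cases
    case 1
    then have "E = {}" using fE by simp
    then show ?thesis by (intro odd_iso) (auto simp: E_def)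
  next
    case 2
    then obtain i j where ij: "E = {i, j}" "i \<noteq> j" by (auto simp: card_2_iff)
    then have "i < 5" "j < 5" "\<And>k. k < 5 \<Longrightarrow> even (f k) \<longleftrightarrow> k = i \<or> k = j" unfolding E_def by blast+
    then show ?thesis using two_even_iso[of f i j] four ij(2) by blast
  next
    case 3
    have "\<not> inj_on (\<lambda>i. chi4 (f i div 2)) E"
    proof (rule pigeonhole)
      have "card ((\<lambda>i. chi4 (f i div 2)) ` E) \<le> card {1, - 1 :: int}"
        using chi4_vals by (intro card_mono) auto
      then show "card ((\<lambda>i. chi4 (f i div 2)) ` E) < card E" using 3 by simp
    qed
    then obtain i j where ij: "i \<in> E" "j \<in> E" "i \<noteq> j" "chi4 (f i div 2) = chi4 (f j div 2)"
      unfolding inj_on_def by blast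
    define u v where "u = f i div 2" and "v = f j div 2"
    have l5: "i < 5" "j < 5" using ij by (auto simp: E_def)
    have uv: "f i = 2 * u" "f j = 2 * v" using ij by (auto simp: E_def u_def v_def)
    have o: "odd u" "odd v" using four[OF l5(1)] four[OF l5(2)] uv by auto
    obtain w where w: "odd w" "u + v = 2 * w" using chi4_eq_half_sum_odd[OF o] ij(4) unfolding u_def v_def by metis
    define g where "g = f(i := w, j := u * v * w)"
    have og: "odd (g i)" "odd (g j)" using o w ij(3) by (auto simp: g_def)
    have "card (E - {i, j}) = 2" using 3 ij fE by (simp add: card_Diff_subset)
    then obtain a b where ab: "E - {i, j} = {a, b}" "a \<noteq> b" by (auto simp: card_2_iff)
    have eg: "even (g k) \<longleftrightarrow> k \<in> E - {i, j}" if "k < 5" for k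
      using og that by (auto simp: g_def E_def)
    have "isotropic_if_indefinite g"
    proof (rule two_even_iso[of _ a b])
      show "a < 5" "b < 5" using ab(1) unfolding E_def by blast+
      show "even (g k) \<longleftrightarrow> k = a \<or> k = b" if "k < 5" for k using eg[OF that] unfolding ab(1) by blast
      show "\<not> 4 dvd g k" if "k < 5" for k
      proof (cases "k = i \<or> k = j")
        case True
        then show ?thesis using og by (auto dest: dvd_trans[of 2 4, rotated])
      next
        case False
        then show ?thesis using four[OF that] by (simp add: g_def)
      qed
    qed (rule ab)
    then show ?thesis unfolding g_def using merge_even_iso[OF l5 ij(3) uv w(2)] by blast
  qed
qed

theorem meyer:
  assumes nz: "\<And>i. i < 5 \<Longrightarrow> f i \<noteq> 0" and "\<exists>i<5. f i > 0" "\<exists>i<5. f i < 0"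
  shows "isotropic f"
proof -
  define g where "g i = squarefree_part (f i)" for i
  have four: "\<not> 4 dvd g i" for i
  proof
    assume "4 dvd g i"
    then have "2\<^sup>2 dvd g i" by simp
    moreover have "squarefree (g i)" by (simp add: g_def)
    ultimately have "is_unit (2::int)" unfolding squarefree_def by blast
    then show False by simp
  qed
  have "isotropic_if_indefinite g"
  proof (cases "even (card {i. i < 5 \<and> even (g i)})")
    case True
    then show ?thesis using even_card_even_iso four by blast
  next
    case False
    \<comment> \<open>Doubling the form and dropping squares exchanges odd and even coefficients,
      and five minus an odd number is even.\<close>
    define h where "h i = (if even (g i) then g i div 2 else 2 * g i)" for i
    have gh: "2 * g i = h i * (if even (g i) then 2 else 1)\<^sup>2" for i by (auto simp: h_def)
    have eh: "even (h i) \<longleftrightarrow> odd (g i)" for i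
    proof (cases "even (g i)")
      case True
      then obtain c where c: "g i = 2 * c" by auto
      then have "odd c" using four[of i] by auto
      then show ?thesis using c by (simp add: h_def)
    qed (simp add: h_def)
    have "isotropic_if_indefinite h"
    proof (rule even_card_even_iso)
      show "\<not> 4 dvd h i" for i
      proof (cases "even (g i)")
        case True
        then have "odd (h i)" using eh by blast
        then show ?thesis by (auto dest: dvd_trans[of 2 4, rotated])
      next
        case False
        then show ?thesis by (auto simp: h_def)
      qed
      have "{i. i < 5 \<and> even (h i)} = {..<5} - {i. i < 5 \<and> even (g i)}" using eh by auto
      then have "card {i. i < 5 \<and> even (h i)} = 5 - card {i. i < 5 \<and> even (g i)}"
        by (simp add: card_Diff_subset Collect_mono subset_eq)
      moreover have "card {i. i < 5 \<and> even (g i)} \<le> card {..<5::nat}" by (intro card_mono) auto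
      ultimately show "even (card {i. i < 5 \<and> even (h i)})" using False by simp
    qed
    then have "isotropic_if_indefinite (\<lambda>i. 2 * g i)"
      by (rule square_iso[of "\<lambda>i. if even (g i) then 2 else 1", rotated]) (use gh in auto)
    then show ?thesis using scale_iso[of 2 g] by simp
  qed
  then have "isotropic_if_indefinite f"
  proof (rule square_iso[of "\<lambda>i. square_part (f i)", rotated])
    fix i :: nat assume i: "i < 5"
    have "f i = g i * (square_part (f i))\<^sup>2" unfolding g_def by (rule squarefree_decompose)
    then show "square_part (f i) \<noteq> 0 \<and> f i = g i * (square_part (f i))\<^sup>2" using nz[OF i] by auto
  qed
  then show ?thesis using assms unfolding isotropic_if_indefinite_def by blast
qed

section \<open>Self-dual lattices of rank at most seven\<close>

text \<open>Here 1, \<open>b\<close>, \<open>a\<close> are the squared Gram-Schmidt lengths of a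
  basis of rank three and \<gamma>, \<mu>, \<nu> its Gram-Schmidt coefficients. \<open>P\<close> and
  \<open>R\<close> reflect that the first vector is shortest, \<open>Q\<close> that the second is
  shortest after projection. If a < 2/3, then \<gamma> and the fractional part of \<mu> are squeezed
  together until the vector with i = 1 is too short.\<close>

lemma korkine_zolotareff_core:
  fixes a b \<nu> \<mu> \<gamma> :: real
  assumes nu: "0 \<le> \<nu>" "\<nu> \<le> 1/2" and ga: "0 \<le> \<gamma>" "\<gamma> \<le> 1/2"
    and P: "\<And>i j :: int. a + (\<nu> - of_int i)\<^sup>2 * b + (\<mu> - of_int i * \<gamma> - of_int j)\<^sup>2 \<ge> 1"
    and Q: "a + \<nu>\<^sup>2 * b \<ge> b" and R: "b + \<gamma>\<^sup>2 \<ge> 1"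
  shows "a \<ge> 2/3"
proof (rule ccontr)
  assume "\<not> a \<ge> 2/3"
  then have a: "a < 2/3" by simp
  have nu2: "\<nu>\<^sup>2 \<le> 1/4" using power_mono[OF nu(2,1), of 2] by (simp add: power2_eq_square)
  have ga2: "\<gamma>\<^sup>2 \<le> 1/4" using power_mono[OF ga(2,1), of 2] by (simp add: power2_eq_square)
  have ab: "(1 - \<nu>\<^sup>2) * b \<le> a" using Q by (simp add: algebra_simps)
  have "(1 - \<nu>\<^sup>2) * (3/4) \<le> (1 - \<nu>\<^sup>2) * b" using R ga2 nu2 by (intro mult_left_mono) auto
  then have "\<nu>\<^sup>2 > (1/3)\<^sup>2" using ab a by (simp add: power2_eq_square)
  then have nu3: "\<nu> > 1/3" using nu(1) power2_less_imp_less by blast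
  \<comment> \<open>The segment \<nu> + s = 5/6 joins (1/3, 1/2) to (1/2, 1/3). At both ends the
    product in \<open>key\<close> equals 2/3, and in between it is larger.\<close>
  define s where "s = 5/6 - \<nu>"
  have s: "1/3 \<le> s" "s < 1/2" using nu nu3 by (auto simp: s_def)
  have key: "(1 - \<nu>\<^sup>2) * (1 - s\<^sup>2) \<ge> 2/3"
  proof -
    have "(\<nu> - 1/3) * (1/2 - \<nu>) \<ge> 0" using nu nu3 by simp
    then have p: "\<nu> * s \<ge> 1/6" by (simp add: s_def algebra_simps power2_eq_square)
    then have p2: "(\<nu> * s)\<^sup>2 \<ge> (1/6)\<^sup>2" by (intro power_mono) auto
    have "(\<nu> + s)\<^sup>2 = (5/6)\<^sup>2" by (simp add: s_def)
    then have "\<nu>\<^sup>2 + s\<^sup>2 = 25/36 - 2 * (\<nu> * s)" by (simp add: power2_eq_square algebra_simps)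
    then have "(1 - \<nu>\<^sup>2) * (1 - s\<^sup>2) = 11/36 + 2 * (\<nu> * s) + (\<nu> * s)\<^sup>2"
      by (simp add: algebra_simps power_mult_distrib)
    then show ?thesis using p p2 by (simp add: power2_eq_square)
  qed
  have small: "x > s" if x: "0 \<le> x" "(1 - \<nu>\<^sup>2) * (1 - x\<^sup>2) \<le> a" for x
  proof (rule ccontr)
    assume "\<not> x > s"
    then have "x\<^sup>2 \<le> s\<^sup>2" using x(1) by (intro power_mono) auto
    then have "(1 - \<nu>\<^sup>2) * (1 - s\<^sup>2) \<le> (1 - \<nu>\<^sup>2) * (1 - x\<^sup>2)" using nu2 by (intro mult_left_mono) auto
    then show False using x(2) key a by linarith
  qed
  have gs: "\<gamma> > s"
  proof (rule small[OF ga(1)])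
    have "(1 - \<nu>\<^sup>2) * (1 - \<gamma>\<^sup>2) \<le> (1 - \<nu>\<^sup>2) * b" using R nu2 by (intro mult_left_mono) auto
    then show "(1 - \<nu>\<^sup>2) * (1 - \<gamma>\<^sup>2) \<le> a" using ab by linarith
  qed
  define m where "m = \<mu> - of_int \<lfloor>\<mu>\<rfloor>"
  have m: "0 \<le> m" "m < 1" unfolding m_def by linarith+
  have dist: "(1 - \<nu>\<^sup>2) * (1 - d\<^sup>2) \<le> a" if "a + \<nu>\<^sup>2 * b + d\<^sup>2 \<ge> 1" for d
  proof -
    have "(1 - \<nu>\<^sup>2) * (1 - d\<^sup>2) \<le> (1 - \<nu>\<^sup>2) * (a + \<nu>\<^sup>2 * b)" using that nu2 by (intro mult_left_mono) auto
    also have "\<dots> = (1 - \<nu>\<^sup>2) * a + \<nu>\<^sup>2 * ((1 - \<nu>\<^sup>2) * b)" by (simp add: algebra_simps)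
    also have "\<dots> \<le> (1 - \<nu>\<^sup>2) * a + \<nu>\<^sup>2 * a" using ab by (intro add_left_mono mult_left_mono) auto
    finally show ?thesis by (simp add: algebra_simps)
  qed
  have "(\<mu> - of_int \<lfloor>\<mu>\<rfloor>)\<^sup>2 = m\<^sup>2" "(\<mu> - of_int (\<lfloor>\<mu>\<rfloor> + 1))\<^sup>2 = (1 - m)\<^sup>2"
    by (simp_all add: m_def power2_eq_square algebra_simps)
  then have "a + \<nu>\<^sup>2 * b + m\<^sup>2 \<ge> 1" "a + \<nu>\<^sup>2 * b + (1 - m)\<^sup>2 \<ge> 1"
    using P[of 0 "\<lfloor>\<mu>\<rfloor>"] P[of 0 "\<lfloor>\<mu>\<rfloor> + 1"] by simp_all
  then have ms: "m > s" "1 - m > s" using small dist m by auto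
  \<comment> \<open>This is 1 - 2s, the length of the interval from s to 1 - s, which contains both
    \<open>m\<close> and \<gamma>.\<close>
  define t where "t = 2 * \<nu> - 2/3"
  have "\<bar>m - \<gamma>\<bar> \<le> t" using ms gs ga s unfolding t_def s_def by linarith
  then have t2: "(m - \<gamma>)\<^sup>2 \<le> t\<^sup>2" by (metis abs_ge_zero power2_abs power_mono)
  have "a + (1 - \<nu>)\<^sup>2 * b + (m - \<gamma>)\<^sup>2 \<ge> 1"
    using P[of 1 "\<lfloor>\<mu>\<rfloor>"] by (simp add: m_def power2_eq_square algebra_simps)
  \<comment> \<open>The factor 1 + \<nu> lets \<open>b\<close> appear as (1 - \<nu>^2) b, which
    \<open>ab\<close> bounds by \<open>a\<close>; the coefficients of \<open>a\<close> then add up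
    to 2.\<close>
  then have "(1 + \<nu>) * (1 - t\<^sup>2) \<le> (1 + \<nu>) * (a + (1 - \<nu>)\<^sup>2 * b)" using t2 nu by (intro mult_left_mono) auto
  also have "\<dots> = (1 + \<nu>) * a + (1 - \<nu>) * ((1 - \<nu>\<^sup>2) * b)" by (simp add: algebra_simps power2_eq_square)
  also have "\<dots> \<le> (1 + \<nu>) * a + (1 - \<nu>) * a" using ab nu by (intro add_left_mono mult_left_mono) auto
  also have "\<dots> = 2 * a" by (simp add: algebra_simps)
  finally have "(1 + \<nu>) * (1 - t\<^sup>2) \<le> 2 * a" .
  moreover have "(1 + \<nu>) * (1 - t\<^sup>2) = 4/3 + (\<nu> - 1/3) * (1 - 4 * (1 + \<nu>) * (\<nu> - 1/3))"
    by (simp add: t_def power2_eq_square field_simps)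
  moreover have "4 * (1 + \<nu>) * (\<nu> - 1/3) \<le> 4 * (3/2) * (1/6)" using nu nu3 by (intro mult_mono) auto
  then have "(\<nu> - 1/3) * (1 - 4 * (1 + \<nu>) * (\<nu> - 1/3)) \<ge> 0" using nu3 by (intro mult_nonneg_nonneg) auto
  ultimately show False using a by linarith
qed

text \<open>Integral translations and sign changes of the basis bring \<nu> and \<gamma> into the
  range from 0 to 1/2: \<open>e\<close> is the sign given to the second basis vector,
  \<open>d\<close> the sign given to the first.\<close>

lemma korkine_zolotareff:
  fixes a b \<nu> \<mu> \<gamma> :: real
  assumes P: "\<And>i j :: int. a + (\<nu> - of_int i)\<^sup>2 * b + (\<mu> - of_int i * \<gamma> - of_int j)\<^sup>2 \<ge> 1"
    and Q: "\<And>i :: int. a + (\<nu> - of_int i)\<^sup>2 * b \<ge> b" and R: "\<And>j :: int. b + (\<gamma> - of_int j)\<^sup>2 \<ge> 1"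
  shows "a \<ge> 2/3"
proof -
  define i0 j0 where "i0 = round \<nu>" and "j0 = round \<gamma>"
  have half: "\<bar>\<nu> - of_int i0\<bar> \<le> 1/2" "\<bar>\<gamma> - of_int j0\<bar> \<le> 1/2"
    unfolding i0_def j0_def using of_int_round_abs_le[of \<nu>] of_int_round_abs_le[of \<gamma>]
    by (simp_all add: abs_minus_commute)
  have core: "a \<ge> 2/3" if e: "e = 1 \<or> e = - 1" "d = 1 \<or> d = - 1"
    "0 \<le> of_int e * (\<nu> - of_int i0)" "0 \<le> of_int d * of_int e * (\<gamma> - of_int j0)" for e d :: int
  proof (rule korkine_zolotareff_core[of "of_int e * (\<nu> - of_int i0)" "of_int d * of_int e * (\<gamma> - of_int j0)"
        a b "of_int d * (\<mu> - of_int i0 * \<gamma>)"])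
    show "of_int e * (\<nu> - of_int i0) \<le> 1/2" using half(1) e(1) unfolding abs_le_iff by auto
    show "of_int d * of_int e * (\<gamma> - of_int j0) \<le> 1/2" using half(2) e(1,2) unfolding abs_le_iff by auto
    have e2: "of_int e * of_int e = (1::real)" "of_int d * of_int d = (1::real)" using e by auto
    show "1 \<le> a + (of_int e * (\<nu> - of_int i0) - of_int i)\<^sup>2 * b
        + (of_int d * (\<mu> - of_int i0 * \<gamma>) - of_int i * (of_int d * of_int e * (\<gamma> - of_int j0)) - of_int j)\<^sup>2"
      for i j :: int
    proof -
      have "(of_int e * (\<nu> - of_int i0) - of_int i)\<^sup>2 = (\<nu> - of_int (i0 + e * i))\<^sup>2"
        using e(1) by (auto simp: power2_eq_square algebra_simps)
      moreover have "(of_int d * (\<mu> - of_int i0 * \<gamma>) - of_int i * (of_int d * of_int e * (\<gamma> - of_int j0)) - of_int j)\<^sup>2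
        = (\<mu> - of_int (i0 + e * i) * \<gamma> - of_int (d * j - e * i * j0))\<^sup>2"
        using e(1,2) by (auto simp: power2_eq_square algebra_simps)
      ultimately show ?thesis using P[of "i0 + e * i" "d * j - e * i * j0"] by simp
    qed
    show "b \<le> a + (of_int e * (\<nu> - of_int i0))\<^sup>2 * b"
      using Q[of i0] e2 by (simp add: power_mult_distrib power2_eq_square[of "of_int e"])
    show "1 \<le> b + (of_int d * of_int e * (\<gamma> - of_int j0))\<^sup>2"
      using R[of j0] e2 by (simp add: power_mult_distrib power2_eq_square[of "of_int e"] power2_eq_square[of "of_int d"])
  qed (use e in auto)
  define e :: int where "e = (if \<nu> - of_int i0 \<ge> 0 then 1 else - 1)"
  define d :: int where "d = (if of_int e * (\<gamma> - of_int j0) \<ge> 0 then 1 else - 1)"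
  show ?thesis by (rule core[of e d]) (auto simp: e_def d_def mult.assoc)
qed

section \<open>Lattices and orthogonal projection\<close>

definition additive_subgroup :: "'a::real_vector set \<Rightarrow> bool" where
  "additive_subgroup L \<longleftrightarrow> 0 \<in> L \<and> (\<forall>x\<in>L. \<forall>y\<in>L. x - y \<in> L)"

lemma additive_subgroupD:
  assumes "additive_subgroup L" "x \<in> L" "y \<in> L"
  shows "0 \<in> L" "x - y \<in> L" "- x \<in> L" "x + y \<in> L"
proof -
  show 0: "0 \<in> L" "x - y \<in> L" using assms by (auto simp: additive_subgroup_def)
  have neg: "- z \<in> L" if "z \<in> L" for z
    using assms(1) that 0(1) unfolding additive_subgroup_def by (metis diff_0)
  show "- x \<in> L" using neg assms(2) .
  show "x + y \<in> L" using assms neg unfolding additive_subgroup_def by (metis diff_minus_eq_add)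
qed

lemma additive_subgroup_scaleR:
  assumes "additive_subgroup L" "x \<in> L"
  shows "of_int z *\<^sub>R x \<in> L"
proof -
  have n: "of_nat n *\<^sub>R x \<in> L" for n
  proof (induction n)
    case 0
    then show ?case using assms(1) by (simp add: additive_subgroup_def)
  next
    case (Suc n)
    then show ?case using additive_subgroupD(4)[OF assms(1,2) Suc] by (simp add: algebra_simps)
  qed
  show ?thesis
  proof (cases "z \<ge> 0")
    case True
    then show ?thesis using n[of "nat z"] by simp
  next
    case False
    then show ?thesis using additive_subgroupD(3)[OF assms(1) n[of "nat (- z)"] n[of 0]] by simp
  qed
qed

text \<open>Discreteness encoded by a common denominator of all inner products. It yields shortest
  vectors and survives projection along a lattice vector, without any choice of a basis.\<close>

definition rational_lattice :: "'a::euclidean_space set \<Rightarrow> bool" where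
  "rational_lattice L \<longleftrightarrow> additive_subgroup L \<and> (\<exists>D::nat. D > 0 \<and> (\<forall>x\<in>L. \<forall>y\<in>L. real D * (x \<bullet> y) \<in> \<int>))"

lemma minimal_vector_exists:
  assumes L: "rational_lattice L" "x0 \<in> L" "x0 \<noteq> 0"
  obtains b where "b \<in> L" "b \<noteq> 0" "\<And>x. x \<in> L \<Longrightarrow> x \<noteq> 0 \<Longrightarrow> b \<bullet> b \<le> x \<bullet> x"
proof -
  obtain D :: nat where D: "D > 0" "\<And>x y. x \<in> L \<Longrightarrow> y \<in> L \<Longrightarrow> real D * (x \<bullet> y) \<in> \<int>"
    using L(1) unfolding rational_lattice_def by blast
  define h where "h x = nat \<lfloor>real D * (x \<bullet> x)\<rfloor>" for x :: 'a
  have h: "real (h x) = real D * (x \<bullet> x)" if "x \<in> L" for x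
  proof -
    have "of_int \<lfloor>real D * (x \<bullet> x)\<rfloor> = real D * (x \<bullet> x)" using D(2)[OF that that] by simp
    moreover have "\<lfloor>real D * (x \<bullet> x)\<rfloor> \<ge> 0" by simp
    ultimately show ?thesis unfolding h_def by (metis of_nat_nat of_int_of_nat_eq)
  qed
  obtain b where b: "b \<in> L \<and> b \<noteq> 0" "\<And>y. y \<in> L \<and> y \<noteq> 0 \<Longrightarrow> h b \<le> h y"
    using ex_has_least_nat[of "\<lambda>x. x \<in> L \<and> x \<noteq> 0" x0 h] L(2,3) by blast
  have "b \<bullet> b \<le> x \<bullet> x" if "x \<in> L" "x \<noteq> 0" for x
  proof -
    have "real (h b) \<le> real (h x)" using b(2)[of x] that by simp
    then have "real D * (b \<bullet> b) \<le> real D * (x \<bullet> x)" using h b(1) that by simp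
    then show ?thesis using D(1) by simp
  qed
  then show ?thesis using that b(1) by blast
qed

definition proj_away :: "'a::euclidean_space \<Rightarrow> 'a \<Rightarrow> 'a" where
  "proj_away b x = x - ((x \<bullet> b) / (b \<bullet> b)) *\<^sub>R b"

lemma proj_away_orthogonal: "b \<noteq> 0 \<Longrightarrow> proj_away b x \<bullet> b = 0"
  by (simp add: proj_away_def inner_diff_left)

lemma proj_away_inner: "y \<bullet> b = 0 \<Longrightarrow> proj_away b x \<bullet> y = x \<bullet> y"
  by (simp add: proj_away_def inner_diff_left inner_commute[of b y])

lemma proj_away_diff: "proj_away b (x - y) = proj_away b x - proj_away b y"
  by (simp add: proj_away_def inner_diff_left diff_divide_distrib algebra_simps)

lemma proj_away_self: "b \<noteq> 0 \<Longrightarrow> proj_away b (c *\<^sub>R b) = 0"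
  by (simp add: proj_away_def)

lemma proj_away_eq: "x = proj_away b x + ((x \<bullet> b) / (b \<bullet> b)) *\<^sub>R b"
  by (simp add: proj_away_def)

lemma norm_orthogonal_sum:
  fixes y b :: "'a::euclidean_space"
  shows "y \<bullet> b = 0 \<Longrightarrow> (y + c *\<^sub>R b) \<bullet> (y + c *\<^sub>R b) = y \<bullet> y + c\<^sup>2 * (b \<bullet> b)"
  by (simp add: inner_simps inner_commute power2_eq_square algebra_simps)

lemma rational_lattice_proj_away:
  assumes L: "rational_lattice L" "b \<in> L" "b \<noteq> 0"
  shows "rational_lattice (proj_away b ` L)"
proof -
  have sub: "additive_subgroup L" using L(1) by (simp add: rational_lattice_def)
  obtain D :: nat where D: "D > 0" "\<And>x y. x \<in> L \<Longrightarrow> y \<in> L \<Longrightarrow> real D * (x \<bullet> y) \<in> \<int>"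
    using L(1) unfolding rational_lattice_def by blast
  obtain k where k: "real D * (b \<bullet> b) = of_int k" using D(2)[OF L(2,2)] by (auto elim: Ints_cases)
  have "real D * (b \<bullet> b) > 0" using D(1) L(3) by simp
  then have kpos: "k > 0" using k by simp
  have "additive_subgroup (proj_away b ` L)"
  proof -
    have "proj_away b 0 = 0" by (simp add: proj_away_def)
    then have "0 \<in> proj_away b ` L" using sub by (metis additive_subgroup_def image_eqI)
    moreover have "proj_away b x - proj_away b y \<in> proj_away b ` L" if "x \<in> L" "y \<in> L" for x y
      unfolding proj_away_diff[symmetric] using sub that by (auto simp: additive_subgroup_def)
    ultimately show ?thesis by (auto simp: additive_subgroup_def)
  qed
  \<comment> \<open>Projection divides by the norm of \<open>b\<close>; with \<open>k\<close> equal
    to \<open>D\<close> times that norm, the denominator \<open>D * k\<close> absorbs this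
    division.\<close>
  moreover have "real (D * nat k) * (proj_away b x \<bullet> proj_away b y) \<in> \<int>" if xy: "x \<in> L" "y \<in> L" for x y
  proof -
    have "proj_away b x \<bullet> proj_away b y = x \<bullet> proj_away b y"
      by (rule proj_away_inner) (rule proj_away_orthogonal[OF L(3)])
    also have "\<dots> = x \<bullet> y - (y \<bullet> b) * (x \<bullet> b) / (b \<bullet> b)"
      by (simp add: proj_away_def inner_diff_right)
    finally have eq: "proj_away b x \<bullet> proj_away b y = x \<bullet> y - (y \<bullet> b) * (x \<bullet> b) / (b \<bullet> b)" .
    have "real (D * nat k) = real D * of_int k" using kpos by simp
    then have "real (D * nat k) * (proj_away b x \<bullet> proj_away b y)
        = of_int k * (real D * (x \<bullet> y)) - (real D * (y \<bullet> b)) * (x \<bullet> b) * (of_int k / (b \<bullet> b))"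
      unfolding eq by (simp only: right_diff_distrib times_divide_eq_right times_divide_eq_left mult_ac)
    also have "of_int k / (b \<bullet> b) = real D" using k L(3) by (metis inner_eq_zero_iff nonzero_mult_div_cancel_right)
    finally have "real (D * nat k) * (proj_away b x \<bullet> proj_away b y)
        = of_int k * (real D * (x \<bullet> y)) - (real D * (y \<bullet> b)) * (real D * (x \<bullet> b))"
      by (simp add: mult_ac)
    then show ?thesis using D(2) xy L(2) by simp
  qed
  moreover have "D * nat k > 0" using D(1) kpos by simp
  ultimately show ?thesis unfolding rational_lattice_def by blast
qed

lemma dim_orthogonal_remove:
  fixes L :: "'a::euclidean_space set"
  assumes b: "b \<noteq> 0" "b \<in> span L" and S: "S \<subseteq> span L" "\<And>x. x \<in> S \<Longrightarrow> x \<bullet> b = 0"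
    and L: "L \<subseteq> span (insert b S)"
  shows "dim L = dim S + 1"
proof -
  have "span (insert b S) = span L"
    using b(2) S(1) L by (intro antisym span_minimal) (auto simp: subspace_span)
  then have "dim L = dim (insert b S)" by (metis dim_span)
  moreover have "b \<notin> span S"
  proof
    assume "b \<in> span S"
    moreover have "span S \<subseteq> {x. x \<bullet> b = 0}"
      by (rule span_minimal) (use S(2) in \<open>auto simp: subspace_def inner_simps\<close>)
    ultimately have "b \<bullet> b = 0" by blast
    then show False using b(1) by simp
  qed
  ultimately show ?thesis by (simp add: dim_insert)
qed

lemma span_proj_away: "b \<in> span L \<Longrightarrow> x \<in> span L \<Longrightarrow> proj_away b x \<in> span L"
  unfolding proj_away_def by (intro span_diff span_scale)

lemma dim_proj_away:
  fixes L :: "'a::euclidean_space set"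
  assumes "b \<in> L" "b \<noteq> 0"
  shows "dim L = dim (proj_away b ` L) + 1"
proof (rule dim_orthogonal_remove[OF assms(2)])
  show "b \<in> span L" using assms(1) by (rule span_base)
  show "proj_away b ` L \<subseteq> span L" using assms(1) by (auto intro: span_proj_away span_base)
  show "\<And>x. x \<in> proj_away b ` L \<Longrightarrow> x \<bullet> b = 0" using proj_away_orthogonal[OF assms(2)] by blast
  show "L \<subseteq> span (insert b (proj_away b ` L))"
  proof
    fix x assume "x \<in> L"
    then have "proj_away b x + ((x \<bullet> b) / (b \<bullet> b)) *\<^sub>R b \<in> span (insert b (proj_away b ` L))"
      by (intro span_add span_scale span_base) auto
    then show "x \<in> span (insert b (proj_away b ` L))" using proj_away_eq[of x b] by simp
  qed
qed

lemma dim_pos_nonzero: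
  fixes L :: "'a::euclidean_space set"
  assumes "dim L > 0"
  obtains x where "x \<in> L" "x \<noteq> 0"
proof -
  have "\<not> L \<subseteq> {0}" using assms dim_eq_0[of L] by (metis less_irrefl)
  then show ?thesis using that by blast
qed

lemma projected_norm_bound:
  assumes sub: "additive_subgroup L" and b: "b \<in> L" "b \<noteq> 0" "\<And>x. x \<in> L \<Longrightarrow> x \<noteq> 0 \<Longrightarrow> b \<bullet> b \<le> x \<bullet> x"
    and x: "x \<in> L" "proj_away b x \<noteq> 0"
  shows "b \<bullet> b \<le> proj_away b x \<bullet> proj_away b x + ((x \<bullet> b) / (b \<bullet> b) - of_int j)\<^sup>2 * (b \<bullet> b)"
proof -
  define x' where "x' = x - of_int j *\<^sub>R b"
  have "x' \<in> L" unfolding x'_def using additive_subgroupD(2)[OF sub x(1) additive_subgroup_scaleR[OF sub b(1)]] .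
  moreover have e: "x' = proj_away b x + ((x \<bullet> b) / (b \<bullet> b) - of_int j) *\<^sub>R b"
    unfolding x'_def proj_away_def by (simp add: algebra_simps)
  have "proj_away b x' = proj_away b x"
    unfolding x'_def proj_away_diff using proj_away_self[OF b(2)] by simp
  then have "x' \<noteq> 0" using x(2) by (auto simp: proj_away_def)
  ultimately have "b \<bullet> b \<le> x' \<bullet> x'" using b(3) by blast
  also have "x' \<bullet> x' = proj_away b x \<bullet> proj_away b x + ((x \<bullet> b) / (b \<bullet> b) - of_int j)\<^sup>2 * (b \<bullet> b)"
    unfolding e by (rule norm_orthogonal_sum) (rule proj_away_orthogonal[OF b(2)])
  finally show ?thesis .
qed

lemma proj_minimum_ge:
  assumes sub: "additive_subgroup L" and b: "b \<in> L" "b \<noteq> 0" "\<And>x. x \<in> L \<Longrightarrow> x \<noteq> 0 \<Longrightarrow> b \<bullet> b \<le> x \<bullet> x"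
    and y: "y \<in> proj_away b ` L" "y \<noteq> 0"
  shows "3/4 * (b \<bullet> b) \<le> y \<bullet> y"
proof -
  obtain x where x: "x \<in> L" "y = proj_away b x" using y(1) by blast
  define c where "c = (x \<bullet> b) / (b \<bullet> b)"
  have "\<bar>c - of_int (round c)\<bar> \<le> 1/2" using of_int_round_abs_le[of c] by (simp add: abs_minus_commute)
  then have "(c - of_int (round c))\<^sup>2 \<le> (1/2)\<^sup>2" by (metis abs_ge_zero power2_abs power_mono)
  then have "(c - of_int (round c))\<^sup>2 * (b \<bullet> b) \<le> (1/2)\<^sup>2 * (b \<bullet> b)" by (intro mult_right_mono) auto
  moreover have "b \<bullet> b \<le> y \<bullet> y + (c - of_int (round c))\<^sup>2 * (b \<bullet> b)"
    using projected_norm_bound[OF sub b x(1), of "round c"] x(2) y(2) unfolding c_def by simp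
  ultimately show ?thesis by (simp add: power2_eq_square)
qed

text \<open>\<open>b1\<close>, \<open>b2\<close> and \<open>y\<close> arise by Gram-Schmidt
  orthogonalisation from three lattice vectors; dividing all squared lengths by that of
  \<open>b1\<close> gives the normalised inequality.\<close>

lemma double_proj_minimum_ge:
  assumes L: "rational_lattice L" and b1: "b1 \<in> L" "b1 \<noteq> 0" "\<And>x. x \<in> L \<Longrightarrow> x \<noteq> 0 \<Longrightarrow> b1 \<bullet> b1 \<le> x \<bullet> x"
    and b2: "b2 \<in> proj_away b1 ` L" "b2 \<noteq> 0" "\<And>x. x \<in> proj_away b1 ` L \<Longrightarrow> x \<noteq> 0 \<Longrightarrow> b2 \<bullet> b2 \<le> x \<bullet> x"
    and y: "y \<in> proj_away b2 ` proj_away b1 ` L" "y \<noteq> 0"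
  shows "2/3 * (b1 \<bullet> b1) \<le> y \<bullet> y"
proof -
  define A where "A = b1 \<bullet> b1"
  define B where "B = b2 \<bullet> b2"
  have pos: "A > 0" "B > 0" using b1 b2 by (simp_all add: A_def B_def)
  have sub: "additive_subgroup L" using L by (simp add: rational_lattice_def)
  have sub1: "additive_subgroup (proj_away b1 ` L)"
    using rational_lattice_proj_away[OF L b1(1,2)] by (simp add: rational_lattice_def)
  obtain x where x: "x \<in> L" "y = proj_away b2 (proj_away b1 x)" using y(1) by blast
  obtain x2 where x2: "x2 \<in> L" "b2 = proj_away b1 x2" using b2(1) by blast
  define \<nu> \<mu> \<gamma> where "\<nu> = (proj_away b1 x \<bullet> b2) / B" and "\<mu> = (x \<bullet> b1) / A" and "\<gamma> = (x2 \<bullet> b1) / A"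
  have scaled: "1 \<le> t / A + c" if "A \<le> t + c * A" for t c
    using divide_right_mono[OF that, of A] pos(1) by (simp add: add_divide_distrib)
  have "y \<bullet> y / A \<ge> 2/3"
  proof (rule korkine_zolotareff[of "y \<bullet> y / A" \<nu> "B / A" \<mu> \<gamma>])
    fix i j :: int
    define z where "z = x - of_int i *\<^sub>R x2"
    have z: "z \<in> L" unfolding z_def using additive_subgroupD(2)[OF sub x(1) additive_subgroup_scaleR[OF sub x2(1)]] .
    have pz: "proj_away b1 z = y + (\<nu> - of_int i) *\<^sub>R b2"
    proof -
      have "proj_away b1 (of_int i *\<^sub>R x2) = of_int i *\<^sub>R b2"
        unfolding x2(2) proj_away_def by (simp add: scaleR_diff_right)
      moreover have "proj_away b1 x = y + \<nu> *\<^sub>R b2"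
        unfolding x(2) \<nu>_def B_def by (rule proj_away_eq)
      ultimately show ?thesis unfolding z_def proj_away_diff by (simp add: algebra_simps)
    qed
    have yb: "y \<bullet> b2 = 0" unfolding x(2) by (rule proj_away_orthogonal[OF b2(2)])
    have npz: "proj_away b1 z \<bullet> proj_away b1 z = y \<bullet> y + (\<nu> - of_int i)\<^sup>2 * B"
      unfolding pz B_def by (rule norm_orthogonal_sum[OF yb])
    have "proj_away b1 z \<bullet> proj_away b1 z > 0"
      unfolding npz using y(2) pos by (intro add_pos_nonneg) auto
    then have nz: "proj_away b1 z \<noteq> 0" by auto
    have "B \<le> y \<bullet> y + (\<nu> - of_int i)\<^sup>2 * B"
      using b2(3)[OF imageI[OF z] nz] npz unfolding B_def by simp
    then have "B / A \<le> (y \<bullet> y + (\<nu> - of_int i)\<^sup>2 * B) / A" using pos by (intro divide_right_mono) auto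
    then show "B / A \<le> y \<bullet> y / A + (\<nu> - of_int i)\<^sup>2 * (B / A)" by (simp add: add_divide_distrib)
    have "(z \<bullet> b1) / A = \<mu> - of_int i * \<gamma>"
      unfolding z_def \<mu>_def \<gamma>_def by (simp add: inner_diff_left diff_divide_distrib)
    then have "A \<le> y \<bullet> y + (\<nu> - of_int i)\<^sup>2 * B + (\<mu> - of_int i * \<gamma> - of_int j)\<^sup>2 * A"
      using projected_norm_bound[OF sub b1 z nz, of j] npz unfolding A_def by simp
    then have "1 \<le> (y \<bullet> y + (\<nu> - of_int i)\<^sup>2 * B) / A + (\<mu> - of_int i * \<gamma> - of_int j)\<^sup>2" by (rule scaled)
    then show "1 \<le> y \<bullet> y / A + (\<nu> - of_int i)\<^sup>2 * (B / A) + (\<mu> - of_int i * \<gamma> - of_int j)\<^sup>2"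
      by (simp add: add_divide_distrib)
    have "A \<le> B + (\<gamma> - of_int j)\<^sup>2 * A"
      using projected_norm_bound[OF sub b1 x2(1), of j] b2(2) x2(2) unfolding A_def B_def \<gamma>_def by simp
    then show "1 \<le> B / A + (\<gamma> - of_int j)\<^sup>2" by (rule scaled)
  qed
  then show ?thesis using pos unfolding A_def by (simp add: field_simps)
qed

text \<open>\<open>w\<close> is the last Gram-Schmidt vector obtained by projecting repeatedly along
  shortest vectors, so all its products with \<open>L\<close> are multiples of its norm. Two
  projections at a time cost only 2/3, whereas two single ones would cost (3/4)^2 = 9/16, too much
  for rank 7.\<close>

lemma long_dual_vector:
  assumes "rational_lattice L" "dim L = k" "k > 0" "m > 0" "\<And>x. x \<in> L \<Longrightarrow> x \<noteq> 0 \<Longrightarrow> m \<le> x \<bullet> x"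
  shows "\<exists>w\<in>span L. w \<noteq> 0 \<and> (2/3) ^ (k div 2) * m \<le> w \<bullet> w \<and> (\<forall>x\<in>L. \<exists>z::int. x \<bullet> w = of_int z * (w \<bullet> w))"
  using assms
proof (induction k arbitrary: L m rule: less_induct)
  case (less k)
  note L = less.prems(1) and dimL = less.prems(2) and kpos = less.prems(3) and mpos = less.prems(4)
    and mL = less.prems(5)
  have sub: "additive_subgroup L" using L by (simp add: rational_lattice_def)
  obtain x0 where x0: "x0 \<in> L" "x0 \<noteq> 0" using dim_pos_nonzero dimL kpos by metis
  obtain b where b: "b \<in> L" "b \<noteq> 0" "\<And>x. x \<in> L \<Longrightarrow> x \<noteq> 0 \<Longrightarrow> b \<bullet> b \<le> x \<bullet> x"
    using minimal_vector_exists[OF L x0] by blast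
  have mb: "m \<le> b \<bullet> b" using mL b by blast
  define L1 where "L1 = proj_away b ` L"
  have L1: "rational_lattice L1" unfolding L1_def by (rule rational_lattice_proj_away[OF L b(1,2)])
  have dim1: "dim L = dim L1 + 1" unfolding L1_def by (rule dim_proj_away[OF b(1,2)])
  have span1: "span L1 \<subseteq> span L"
    unfolding L1_def using b(1) by (intro span_minimal) (auto intro: span_proj_away span_base)
  have orth1: "w \<bullet> b = 0" if "w \<in> span L1" for w
  proof -
    have "span L1 \<subseteq> {x. x \<bullet> b = 0}"
      by (rule span_minimal) (use proj_away_orthogonal[OF b(2)] in \<open>auto simp: L1_def subspace_def inner_simps\<close>)
    then show ?thesis using that by blast
  qed
  have lift: "\<exists>z::int. x \<bullet> w = of_int z * (w \<bullet> w)" if "x \<in> L" "w \<in> span L1"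
    "\<forall>x\<in>L1. \<exists>z::int. x \<bullet> w = of_int z * (w \<bullet> w)" for x w
    using bspec[OF that(3), of "proj_away b x"] that(1) proj_away_inner[of w b x] orth1[OF that(2)]
    by (simp add: L1_def)
  consider "k = 1" | "k = 2" | "k \<ge> 3" using kpos by linarith
  then show ?case
  proof cases
    case 1
    have "\<exists>z::int. x \<bullet> b = of_int z * (b \<bullet> b)" if x: "x \<in> L" for x
    proof -
      have "dim L1 = 0" using dim1 dimL 1 by simp
      then have "L1 \<subseteq> {0}" by (simp add: dim_eq_0)
      then have px: "proj_away b x = 0" using x by (auto simp: L1_def)
      define c where "c = (x \<bullet> b) / (b \<bullet> b)"
      have xc: "x = c *\<^sub>R b" using proj_away_eq[of x b] px by (simp add: c_def)
      define x' where "x' = x - of_int (round c) *\<^sub>R b"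
      have "x' \<in> L" unfolding x'_def using additive_subgroupD(2)[OF sub x additive_subgroup_scaleR[OF sub b(1)]] .
      have x'c: "x' = (c - of_int (round c)) *\<^sub>R b" unfolding x'_def xc by (simp add: algebra_simps)
      have "\<bar>c - of_int (round c)\<bar> \<le> 1/2" using of_int_round_abs_le[of c] by (simp add: abs_minus_commute)
      then have "(c - of_int (round c))\<^sup>2 \<le> (1/2)\<^sup>2" by (metis abs_ge_zero power2_abs power_mono)
      then have "(c - of_int (round c))\<^sup>2 * (b \<bullet> b) \<le> (1/2)\<^sup>2 * (b \<bullet> b)" by (intro mult_right_mono) auto
      also have "\<dots> < b \<bullet> b" using b(2) by (simp add: power2_eq_square)
      finally have "x' \<bullet> x' < b \<bullet> b" unfolding x'c by (simp add: power2_eq_square mult_ac)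
      then have "x' = 0" using b(3)[OF \<open>x' \<in> L\<close>] by force
      then have "c = of_int (round c)" using x'c b(2) by simp
      then have "x \<bullet> b = of_int (round c) * (b \<bullet> b)" using xc by (metis inner_scaleR_left)
      then show ?thesis by blast
    qed
    moreover have "(2/3) ^ (k div 2) * m \<le> b \<bullet> b" using 1 mb by simp
    ultimately show ?thesis using b(1,2) span_base by blast
  next
    case 2
    have m1: "3/4 * m \<le> y \<bullet> y" if "y \<in> L1" "y \<noteq> 0" for y
    proof -
      have "3/4 * (b \<bullet> b) \<le> y \<bullet> y"
        by (rule proj_minimum_ge[OF sub b]) (use that in \<open>auto simp: L1_def\<close>)
      then show ?thesis using mb by linarith
    qed
    have "\<exists>w\<in>span L1. w \<noteq> 0 \<and> (2/3) ^ (1 div 2) * (3/4 * m) \<le> w \<bullet> w \<and> (\<forall>x\<in>L1. \<exists>z::int. x \<bullet> w = of_int z * (w \<bullet> w))"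
      by (rule less.IH[OF _ L1]) (use 2 dim1 dimL mpos m1 in auto)
    then obtain w where w: "w \<in> span L1" "w \<noteq> 0" "3/4 * m \<le> w \<bullet> w" "\<forall>x\<in>L1. \<exists>z::int. x \<bullet> w = of_int z * (w \<bullet> w)"
      by auto
    \<comment> \<open>In rank two the bound 3/4 for a single projection is available and is weakened
      to 2/3.\<close>
    have "(2/3) ^ (k div 2) * m \<le> w \<bullet> w" using 2 w(3) mpos by simp
    then show ?thesis using w span1 lift by blast
  next
    case 3
    have "dim L1 > 0" using dim1 dimL 3 by simp
    then obtain x1 where x1: "x1 \<in> L1" "x1 \<noteq> 0" using dim_pos_nonzero by metis
    obtain b2 where b2: "b2 \<in> L1" "b2 \<noteq> 0" "\<And>x. x \<in> L1 \<Longrightarrow> x \<noteq> 0 \<Longrightarrow> b2 \<bullet> b2 \<le> x \<bullet> x"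
      using minimal_vector_exists[OF L1 x1] by blast
    define L2 where "L2 = proj_away b2 ` L1"
    have L2: "rational_lattice L2" unfolding L2_def by (rule rational_lattice_proj_away[OF L1 b2(1,2)])
    have dim2: "dim L1 = dim L2 + 1" unfolding L2_def by (rule dim_proj_away[OF b2(1,2)])
    have span2: "span L2 \<subseteq> span L1"
      unfolding L2_def using b2(1) by (intro span_minimal) (auto intro: span_proj_away span_base)
    have orth2: "w \<bullet> b2 = 0" if "w \<in> span L2" for w
    proof -
      have "span L2 \<subseteq> {x. x \<bullet> b2 = 0}"
        by (rule span_minimal) (use proj_away_orthogonal[OF b2(2)] in \<open>auto simp: L2_def subspace_def inner_simps\<close>)
      then show ?thesis using that by blast
    qed
    have m2: "2/3 * m \<le> y \<bullet> y" if "y \<in> L2" "y \<noteq> 0" for y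
    proof -
      have "2/3 * (b \<bullet> b) \<le> y \<bullet> y"
        by (rule double_proj_minimum_ge[OF L b, of b2]) (use that b2 in \<open>auto simp: L1_def L2_def\<close>)
      then show ?thesis using mb by linarith
    qed
    have "\<exists>w\<in>span L2. w \<noteq> 0 \<and> (2/3) ^ ((k - 2) div 2) * (2/3 * m) \<le> w \<bullet> w
        \<and> (\<forall>x\<in>L2. \<exists>z::int. x \<bullet> w = of_int z * (w \<bullet> w))"
      by (rule less.IH[OF _ L2]) (use 3 dim1 dim2 dimL mpos m2 in auto)
    then obtain w where w: "w \<in> span L2" "w \<noteq> 0" "(2/3) ^ ((k - 2) div 2) * (2/3 * m) \<le> w \<bullet> w"
      "\<forall>x\<in>L2. \<exists>z::int. x \<bullet> w = of_int z * (w \<bullet> w)" by auto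
    have "\<forall>x\<in>L1. \<exists>z::int. x \<bullet> w = of_int z * (w \<bullet> w)"
      using w(4) proj_away_inner[of w b2] orth2[OF w(1)] by (simp add: L2_def)
    moreover have "k div 2 = Suc ((k - 2) div 2)" using 3 by linarith
    then have "(2/3) ^ (k div 2) * m \<le> w \<bullet> w" using w(3) by (simp add: mult_ac)
    ultimately show ?thesis using w(1,2) span1 span2 lift by blast
  qed
qed

text \<open>Unimodularity relative to the span, so that the notion passes to the orthogonal
  complement of a unit vector inside the same ambient space.\<close>

definition self_dual :: "'a::euclidean_space set \<Rightarrow> bool" where
  "self_dual L \<longleftrightarrow> additive_subgroup L \<and> (\<forall>x\<in>L. \<forall>y\<in>L. x \<bullet> y \<in> \<int>)
     \<and> (\<forall>y\<in>span L. (\<forall>x\<in>L. x \<bullet> y \<in> \<int>) \<longrightarrow> y \<in> L)"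

text \<open>By self-duality \<open>u\<close>, the vector \<open>w\<close> divided by its norm, lies
  in \<open>L\<close>, so its norm is at least the minimum \<open>m\<close>. Together with the lower
  bound for the norm of \<open>w\<close> this gives m^2 \<le> (3/2)^3 = 27/8 < 4. In rank 8 the
  exponent would be 4, and (3/2)^4 exceeds 4.\<close>

lemma self_dual_unit_vector:
  fixes L :: "'a::euclidean_space set"
  assumes L: "self_dual L" and dim: "0 < dim L" "dim L \<le> 7"
  obtains e where "e \<in> L" "e \<bullet> e = 1"
proof -
  have sub: "additive_subgroup L" and int: "\<And>x y. x \<in> L \<Longrightarrow> y \<in> L \<Longrightarrow> x \<bullet> y \<in> \<int>"
    and dual: "\<And>y. y \<in> span L \<Longrightarrow> (\<forall>x\<in>L. x \<bullet> y \<in> \<int>) \<Longrightarrow> y \<in> L"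
    using L by (auto simp: self_dual_def)
  have rat: "rational_lattice L" unfolding rational_lattice_def using sub int by (intro conjI exI[of _ 1]) auto
  obtain x0 where x0: "x0 \<in> L" "x0 \<noteq> 0" using dim_pos_nonzero dim(1) by metis
  obtain b where b: "b \<in> L" "b \<noteq> 0" "\<And>x. x \<in> L \<Longrightarrow> x \<noteq> 0 \<Longrightarrow> b \<bullet> b \<le> x \<bullet> x"
    using minimal_vector_exists[OF rat x0] by blast
  define m where "m = b \<bullet> b"
  have m: "m > 0" "m \<in> \<int>" using b int by (auto simp: m_def)
  obtain w where w: "w \<in> span L" "w \<noteq> 0" "(2/3) ^ (dim L div 2) * m \<le> w \<bullet> w"
    "\<And>x. x \<in> L \<Longrightarrow> \<exists>z::int. x \<bullet> w = of_int z * (w \<bullet> w)"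
    using long_dual_vector[OF rat refl dim(1) m(1)] b(3) unfolding m_def by blast
  have w0: "w \<bullet> w > 0" using w(2) by simp
  have "dim L div 2 \<le> 3" using dim(2) by linarith
  then have "(2/3) ^ 3 \<le> (2/3 :: real) ^ (dim L div 2)" by (intro power_decreasing) auto
  then have "(2/3) ^ 3 * m \<le> (2/3) ^ (dim L div 2) * m" using m(1) by (intro mult_right_mono) auto
  then have wm: "8/27 * m \<le> w \<bullet> w" using w(3) by (simp add: power3_eq_cube)
  define u where "u = (1 / (w \<bullet> w)) *\<^sub>R w"
  have "u \<in> L"
  proof (rule dual)
    show "u \<in> span L" unfolding u_def using w(1) by (rule span_scale)
    show "\<forall>x\<in>L. x \<bullet> u \<in> \<int>"
    proof
      fix x assume "x \<in> L"
      then obtain z :: int where "x \<bullet> w = of_int z * (w \<bullet> w)" using w(4) by blast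
      then show "x \<bullet> u \<in> \<int>" unfolding u_def using w0 by simp
    qed
  qed
  moreover have uu: "u \<bullet> u = 1 / (w \<bullet> w)" unfolding u_def using w0 by simp
  then have "u \<noteq> 0" using w0 by auto
  ultimately have "m \<le> 1 / (w \<bullet> w)" using b(3) uu unfolding m_def by metis
  then have "m * (w \<bullet> w) \<le> 1" using w0 by (simp add: field_simps)
  moreover have "m * (8/27 * m) \<le> m * (w \<bullet> w)" using wm m(1) by (intro mult_left_mono) auto
  ultimately have mm: "m * m \<le> 27/8" by simp
  have "m < 2"
  proof (rule ccontr)
    assume "\<not> m < 2"
    then have "2 * 2 \<le> m * m" by (intro mult_mono) auto
    then show False using mm by simp
  qed
  obtain z where z: "m = of_int z" using m(2) by (auto elim: Ints_cases)
  then have "z = 1" using m(1) \<open>m < 2\<close> by simp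
  then have "b \<bullet> b = 1" using z m_def by simp
  then show ?thesis using that b(1) by blast
qed

theorem self_dual_orthonormal_coordinates:
  fixes L :: "'a::euclidean_space set"
  assumes "self_dual L" "dim L = k" "k \<le> 7"
  shows "\<exists>e. (\<forall>i<k. e i \<in> L) \<and> (\<forall>x\<in>L. \<forall>y\<in>L. x \<bullet> y = (\<Sum>i<k. (x \<bullet> e i) * (y \<bullet> e i)))"
  using assms
proof (induction k arbitrary: L)
  case 0
  then have "L \<subseteq> {0}" by (simp add: dim_eq_0)
  then show ?case by auto
next
  case (Suc k)
  have sub: "additive_subgroup L" and int: "\<And>x y. x \<in> L \<Longrightarrow> y \<in> L \<Longrightarrow> x \<bullet> y \<in> \<int>"
    and dual: "\<And>y. y \<in> span L \<Longrightarrow> (\<forall>x\<in>L. x \<bullet> y \<in> \<int>) \<Longrightarrow> y \<in> L"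
    using Suc.prems(1) by (auto simp: self_dual_def)
  obtain u where u: "u \<in> L" "u \<bullet> u = 1" using self_dual_unit_vector Suc.prems by (metis zero_less_Suc)
  have u0: "u \<noteq> 0" using u(2) by auto
  define M where "M = {x \<in> L. x \<bullet> u = 0}"
  define \<pi> where "\<pi> x = x - (x \<bullet> u) *\<^sub>R u" for x
  have piM: "\<pi> x \<in> M" if x: "x \<in> L" for x
  proof -
    obtain z where z: "x \<bullet> u = of_int z" using int[OF x u(1)] by (auto elim: Ints_cases)
    have "\<pi> x \<in> L" unfolding \<pi>_def z
      using additive_subgroupD(2)[OF sub x additive_subgroup_scaleR[OF sub u(1)]] .
    moreover have "\<pi> x \<bullet> u = 0" using u(2) by (simp add: \<pi>_def inner_diff_left)
    ultimately show ?thesis by (simp add: M_def)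
  qed
  have MsubL: "M \<subseteq> L" by (auto simp: M_def)
  have orth: "y \<bullet> u = 0" if "y \<in> span M" for y
  proof -
    have "span M \<subseteq> {x. x \<bullet> u = 0}"
      by (rule span_minimal) (auto simp: M_def subspace_def inner_simps)
    then show ?thesis using that by blast
  qed
  have "self_dual M"
    unfolding self_dual_def
  proof (intro conjI ballI impI)
    show "additive_subgroup M" using sub by (auto simp: M_def additive_subgroup_def inner_diff_left)
    show "x \<bullet> y \<in> \<int>" if "x \<in> M" "y \<in> M" for x y using that int MsubL by blast
    fix y assume y: "y \<in> span M" "\<forall>x\<in>M. x \<bullet> y \<in> \<int>"
    have "y \<in> L"
    proof (rule dual)
      show "y \<in> span L" using y(1) span_mono[OF MsubL] by blast
      show "\<forall>x\<in>L. x \<bullet> y \<in> \<int>"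
      proof
        fix x assume "x \<in> L"
        then have "\<pi> x \<bullet> y \<in> \<int>" using y(2) piM by blast
        moreover have "\<pi> x \<bullet> y = x \<bullet> y" using orth[OF y(1)] by (simp add: \<pi>_def inner_diff_left inner_commute[of u y])
        ultimately show "x \<bullet> y \<in> \<int>" by simp
      qed
    qed
    then show "y \<in> M" using orth[OF y(1)] by (simp add: M_def)
  qed
  moreover have "dim L = dim M + 1"
  proof (rule dim_orthogonal_remove[OF u0])
    show "u \<in> span L" using u(1) by (rule span_base)
    show "M \<subseteq> span L" using MsubL span_superset by blast
    show "\<And>x. x \<in> M \<Longrightarrow> x \<bullet> u = 0" by (simp add: M_def)
    show "L \<subseteq> span (insert u M)"
    proof
      fix x assume "x \<in> L"
      then have "\<pi> x + (x \<bullet> u) *\<^sub>R u \<in> span (insert u M)"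
        using piM by (intro span_add span_scale span_base) auto
      then show "x \<in> span (insert u M)" by (simp add: \<pi>_def)
    qed
  qed
  ultimately obtain e where e: "\<And>i. i < k \<Longrightarrow> e i \<in> M"
    "\<And>x y. x \<in> M \<Longrightarrow> y \<in> M \<Longrightarrow> x \<bullet> y = (\<Sum>i<k. (x \<bullet> e i) * (y \<bullet> e i))"
    using Suc.IH[of M] Suc.prems by auto
  have "x \<bullet> y = (\<Sum>i<Suc k. (x \<bullet> (e(k := u)) i) * (y \<bullet> (e(k := u)) i))" if xy: "x \<in> L" "y \<in> L" for x y
  proof -
    have pe: "\<pi> z \<bullet> e i = z \<bullet> e i" if "i < k" for z i
      using e(1)[OF that] by (simp add: \<pi>_def M_def inner_diff_left inner_commute[of u "e i"])
    have "x \<bullet> y = \<pi> x \<bullet> \<pi> y + (x \<bullet> u) * (y \<bullet> u)"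
      using u(2) by (simp add: \<pi>_def inner_simps inner_commute)
    also have "\<pi> x \<bullet> \<pi> y = (\<Sum>i<k. (x \<bullet> e i) * (y \<bullet> e i))"
      using e(2)[OF piM[OF xy(1)] piM[OF xy(2)]] pe by simp
    finally show ?thesis by simp
  qed
  moreover have "\<forall>i<Suc k. (e(k := u)) i \<in> L" using e(1) MsubL u(1) by (auto simp: less_Suc_eq)
  ultimately show ?case by blast
qed

section \<open>Sums of eight squares of linear forms\<close>

text \<open>Elimination without fractions: \<open>b\<close> cross-multiplies with the pivot
  \<open>i0\<close> of row \<open>m\<close>, and \<open>x\<close> multiplies the remaining solution
  by that pivot.\<close>

lemma integer_kernel_nontrivial:
  fixes a :: "nat \<Rightarrow> 'i \<Rightarrow> int"
  assumes "finite I" "m < card I"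
  shows "\<exists>x. (\<exists>i\<in>I. x i \<noteq> 0) \<and> (\<forall>k<m. (\<Sum>i\<in>I. a k i * x i) = 0)"
  using assms
proof (induction m arbitrary: a I)
  case 0
  then have "I \<noteq> {}" by auto
  then show ?case by (intro exI[of _ "\<lambda>_. 1"]) auto
next
  case (Suc m)
  show ?case
  proof (cases "\<forall>i\<in>I. a m i = 0")
    case True
    obtain x where x: "\<exists>i\<in>I. x i \<noteq> 0" "\<forall>k<m. (\<Sum>i\<in>I. a k i * x i) = 0"
      using Suc.IH[of I a] Suc.prems by auto
    have "(\<Sum>i\<in>I. a m i * x i) = 0" using True by simp
    then show ?thesis using x by (auto simp: less_Suc_eq)
  next
    case False
    then obtain i0 where i0: "i0 \<in> I" "a m i0 \<noteq> 0" by blast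
    define J where "J = I - {i0}"
    have J: "finite J" "m < card J" using Suc.prems i0 by (auto simp: J_def)
    define b where "b k i = a m i0 * a k i - a k i0 * a m i" for k i
    obtain y where y: "\<exists>i\<in>J. y i \<noteq> 0" "\<forall>k<m. (\<Sum>i\<in>J. b k i * y i) = 0"
      using Suc.IH[OF J, of b] by blast
    define x where "x i = (if i = i0 then - (\<Sum>i\<in>J. a m i * y i) else a m i0 * y i)" for i
    have split: "(\<Sum>i\<in>I. a k i * x i) = - a k i0 * (\<Sum>i\<in>J. a m i * y i) + (\<Sum>i\<in>J. a k i * (a m i0 * y i))" for k
    proof -
      have "(\<Sum>i\<in>I. a k i * x i) = a k i0 * x i0 + (\<Sum>i\<in>J. a k i * x i)"
        unfolding J_def using Suc.prems(1) i0(1) by (rule sum.remove)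
      moreover have "(\<Sum>i\<in>J. a k i * x i) = (\<Sum>i\<in>J. a k i * (a m i0 * y i))"
        by (rule sum.cong) (auto simp: x_def J_def)
      ultimately show ?thesis by (simp add: x_def)
    qed
    have "(\<Sum>i\<in>I. a k i * x i) = 0" if "k < Suc m" for k
    proof (cases "k = m")
      case True
      then show ?thesis unfolding split by (simp add: sum_distrib_left sum_negf mult_ac)
    next
      case False
      then have "(\<Sum>i\<in>J. b k i * y i) = 0" using that y(2) by simp
      moreover have "(\<Sum>i\<in>I. a k i * x i) = (\<Sum>i\<in>J. b k i * y i)"
        unfolding split b_def sum_distrib_left sum.distrib[symmetric]
        by (intro sum.cong refl) (simp add: algebra_simps)
      ultimately show ?thesis by simp
    qed
    moreover obtain i where "i \<in> J" "y i \<noteq> 0" using y(1) by blast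
    then have "i \<in> I" "x i \<noteq> 0" using i0(2) by (auto simp: x_def J_def)
    ultimately show ?thesis by blast
  qed
qed

lemma orthogonal_integer_vectors:
  fixes c :: "nat \<Rightarrow> 8 \<Rightarrow> int"
  assumes "n \<le> 4"
  shows "\<exists>t :: nat \<Rightarrow> 8 \<Rightarrow> int. (\<forall>i<n. (\<exists>s. t i s \<noteq> 0) \<and> (\<forall>j<4. (\<Sum>s\<in>UNIV. c j s * t i s) = 0))
    \<and> (\<forall>i<n. \<forall>j<i. (\<Sum>s\<in>UNIV. t j s * t i s) = 0)"
  using assms
proof (induction n)
  case (Suc n)
  then obtain t :: "nat \<Rightarrow> 8 \<Rightarrow> int" where
    t: "\<forall>i<n. (\<exists>s. t i s \<noteq> 0) \<and> (\<forall>j<4. (\<Sum>s\<in>UNIV. c j s * t i s) = 0)"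
      "\<forall>i<n. \<forall>j<i. (\<Sum>s\<in>UNIV. t j s * t i s) = 0" by auto
  define a where "a k = (if k < 4 then c k else t (k - 4))" for k
  \<comment> \<open>The last vector has to satisfy 4 + 3 = 7 homogeneous conditions in 8
    unknowns.\<close>
  have "4 + n < card (UNIV :: 8 set)" using Suc.prems by simp
  then obtain x where x: "\<exists>s. x s \<noteq> 0" "\<And>k. k < 4 + n \<Longrightarrow> (\<Sum>s\<in>UNIV. a k s * x s) = 0"
    using integer_kernel_nontrivial[of UNIV "4 + n" a] by auto
  have "(\<Sum>s\<in>UNIV. c j s * x s) = 0" if "j < 4" for j using x(2)[of j] that by (simp add: a_def)
  moreover have "(\<Sum>s\<in>UNIV. t j s * x s) = 0" if "j < n" for j using x(2)[of "4 + j"] that by (simp add: a_def)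
  ultimately show ?case using t x(1)
    by (intro exI[of _ "t(n := x)"]) (auto simp: less_Suc_eq)
qed simp

text \<open>A combination of four orthogonal vectors has norm k^2 exactly when the quinary form with
  their norms and -1 vanishes. The norms are positive, so the form is indefinite, and the last
  coordinate of a zero cannot be 0.\<close>

lemma orthogonal_vector_of_square_norm:
  fixes c :: "nat \<Rightarrow> 8 \<Rightarrow> int"
  obtains t :: "8 \<Rightarrow> int" and k :: int where "k \<noteq> 0" "(\<Sum>s\<in>UNIV. t s * t s) = k * k"
    "\<forall>j<4. (\<Sum>s\<in>UNIV. c j s * t s) = 0"
proof -
  obtain t :: "nat \<Rightarrow> 8 \<Rightarrow> int" where
    raw: "\<forall>i<4. (\<exists>s. t i s \<noteq> 0) \<and> (\<forall>j<4. (\<Sum>s\<in>UNIV. c j s * t i s) = 0)"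
      "\<forall>i<4. \<forall>j<i. (\<Sum>s\<in>UNIV. t j s * t i s) = 0"
    using orthogonal_integer_vectors[OF order_refl, of c] by blast
  have t: "\<And>i. i < 4 \<Longrightarrow> \<exists>s. t i s \<noteq> 0" "\<And>i j. i < 4 \<Longrightarrow> j < 4 \<Longrightarrow> (\<Sum>s\<in>UNIV. c j s * t i s) = 0"
      "\<And>i j. i < 4 \<Longrightarrow> j < i \<Longrightarrow> (\<Sum>s\<in>UNIV. t j s * t i s) = 0"
    using raw by blast+
  define q where "q i = (\<Sum>s\<in>UNIV. t i s * t i s)" for i
  have orth: "(\<Sum>s\<in>UNIV. t i s * t j s) = (if i = j then q i else 0)" if "i < 4" "j < 4" for i j
  proof (cases i j rule: linorder_cases)
    case less
    then show ?thesis using t(3)[of j i] that by simp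
  next
    case equal
    then show ?thesis by (simp add: q_def)
  next
    case greater
    then show ?thesis using t(3)[of i j] that by (simp add: mult.commute)
  qed
  have qpos: "q i > 0" if i: "i < 4" for i
  proof -
    obtain s where "t i s \<noteq> 0" using t(1)[OF i] by blast
    then show ?thesis unfolding q_def by (intro sum_pos2[of _ s]) (auto simp: zero_less_mult_iff neq_iff)
  qed
  define f where "f i = (if i < 4 then q i else - 1)" for i :: nat
  have "isotropic f"
  proof (rule meyer)
    show "f i \<noteq> 0" for i using qpos[of i] by (auto simp: f_def)
    show "\<exists>i<5. f i > 0" using qpos[of 0] by (intro exI[of _ 0]) (simp add: f_def)
    show "\<exists>i<5. f i < 0" by (intro exI[of _ 4]) (simp add: f_def)
  qed
  then obtain x where x: "\<exists>i<5. x i \<noteq> 0" "(\<Sum>i<5. f i * (x i)\<^sup>2) = 0" unfolding isotropic_def by blast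
  have "(\<Sum>i<5. f i * (x i)\<^sup>2) = (\<Sum>i<4. f i * (x i)\<^sup>2) + f 4 * (x 4)\<^sup>2"
    by (simp add: eval_nat_numeral)
  also have "(\<Sum>i<4. f i * (x i)\<^sup>2) = (\<Sum>i<4. q i * (x i)\<^sup>2)" by (rule sum.cong) (auto simp: f_def)
  finally have sq: "(\<Sum>i<4. q i * (x i)\<^sup>2) = (x 4)\<^sup>2" using x(2) by (simp add: f_def)
  have x4: "x 4 \<noteq> 0"
  proof
    assume "x 4 = 0"
    then have "(\<Sum>i<4. q i * (x i)\<^sup>2) = 0" using sq by simp
    moreover have "0 \<le> q i * (x i)\<^sup>2" if "i \<in> {..<4}" for i using qpos[of i] that by simp
    ultimately have "\<forall>i\<in>{..<4}. q i * (x i)\<^sup>2 = 0"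
      using sum_nonneg_eq_0_iff[of "{..<4}" "\<lambda>i. q i * (x i)\<^sup>2"] by simp
    then have "x i = 0" if "i < 4" for i using qpos[OF that] that by force
    moreover have "i < 4 \<or> i = 4" if "i < 5" for i :: nat using that by linarith
    ultimately have "\<forall>i<5. x i = 0" using \<open>x 4 = 0\<close> by blast
    then show False using x(1) by blast
  qed
  define T where "T s = (\<Sum>i<4. x i * t i s)" for s
  have "(\<Sum>s\<in>UNIV. T s * T s) = (\<Sum>s\<in>UNIV. \<Sum>i<4. \<Sum>j<4. x i * x j * (t i s * t j s))"
    unfolding T_def sum_product by (intro sum.cong refl) (simp add: mult_ac)
  also have "\<dots> = (\<Sum>i<4. \<Sum>j<4. \<Sum>s\<in>UNIV. x i * x j * (t i s * t j s))"
    unfolding sum.swap[of _ _ UNIV] ..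
  also have "\<dots> = (\<Sum>i<4. \<Sum>j<4. if i = j then q i * (x i)\<^sup>2 else 0)"
    unfolding sum_distrib_left[symmetric]
    by (intro sum.cong refl) (auto simp: orth power2_eq_square)
  also have "\<dots> = (\<Sum>i<4. q i * (x i)\<^sup>2)" by (simp add: sum.delta')
  finally have "(\<Sum>s\<in>UNIV. T s * T s) = x 4 * x 4" using sq by (simp add: power2_eq_square)
  moreover have "(\<Sum>s\<in>UNIV. c j s * T s) = 0" if "j < 4" for j
  proof -
    have "(\<Sum>s\<in>UNIV. c j s * T s) = (\<Sum>i<4. \<Sum>s\<in>UNIV. x i * (c j s * t i s))"
      unfolding T_def sum_distrib_left by (subst sum.swap) (simp add: mult_ac)
    also have "\<dots> = 0" unfolding sum_distrib_left[symmetric] using t(2) that by simp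
    finally show ?thesis .
  qed
  ultimately show ?thesis using that x4 by blast
qed

text \<open>The least positive integral combination of the entries is their common divisor. The
  Bezout relation for the primitive vector \<open>t'\<close> is what identifies the dual in the
  neighbour construction.\<close>

lemma bezout_vector:
  fixes t :: "'i::finite \<Rightarrow> int"
  assumes "\<exists>s. t s \<noteq> 0"
  obtains u d t' where "d > 0" "\<forall>s. t s = d * t' s" "(\<Sum>s\<in>UNIV. u s * t' s) = 1"
proof -
  define P where "P d \<longleftrightarrow> d > 0 \<and> (\<exists>u. (\<Sum>s\<in>UNIV. u s * t s) = int d)" for d
  obtain s0 where s0: "t s0 \<noteq> 0" using assms by blast
  have "(\<Sum>s\<in>UNIV. (if s = s0 then sgn (t s0) else 0) * t s) = sgn (t s0) * t s0"
    by (simp add: if_distrib[of "\<lambda>x. x * _"] cong: if_cong)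
  also have "\<dots> = int (nat \<bar>t s0\<bar>)" by (simp add: mult.commute abs_sgn[symmetric])
  finally have "P (nat \<bar>t s0\<bar>)" unfolding P_def using s0 by (intro conjI exI) auto
  then have PL: "P (LEAST d. P d)" by (rule LeastI)
  define d where "d = (LEAST d. P d)"
  obtain u where u: "d > 0" "(\<Sum>s\<in>UNIV. u s * t s) = int d" using PL unfolding d_def P_def by blast
  have dvd: "int d dvd t s" for s
  proof (rule ccontr)
    assume n: "\<not> int d dvd t s"
    define r where "r = t s mod int d"
    have "r \<noteq> 0" unfolding r_def using n by (simp only: dvd_eq_mod_eq_0 not_False_eq_True)
    moreover have "0 \<le> r" "r < int d" unfolding r_def using u(1) by simp_all
    ultimately have r: "0 < r" "r < int d" by linarith+
    have "(\<Sum>s'\<in>UNIV. ((if s' = s then 1 else 0) - (t s div int d) * u s') * t s')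
        = (\<Sum>s'\<in>UNIV. (if s' = s then t s' else 0)) - (t s div int d) * (\<Sum>s'\<in>UNIV. u s' * t s')"
      unfolding sum_distrib_left sum_subtractf[symmetric] by (intro sum.cong refl) (auto simp: algebra_simps)
    also have "\<dots> = int (nat r)" using u(2) r(1) by (simp add: r_def minus_div_mult_eq_mod)
    finally have "P (nat r)" unfolding P_def using r(1) by (intro conjI exI) auto
    then have "d \<le> nat r" unfolding d_def by (rule Least_le)
    then show False using r by linarith
  qed
  define t' where "t' s = t s div int d" for s
  have t': "t s = int d * t' s" for s using dvd[of s] by (simp add: t'_def)
  have "(\<Sum>s\<in>UNIV. u s * t s) = int d * (\<Sum>s\<in>UNIV. u s * t' s)"
    unfolding t' sum_distrib_left by (intro sum.cong refl) (simp add: mult_ac)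
  then have "(\<Sum>s\<in>UNIV. u s * t' s) = 1" using u by simp
  then show ?thesis using that[of "int d" t' u] u(1) t' by simp
qed

section \<open>The neighbour lattice\<close>

definition int_vec :: "(8 \<Rightarrow> int) \<Rightarrow> real ^ 8" where
  "int_vec x = (\<chi> s. of_int (x s))"

lemma int_vec_inner: "int_vec x \<bullet> int_vec y = of_int (\<Sum>s\<in>UNIV. x s * y s)"
  by (simp add: int_vec_def inner_vec_def)

lemma int_vec_linear:
  "int_vec (\<lambda>s. x s + y s) = int_vec x + int_vec y" "int_vec (\<lambda>s. x s - y s) = int_vec x - int_vec y"
  "int_vec (\<lambda>s. k * x s) = of_int k *\<^sub>R int_vec x"
  by (simp_all add: int_vec_def vec_eq_iff)

text \<open>The neighbour of \<open>\<int>\<^sup>8\<close> at the rational unit vector \<open>v = t / k\<close>, intersected with the orthogonal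
  complement of \<open>v\<close>.\<close>

lemma neighbour_self_dual:
  fixes t u :: "8 \<Rightarrow> int"
  assumes k: "k \<noteq> 0" and tt: "(\<Sum>s\<in>UNIV. t s * t s) = k * k" and ut: "(\<Sum>s\<in>UNIV. u s * t s) = 1"
  defines "v \<equiv> (1 / of_int k) *\<^sub>R int_vec t"
  defines "N \<equiv> {y. y \<bullet> v = 0 \<and> (\<exists>m a. y = int_vec m + of_int a *\<^sub>R v \<and> int_vec m \<bullet> v \<in> \<int>)}"
  shows "self_dual N"
proof -
  have vv: "v \<bullet> v = 1"
    using k tt unfolding v_def by (simp add: int_vec_inner)
  have kv: "of_int k *\<^sub>R v = int_vec t" using k by (simp add: v_def)
  have mv: "int_vec m \<bullet> v = of_int (\<Sum>s\<in>UNIV. m s * t s) / of_int k" for m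
    unfolding v_def by (simp add: int_vec_inner)
  have NI: "int_vec m + of_int a *\<^sub>R v \<in> N" if "int_vec m \<bullet> v = - of_int a" for m a
    unfolding N_def using that vv by (auto simp: inner_add_left)
  have NE: "\<exists>m a. y = int_vec m + of_int a *\<^sub>R v \<and> int_vec m \<bullet> v = - of_int a" if "y \<in> N" for y
  proof -
    obtain m a where y: "y = int_vec m + of_int a *\<^sub>R v" "y \<bullet> v = 0" using \<open>y \<in> N\<close> unfolding N_def by blast
    then have "int_vec m \<bullet> v = - of_int a" using vv by (simp add: inner_add_left)
    then show ?thesis using y(1) by blast
  qed
  show ?thesis
    unfolding self_dual_def
  proof (intro conjI ballI impI)
    show "additive_subgroup N"
      unfolding additive_subgroup_def
    proof (intro conjI ballI)
      have "int_vec (\<lambda>_. 0) = 0" by (simp add: int_vec_def vec_eq_iff)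
      then show "0 \<in> N" using NI[of "\<lambda>_. 0" 0] by simp
      fix x y assume "x \<in> N" "y \<in> N"
      then obtain m a m' a' where
        x: "x = int_vec m + of_int a *\<^sub>R v" "int_vec m \<bullet> v = - of_int a" and
        y: "y = int_vec m' + of_int a' *\<^sub>R v" "int_vec m' \<bullet> v = - of_int a'" using NE by meson
      have "x - y = int_vec (\<lambda>s. m s - m' s) + of_int (a - a') *\<^sub>R v"
        unfolding x(1) y(1) int_vec_linear by (simp add: algebra_simps)
      moreover have "int_vec (\<lambda>s. m s - m' s) \<bullet> v = - of_int (a - a')"
        unfolding int_vec_linear inner_diff_left x(2) y(2) by simp
      ultimately show "x - y \<in> N" using NI by metis
    qed
  next
    fix x y assume "x \<in> N" "y \<in> N"
    then obtain m a m' a' where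
      x: "x = int_vec m + of_int a *\<^sub>R v" "int_vec m \<bullet> v = - of_int a" and
      y: "y = int_vec m' + of_int a' *\<^sub>R v" "int_vec m' \<bullet> v = - of_int a'" using NE by meson
    have "x \<bullet> y = of_int ((\<Sum>s\<in>UNIV. m s * m' s) - a * a')"
    proof -
      have "v \<bullet> int_vec m' = - of_int a'" using y(2) by (simp only: inner_commute)
      then show ?thesis unfolding x(1) y(1) by (simp add: inner_add_left inner_add_right x(2) vv int_vec_inner)
    qed
    then show "x \<bullet> y \<in> \<int>" by (metis Ints_of_int)
  next
    fix y assume y: "y \<in> span N" "\<forall>x\<in>N. x \<bullet> y \<in> \<int>"
    have "span N \<subseteq> {y. y \<bullet> v = 0}"
      by (rule span_minimal) (auto simp: N_def subspace_def inner_add_left)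
    then have yv: "y \<bullet> v = 0" using y(1) by blast
    \<comment> \<open>If \<open>m\<close> has integral product \<open>a\<close> with
      \<open>v\<close>, then m - a v lies in \<open>N\<close>; as \<open>y\<close> is orthogonal to
      \<open>v\<close>, it pairs integrally with \<open>m\<close> itself.\<close>
    have test: "int_vec m \<bullet> y \<in> \<int>" if "int_vec m \<bullet> v = of_int a" for m a
    proof -
      have "(int_vec m + of_int (- a) *\<^sub>R v) \<bullet> y \<in> \<int>" using y(2) NI[of m "- a"] that by simp
      then show ?thesis using yv by (simp add: inner_diff_left inner_commute[of v y])
    qed
    \<comment> \<open>\<open>k\<close> times \<open>u\<close> has product 1 with \<open>v\<close>,
      so the product of \<open>u\<close> and \<open>y\<close> has a denominator dividing
      \<open>k\<close>.\<close>
    have "int_vec (\<lambda>s. k * u s) \<bullet> v = of_int 1" unfolding mv using k ut by (simp add: mult.assoc sum_distrib_left[symmetric])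
    then have "int_vec (\<lambda>s. k * u s) \<bullet> y \<in> \<int>" by (rule test)
    then obtain c where c: "of_int k * (int_vec u \<bullet> y) = of_int c"
      unfolding int_vec_linear by (auto elim: Ints_cases)
    have comp: "\<exists>z. y $ s = of_int z + of_int (t s) * (int_vec u \<bullet> y)" for s
    proof -
      \<comment> \<open>The unit vector of index \<open>s\<close>; a multiple of \<open>u\<close>
        makes it orthogonal to \<open>t\<close>, so it can be tested against \<open>y\<close> and
        yields that coordinate up to a multiple of \<open>t s\<close>.\<close>
      define e where "e = (\<lambda>r. if r = s then 1 else (0::int))"
      have et: "(\<Sum>r\<in>UNIV. (e r - t s * u r) * t r) = 0"
      proof -
        have "(\<Sum>r\<in>UNIV. (e r - t s * u r) * t r) = (\<Sum>r\<in>UNIV. if r = s then t r else 0) - t s * (\<Sum>r\<in>UNIV. u r * t r)"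
          unfolding sum_distrib_left sum_subtractf[symmetric] by (intro sum.cong refl) (auto simp: e_def algebra_simps)
        then show ?thesis using ut by simp
      qed
      have "int_vec (\<lambda>r. e r - t s * u r) \<bullet> v = of_int 0" unfolding mv et by simp
      then have "int_vec (\<lambda>r. e r - t s * u r) \<bullet> y \<in> \<int>" by (rule test)
      moreover have "int_vec e \<bullet> y = y $ s"
      proof -
        have "int_vec e \<bullet> y = (\<Sum>r\<in>UNIV. if r = s then y $ r else 0)"
          unfolding inner_vec_def int_vec_def e_def by (intro sum.cong refl) auto
        then show ?thesis by simp
      qed
      ultimately have "y $ s - of_int (t s) * (int_vec u \<bullet> y) \<in> \<int>"
        by (simp add: int_vec_linear inner_diff_left)
      then obtain z where "y $ s - of_int (t s) * (int_vec u \<bullet> y) = of_int z" by (auto elim: Ints_cases)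
      then have "y $ s = of_int z + of_int (t s) * (int_vec u \<bullet> y)" by simp
      then show ?thesis by blast
    qed
    then obtain z where z: "\<And>s. y $ s = of_int (z s) + of_int (t s) * (int_vec u \<bullet> y)" by metis
    have "int_vec u \<bullet> y = of_int c / of_int k" using c k by (simp add: field_simps)
    then have yz: "y = int_vec z + of_int c *\<^sub>R v"
      using z unfolding vec_eq_iff v_def int_vec_def by simp
    then have "int_vec z \<bullet> v = - of_int c" using yv vv by (simp add: inner_add_left)
    then show "y \<in> N" unfolding yz by (rule NI)
  qed
qed

theorem gram_of_seven:
  fixes c :: "nat \<Rightarrow> 8 \<Rightarrow> int"
  obtains k and d :: "nat \<Rightarrow> nat \<Rightarrow> int" where "k \<le> 7"
    "\<forall>i<4. \<forall>j<4. (\<Sum>s\<in>UNIV. c i s * c j s) = (\<Sum>r<k. d i r * d j r)"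
proof -
  obtain t0 :: "8 \<Rightarrow> int" and k0 where t0: "k0 \<noteq> 0" "(\<Sum>s\<in>UNIV. t0 s * t0 s) = k0 * k0"
    "\<forall>j<4. (\<Sum>s\<in>UNIV. c j s * t0 s) = 0" by (rule orthogonal_vector_of_square_norm[of c])
  have "\<exists>s. t0 s \<noteq> 0"
  proof (rule ccontr)
    assume "\<nexists>s. t0 s \<noteq> 0"
    then show False using t0(1,2) by simp
  qed
  then obtain u g t where g0: "g > 0" "\<forall>s. t0 s = g * t s" "(\<Sum>s\<in>UNIV. u s * t s) = 1"
    by (rule bezout_vector)
  then have g: "g > 0" "\<And>s. t0 s = g * t s" "(\<Sum>s\<in>UNIV. u s * t s) = 1" by auto
  have gg: "g\<^sup>2 * (\<Sum>s\<in>UNIV. t s * t s) = k0\<^sup>2"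
    using t0(2) unfolding g(2) sum_distrib_left by (simp add: power2_eq_square mult_ac)
  then have "g\<^sup>2 dvd k0\<^sup>2" by (metis dvd_triv_left)
  then have "g dvd k0" by simp
  then obtain k where k: "k0 = g * k" by blast
  have tt: "(\<Sum>s\<in>UNIV. t s * t s) = k * k"
    using gg g(1) unfolding k by (simp add: power2_eq_square mult_ac)
  have k0: "k \<noteq> 0" using t0(1) k by auto
  have ct: "(\<Sum>s\<in>UNIV. c j s * t s) = 0" if "j < 4" for j
  proof -
    have "(\<Sum>s\<in>UNIV. c j s * t0 s) = g * (\<Sum>s\<in>UNIV. c j s * t s)"
      unfolding g(2) sum_distrib_left by (intro sum.cong refl) (simp add: mult_ac)
    then show ?thesis using t0(3) that g(1) by simp
  qed
  define v where "v = (1 / of_int k) *\<^sub>R int_vec t"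
  define N where "N = {y. y \<bullet> v = 0 \<and> (\<exists>m a. y = int_vec m + of_int a *\<^sub>R v \<and> int_vec m \<bullet> v \<in> \<int>)}"
  have sd: "self_dual N" unfolding N_def v_def by (rule neighbour_self_dual[OF k0 tt g(3)])
  have "v \<bullet> v = 1" using k0 tt unfolding v_def by (simp add: int_vec_inner)
  then have v0: "v \<noteq> 0" by auto
  have "dim N \<le> dim {y. v \<bullet> y = 0}" by (rule dim_subset) (auto simp: N_def inner_commute)
  also have "\<dots> = 7" using dim_hyperplane[OF v0] by simp
  finally have dim: "dim N \<le> 7" .
  have cN: "int_vec (c j) \<in> N" if "j < 4" for j
  proof -
    have "int_vec (c j) \<bullet> v = 0" unfolding v_def using ct[OF that] by (simp add: int_vec_inner)
    then show ?thesis unfolding N_def by (auto intro!: exI[of _ "c j"] exI[of _ 0])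
  qed
  obtain e where e: "\<forall>i<dim N. e i \<in> N"
    "\<forall>x\<in>N. \<forall>y\<in>N. x \<bullet> y = (\<Sum>i<dim N. (x \<bullet> e i) * (y \<bullet> e i))"
    using self_dual_orthonormal_coordinates[OF sd refl dim] by blast
  define d where "d j r = \<lfloor>int_vec (c j) \<bullet> e r\<rfloor>" for j r
  have d: "int_vec (c j) \<bullet> e r = of_int (d j r)" if "j < 4" "r < dim N" for j r
  proof -
    have "int_vec (c j) \<bullet> e r \<in> \<int>" using sd cN[OF that(1)] e(1) that(2) unfolding self_dual_def by blast
    then show ?thesis by (simp add: d_def)
  qed
  have "(\<Sum>s\<in>UNIV. c i s * c j s) = (\<Sum>r<dim N. d i r * d j r)" if "i < 4" "j < 4" for i j
  proof -
    have "real_of_int (\<Sum>s\<in>UNIV. c i s * c j s) = int_vec (c i) \<bullet> int_vec (c j)" by (rule int_vec_inner[symmetric])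
    also have "\<dots> = (\<Sum>r<dim N. (int_vec (c i) \<bullet> e r) * (int_vec (c j) \<bullet> e r))" using e(2) cN that by blast
    also have "\<dots> = of_int (\<Sum>r<dim N. d i r * d j r)" using d that by simp
    finally show ?thesis by (simp only: of_int_eq_iff)
  qed
  then show ?thesis using that[OF dim] by blast
qed

section \<open>The ring of integers\<close>

lemma rat_adjoin_induct:
  fixes x :: "'a::field_char_0"
  assumes "x \<in> rat_adjoin S" "\<And>x. x \<in> \<rat> \<Longrightarrow> Pr x" "\<And>x. x \<in> S \<Longrightarrow> Pr x" "\<And>x. Pr x \<Longrightarrow> Pr (- x)"
    "\<And>x. Pr x \<Longrightarrow> x \<noteq> 0 \<Longrightarrow> Pr (inverse x)" "\<And>x y. Pr x \<Longrightarrow> Pr y \<Longrightarrow> Pr (x + y)"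
    "\<And>x y. Pr x \<Longrightarrow> Pr y \<Longrightarrow> Pr (x * y)"
  shows "Pr x"
proof -
  let ?R = "ring_of_type_algebra :: 'a ring"
  interpret R: field ?R by (rule field_from_type_algebra)
  have ops: "carrier ?R = UNIV" "\<one>\<^bsub>?R\<^esub> = 1" "\<zero>\<^bsub>?R\<^esub> = 0" "a \<oplus>\<^bsub>?R\<^esub> b = a + b" "a \<otimes>\<^bsub>?R\<^esub> b = a * b" for a b
    by (simp_all add: ring_of_type_algebra_def)
  have neg: "\<ominus>\<^bsub>?R\<^esub> a = - a" for a
    by (rule R.minus_equality) (simp_all add: ops)
  have inv: "inv\<^bsub>?R\<^esub> a = inverse a" if "a \<noteq> 0" for a
    by (rule R.comm_inv_char) (use that in \<open>simp_all add: ops\<close>)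
  have "x \<in> generate_field ?R (\<rat> \<union> S)" using assms(1) by (simp add: rat_adjoin_def)
  then show ?thesis
  proof (induction rule: generate_field.induct)
    case one
    then show ?case using assms(2)[of 1] by (simp add: ops)
  next
    case (incl h)
    then show ?case using assms(2,3) by blast
  next
    case (a_inv h)
    then show ?case using assms(4) by (simp add: neg)
  next
    case (m_inv h)
    then show ?case using assms(5) by (simp add: inv ops)
  next
    case (eng_add h1 h2)
    then show ?case using assms(6) by (simp add: ops)
  next
    case (eng_mult h1 h2)
    then show ?case using assms(7) by (simp add: ops)
  qed
qed

lemma rat_adjoin_intros:
  fixes x y :: "'a::field_char_0"
  shows "x \<in> \<rat> \<Longrightarrow> x \<in> rat_adjoin S" "x \<in> S \<Longrightarrow> x \<in> rat_adjoin S"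
    "x \<in> rat_adjoin S \<Longrightarrow> y \<in> rat_adjoin S \<Longrightarrow> x + y \<in> rat_adjoin S"
    "x \<in> rat_adjoin S \<Longrightarrow> y \<in> rat_adjoin S \<Longrightarrow> x * y \<in> rat_adjoin S"
proof -
  let ?R = "ring_of_type_algebra :: 'a ring"
  have ops: "a \<oplus>\<^bsub>?R\<^esub> b = a + b" "a \<otimes>\<^bsub>?R\<^esub> b = a * b" for a b
    by (simp_all add: ring_of_type_algebra_def)
  show "x \<in> \<rat> \<Longrightarrow> x \<in> rat_adjoin S" "x \<in> S \<Longrightarrow> x \<in> rat_adjoin S"
    unfolding rat_adjoin_def by (auto intro: generate_field.incl)
  show "x \<in> rat_adjoin S \<Longrightarrow> y \<in> rat_adjoin S \<Longrightarrow> x + y \<in> rat_adjoin S"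
    unfolding rat_adjoin_def using generate_field.eng_add[of x ?R _ y] by (simp add: ops)
  show "x \<in> rat_adjoin S \<Longrightarrow> y \<in> rat_adjoin S \<Longrightarrow> x * y \<in> rat_adjoin S"
    unfolding rat_adjoin_def using generate_field.eng_mult[of x ?R _ y] by (simp add: ops)
qed

lemma rat_square_squarefree_imp_int:
  fixes f :: real
  assumes f: "f \<in> \<rat>" and m: "squarefree (m::int)" and fm: "f\<^sup>2 * of_int m \<in> \<int>"
  shows "f \<in> \<int>"
proof -
  obtain u v :: int where uv: "v > 0" "coprime u v" "f = of_int u / of_int v"
    using f by (metis Rats_cases')
  obtain z where z: "f\<^sup>2 * of_int m = of_int z" using fm by (auto elim: Ints_cases)
  have "real_of_int (u\<^sup>2 * m) = of_int (z * v\<^sup>2)"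
    using z uv(1) unfolding uv(3) by (simp add: power_divide field_simps)
  then have "u\<^sup>2 * m = z * v\<^sup>2" by (simp only: of_int_eq_iff)
  then have "v\<^sup>2 dvd u\<^sup>2 * m" by simp
  moreover have "coprime (v\<^sup>2) (u\<^sup>2)" using uv(2) by (simp add: coprime_commute)
  ultimately have "v\<^sup>2 dvd m" by (simp add: coprime_dvd_mult_right_iff)
  then have "is_unit v" using m by (simp add: squarefree_def)
  then show ?thesis using uv(1,3) by auto
qed

lemma squarefree_irrational:
  fixes x y :: real
  assumes xy: "x \<in> \<rat>" "y \<in> \<rat>" and m: "squarefree (m::int)" "m > 1" and eq: "x\<^sup>2 = y\<^sup>2 * of_int m"
  shows "x = 0" "y = 0"
proof -
  show y: "y = 0"
  proof (rule ccontr)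
    assume y: "y \<noteq> 0"
    define z where "z = x / y"
    have zm: "z\<^sup>2 = of_int m" using eq y by (simp add: z_def power_divide)
    have "z \<in> \<int>"
      by (rule rat_square_squarefree_imp_int[of _ 1]) (use xy zm in \<open>auto simp: z_def\<close>)
    then obtain k where "z = of_int k" by (auto elim: Ints_cases)
    then have "real_of_int (k\<^sup>2) = of_int m" using zm by simp
    then have "m = k\<^sup>2" by (simp only: of_int_eq_iff)
    then show False using squarefree_square_eq_1[OF m(1), of k] m(2) by simp
  qed
  then show "x = 0" using eq by simp
qed

text \<open>A denominator v > 1 in lowest terms would make every power of v divide
  \<open>N\<close>.\<close>

lemma rat_powers_bounded_denominator:
  fixes y :: real and N :: int
  assumes y: "y \<in> \<rat>" and N: "N > 0" "\<And>k. of_int N * y ^ k \<in> \<int>"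
  shows "y \<in> \<int>"
proof -
  obtain u v :: int where uv: "v > 0" "coprime u v" "y = of_int u / of_int v"
    using y by (metis Rats_cases')
  have dvd: "v ^ k dvd N" for k
  proof -
    obtain z where z: "of_int N * y ^ k = of_int z" using N(2)[of k] by (auto elim: Ints_cases)
    have "real_of_int (N * u ^ k) = of_int (z * v ^ k)"
      using z uv(1) unfolding uv(3) by (simp add: power_divide field_simps)
    then have "N * u ^ k = z * v ^ k" by (simp only: of_int_eq_iff)
    then have "v ^ k dvd N * u ^ k" by simp
    moreover have "coprime (v ^ k) (u ^ k)" using uv(2) by (simp add: coprime_commute)
    ultimately show ?thesis by (simp add: coprime_dvd_mult_left_iff)
  qed
  have "v = 1"
  proof (rule ccontr)
    assume "v \<noteq> 1"
    then have "v \<ge> 2" using uv(1) by simp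
    then have "(2::int) ^ nat N \<le> v ^ nat N" by (intro power_mono) auto
    also have "\<dots> \<le> N" using dvd[of "nat N"] N(1) by (rule zdvd_imp_le)
    finally have "(2::int) ^ nat N \<le> int (nat N)" using N(1) by simp
    moreover have "nat N < 2 ^ nat N" by (rule less_exp)
    then have "int (nat N) < 2 ^ nat N" by (metis of_nat_less_iff of_nat_numeral of_nat_power)
    ultimately show False by simp
  qed
  then show ?thesis using uv(3) by simp
qed

section \<open>Coordinates in the biquadratic field\<close>

locale biquadratic =
  fixes n p q r :: int
  assumes n6: "n \<ge> 6"
    and p_eq: "p = (2 * n - 1) * (2 * n + 1)"
    and q_eq: "q = (2 * n - 1) * (2 * n + 3)"
    and r_eq: "r = (2 * n + 1) * (2 * n + 3)"
    and sqf: "squarefree p" "squarefree q" "squarefree r"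
begin

definition sp :: real where "sp = sqrt (of_int p)"
definition sq :: real where "sq = sqrt (of_int q)"
definition sr :: real where "sr = sqrt (of_int r)"

lemma gt_1: "p > 1" "q > 1" "r > 1"
proof -
  have "1 < x * y" if "1 < x" "1 < y" for x y :: int using mult_strict_mono[OF that] that by simp
  then show "p > 1" "q > 1" "r > 1" unfolding p_eq q_eq r_eq using n6 by simp_all
qed

lemma sqrt_squares: "sp * sp = of_int p" "sq * sq = of_int q" "sr * sr = of_int r"
  using gt_1 by (simp_all add: sp_def sq_def sr_def)

lemma sqrt_products:
  "sp * sq = of_int (2 * n - 1) * sr" "sp * sr = of_int (2 * n + 1) * sq" "sq * sr = of_int (2 * n + 3) * sp"
proof -
  have s: "sqrt (of_int (k\<^sup>2 * m)) = of_int k * sqrt (of_int m)" if "k \<ge> 0" for k m :: int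
    using that by (simp add: real_sqrt_mult)
  have "p * q = (2 * n - 1)\<^sup>2 * r" "p * r = (2 * n + 1)\<^sup>2 * q" "q * r = (2 * n + 3)\<^sup>2 * p"
    unfolding p_eq q_eq r_eq by (simp_all add: power2_eq_square)
  then show "sp * sq = of_int (2 * n - 1) * sr" "sp * sr = of_int (2 * n + 1) * sq" "sq * sr = of_int (2 * n + 3) * sp"
    unfolding sp_def sq_def sr_def real_sqrt_mult[symmetric] of_int_mult[symmetric]
    using s[of "2 * n - 1" r] s[of "2 * n + 1" q] s[of "2 * n + 3" p] n6 by simp_all
qed

text \<open>The signs \<open>s, t\<close> describe the four embeddings.\<close>

definition conj_val :: "real \<Rightarrow> real \<Rightarrow> real \<Rightarrow> real \<Rightarrow> real \<Rightarrow> real \<Rightarrow> real" where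
  "conj_val s t x0 x1 x2 x3 = x0 + s * x1 * sp + t * x2 * sq + s * t * x3 * sr"

abbreviation val :: "real \<Rightarrow> real \<Rightarrow> real \<Rightarrow> real \<Rightarrow> real" where "val \<equiv> conj_val 1 1"

lemma conj_val_mult:
  assumes "s * s = 1" "t * t = 1"
  shows "conj_val s t x0 x1 x2 x3 * conj_val s t y0 y1 y2 y3 = conj_val s t
    (x0 * y0 + of_int p * x1 * y1 + of_int q * x2 * y2 + of_int r * x3 * y3)
    (x0 * y1 + x1 * y0 + of_int (2 * n + 3) * (x2 * y3 + x3 * y2))
    (x0 * y2 + x2 * y0 + of_int (2 * n + 1) * (x1 * y3 + x3 * y1))
    (x0 * y3 + x3 * y0 + of_int (2 * n - 1) * (x1 * y2 + x2 * y1))" (is "?L = ?R")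
proof -
  have "?L = x0 * y0 + s * s * (x1 * y1) * (sp * sp) + t * t * (x2 * y2) * (sq * sq) + (s * s) * (t * t) * (x3 * y3) * (sr * sr)
    + s * (x0 * y1 + x1 * y0) * sp + t * (x0 * y2 + x2 * y0) * sq + s * t * (x0 * y3 + x3 * y0) * sr
    + s * t * (x1 * y2 + x2 * y1) * (sp * sq) + s * s * t * (x1 * y3 + x3 * y1) * (sp * sr)
    + s * (t * t) * (x2 * y3 + x3 * y2) * (sq * sr)"
    unfolding conj_val_def by (simp add: algebra_simps)
  also have "\<dots> = ?R" unfolding sqrt_squares sqrt_products assms conj_val_def by (simp add: algebra_simps)
  finally show ?thesis .
qed

text \<open>Linear independence of 1, sp, sq, sr over the rationals. Moving two terms across and
  squaring leaves a relation in a single square root, whose rational part must vanish. The three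
  possible pairings give equations whose pairwise sums are x0^2 = r x3^2 and its analogues.\<close>

lemma val_eq_0:
  assumes Q: "x0 \<in> \<rat>" "x1 \<in> \<rat>" "x2 \<in> \<rat>" "x3 \<in> \<rat>" and 0: "val x0 x1 x2 x3 = 0"
  shows "x0 = 0" "x1 = 0" "x2 = 0" "x3 = 0"
proof -
  have irr: "e = 0 \<and> f = 0" if "e \<in> \<rat>" "f \<in> \<rat>" "e + f * T = 0" "T * T = of_int m" "squarefree m" "m > 1" for e f T :: real and m :: int
  proof -
    have "e = - (f * T)" using that(3) by simp
    then have "e\<^sup>2 = f\<^sup>2 * of_int m" using that(4) by (simp add: power2_eq_square)
    then show ?thesis using squarefree_irrational[OF that(1,2,5,6)] by blast
  qed
  have e0: "x0 + x1 * sp + x2 * sq + x3 * sr = 0" using 0 by (simp add: conj_val_def)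
  have "x0 + x1 * sp = - (x2 * sq + x3 * sr)" using e0 by linarith
  then have "(x0 + x1 * sp) * (x0 + x1 * sp) = (x2 * sq + x3 * sr) * (x2 * sq + x3 * sr)" by (simp only: minus_mult_minus)
  then have "x0 * x0 + x1 * x1 * (sp * sp) + 2 * x0 * x1 * sp
      = x2 * x2 * (sq * sq) + x3 * x3 * (sr * sr) + 2 * x2 * x3 * (sq * sr)" by (simp add: algebra_simps)
  then have "(x0 * x0 + x1 * x1 * of_int p - x2 * x2 * of_int q - x3 * x3 * of_int r)
      + (2 * x0 * x1 - 2 * x2 * x3 * of_int (2 * n + 3)) * sp = 0"
    unfolding sqrt_squares sqrt_products by (simp add: algebra_simps)
  then have 1: "x0 * x0 + x1 * x1 * of_int p - x2 * x2 * of_int q - x3 * x3 * of_int r = 0"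
    by (rule conjunct1[OF irr[OF _ _ _ sqrt_squares(1) sqf(1) gt_1(1)], rotated 2]) (use Q in simp_all)
  have "x0 + x2 * sq = - (x1 * sp + x3 * sr)" using e0 by linarith
  then have "(x0 + x2 * sq) * (x0 + x2 * sq) = (x1 * sp + x3 * sr) * (x1 * sp + x3 * sr)" by (simp only: minus_mult_minus)
  then have "x0 * x0 + x2 * x2 * (sq * sq) + 2 * x0 * x2 * sq
      = x1 * x1 * (sp * sp) + x3 * x3 * (sr * sr) + 2 * x1 * x3 * (sp * sr)" by (simp add: algebra_simps)
  then have "(x0 * x0 + x2 * x2 * of_int q - x1 * x1 * of_int p - x3 * x3 * of_int r)
      + (2 * x0 * x2 - 2 * x1 * x3 * of_int (2 * n + 1)) * sq = 0"
    unfolding sqrt_squares sqrt_products by (simp add: algebra_simps)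
  then have 2: "x0 * x0 + x2 * x2 * of_int q - x1 * x1 * of_int p - x3 * x3 * of_int r = 0"
    by (rule conjunct1[OF irr[OF _ _ _ sqrt_squares(2) sqf(2) gt_1(2)], rotated 2]) (use Q in simp_all)
  have "x0 + x3 * sr = - (x1 * sp + x2 * sq)" using e0 by linarith
  then have "(x0 + x3 * sr) * (x0 + x3 * sr) = (x1 * sp + x2 * sq) * (x1 * sp + x2 * sq)" by (simp only: minus_mult_minus)
  then have "x0 * x0 + x3 * x3 * (sr * sr) + 2 * x0 * x3 * sr
      = x1 * x1 * (sp * sp) + x2 * x2 * (sq * sq) + 2 * x1 * x2 * (sp * sq)" by (simp add: algebra_simps)
  then have "(x0 * x0 + x3 * x3 * of_int r - x1 * x1 * of_int p - x2 * x2 * of_int q)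
      + (2 * x0 * x3 - 2 * x1 * x2 * of_int (2 * n - 1)) * sr = 0"
    unfolding sqrt_squares sqrt_products by (simp add: algebra_simps)
  then have 3: "x0 * x0 + x3 * x3 * of_int r - x1 * x1 * of_int p - x2 * x2 * of_int q = 0"
    by (rule conjunct1[OF irr[OF _ _ _ sqrt_squares(3) sqf(3) gt_1(3)], rotated 2]) (use Q in simp_all)
  have "x0\<^sup>2 = x3\<^sup>2 * of_int r" "x0\<^sup>2 = x2\<^sup>2 * of_int q" "x0\<^sup>2 = x1\<^sup>2 * of_int p"
    using 1 2 3 by (simp_all add: power2_eq_square)
  then show "x0 = 0" "x1 = 0" "x2 = 0" "x3 = 0"
    using squarefree_irrational[OF Q(1,4) sqf(3) gt_1(3)] squarefree_irrational[OF Q(1,3) sqf(2) gt_1(2)]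
      squarefree_irrational[OF Q(1,2) sqf(1) gt_1(1)] by auto
qed

lemma conj_val_diff: "conj_val s t x0 x1 x2 x3 - conj_val s t y0 y1 y2 y3
    = conj_val s t (x0 - y0) (x1 - y1) (x2 - y2) (x3 - y3)"
  by (simp add: conj_val_def algebra_simps)

lemma val_inj:
  assumes "x0 \<in> \<rat>" "x1 \<in> \<rat>" "x2 \<in> \<rat>" "x3 \<in> \<rat>" "y0 \<in> \<rat>" "y1 \<in> \<rat>" "y2 \<in> \<rat>" "y3 \<in> \<rat>"
    and "val x0 x1 x2 x3 = val y0 y1 y2 y3"
  shows "x0 = y0" "x1 = y1" "x2 = y2" "x3 = y3"
proof -
  have "val (x0 - y0) (x1 - y1) (x2 - y2) (x3 - y3) = 0" using assms(9) by (simp add: conj_val_diff[symmetric])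
  then have "x0 - y0 = 0" "x1 - y1 = 0" "x2 - y2 = 0" "x3 - y3 = 0"
    using val_eq_0[of "x0 - y0" "x1 - y1" "x2 - y2" "x3 - y3"] assms by simp_all
  then show "x0 = y0" "x1 = y1" "x2 = y2" "x3 = y3" by simp_all
qed

definition field_K :: "real set" where
  "field_K = {val x0 x1 x2 x3 | x0 x1 x2 x3. x0 \<in> \<rat> \<and> x1 \<in> \<rat> \<and> x2 \<in> \<rat> \<and> x3 \<in> \<rat>}"

lemma field_K_I: "x0 \<in> \<rat> \<Longrightarrow> x1 \<in> \<rat> \<Longrightarrow> x2 \<in> \<rat> \<Longrightarrow> x3 \<in> \<rat> \<Longrightarrow> val x0 x1 x2 x3 \<in> field_K"
  by (auto simp: field_K_def)

lemma field_K_mult: "x \<in> field_K \<Longrightarrow> y \<in> field_K \<Longrightarrow> x * y \<in> field_K"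
  unfolding field_K_def by (auto simp: conj_val_mult simp del: of_int_add of_int_diff of_int_mult)
    (blast intro: Rats_add Rats_mult Rats_of_int)

lemma field_K_add: "x \<in> field_K \<Longrightarrow> y \<in> field_K \<Longrightarrow> x + y \<in> field_K"
proof -
  assume "x \<in> field_K" "y \<in> field_K"
  then obtain x0 x1 x2 x3 y0 y1 y2 y3 where
    x: "x = val x0 x1 x2 x3" "x0 \<in> \<rat>" "x1 \<in> \<rat>" "x2 \<in> \<rat>" "x3 \<in> \<rat>" and
    y: "y = val y0 y1 y2 y3" "y0 \<in> \<rat>" "y1 \<in> \<rat>" "y2 \<in> \<rat>" "y3 \<in> \<rat>" unfolding field_K_def by blast
  have "x + y = val (x0 + y0) (x1 + y1) (x2 + y2) (x3 + y3)"
    unfolding x(1) y(1) by (simp add: conj_val_def algebra_simps)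
  then show ?thesis using field_K_I[of "x0 + y0" "x1 + y1" "x2 + y2" "x3 + y3"] x y by simp
qed

lemma field_K_rat: "x \<in> \<rat> \<Longrightarrow> x \<in> field_K"
  using field_K_I[of x 0 0 0] by (simp add: conj_val_def)

text \<open>Write \<open>x = u + v sq\<close> with \<open>u, v\<close> in the quadratic subfield generated by \<open>sp\<close> and rationalise the
  denominator twice; if a conjugate vanishes, then \<open>x\<close> already lies in the smaller field.\<close>

lemma field_K_inverse:
  assumes "x \<in> field_K"
  shows "inverse x \<in> field_K"
proof -
  have sub: "inverse (e + f * sp) \<in> field_K" if ef: "e \<in> \<rat>" "f \<in> \<rat>" for e f
  proof (cases "e - f * sp = 0")
    case True
    then have "e + f * sp = 2 * e" by simp
    then show ?thesis using ef field_K_rat[of "inverse (2 * e)"] by simp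
  next
    case False
    define c where "c = e * e - f * f * of_int p"
    have "(e + f * sp) * (e - f * sp) = c"
      using sqrt_squares(1) by (simp add: c_def algebra_simps)
    then have "inverse (e + f * sp) = inverse c * (e - f * sp)"
      using False by (metis inverse_mult_distrib mult.assoc left_inverse mult.right_neutral mult.commute)
    moreover have "e - f * sp \<in> field_K" using field_K_I[of e "- f" 0 0] ef by (simp add: conj_val_def)
    moreover have "inverse c \<in> field_K" using ef by (intro field_K_rat) (simp add: c_def)
    ultimately show ?thesis using field_K_mult by simp
  qed
  obtain x0 x1 x2 x3 where x: "x = val x0 x1 x2 x3" "x0 \<in> \<rat>" "x1 \<in> \<rat>" "x2 \<in> \<rat>" "x3 \<in> \<rat>"
    using assms unfolding field_K_def by blast
  define a :: real where "a = of_int (2 * n - 1)"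
  have a: "a \<noteq> 0" "a \<in> \<rat>" using n6 by (simp_all add: a_def)
  define u where "u = x0 + x1 * sp"
  define v where "v = x2 + x3 / a * sp"
  have "sr = sp * sq / a" using sqrt_products(1) a by (simp add: a_def)
  then have xuv: "x = u + v * sq" unfolding x(1) u_def v_def conj_val_def by (simp add: algebra_simps)
  show ?thesis
  proof (cases "u - v * sq = 0")
    case True
    then have "x = 2 * x0 + 2 * x1 * sp" using xuv by (simp add: u_def)
    then show ?thesis using sub[of "2 * x0" "2 * x1"] x by simp
  next
    case False
    define c where "c = u * u - v * v * of_int q"
    have "x * (u - v * sq) = c"
      unfolding xuv using sqrt_squares(2) by (simp add: c_def algebra_simps)
    then have "inverse x = inverse c * (u - v * sq)"
      using False by (metis inverse_mult_distrib mult.assoc left_inverse mult.right_neutral mult.commute)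
    moreover have "u - v * sq = val x0 x1 (- x2) (- x3)"
      unfolding u_def v_def conj_val_def using \<open>sr = sp * sq / a\<close> by (simp add: algebra_simps)
    then have "u - v * sq \<in> field_K" using field_K_I x by simp
    moreover have "c = (x0 * x0 + x1 * x1 * of_int p - of_int q * (x2 * x2 + x3 / a * (x3 / a) * of_int p))
        + (2 * x0 * x1 - 2 * of_int q * x2 * (x3 / a)) * sp"
    proof -
      have "u * u = x0 * x0 + x1 * x1 * (sp * sp) + 2 * x0 * x1 * sp" by (simp add: u_def algebra_simps)
      moreover have "v * v = x2 * x2 + x3 / a * (x3 / a) * (sp * sp) + 2 * x2 * (x3 / a) * sp"
        by (simp add: v_def algebra_simps)
      ultimately show ?thesis unfolding c_def sqrt_squares by (simp add: algebra_simps)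
    qed
    then have "inverse c \<in> field_K" using x a by (simp only:) (intro sub; simp)
    ultimately show ?thesis using field_K_mult by simp
  qed
qed

lemma rat_adjoin_eq_field_K: "rat_adjoin {sp, sq} = field_K"
proof
  show "rat_adjoin {sp, sq} \<subseteq> field_K"
  proof
    fix x assume "x \<in> rat_adjoin {sp, sq}"
    then show "x \<in> field_K"
    proof (rule rat_adjoin_induct)
      show "y \<in> field_K" if "y \<in> {sp, sq}" for y
        using that field_K_I[of 0 1 0 0] field_K_I[of 0 0 1 0] by (auto simp: conj_val_def)
      show "- y \<in> field_K" if "y \<in> field_K" for y
        using field_K_mult[OF field_K_rat[of "- 1"] that] by simp
    qed (auto intro: field_K_rat field_K_inverse field_K_add field_K_mult)
  qed
next
  show "field_K \<subseteq> rat_adjoin {sp, sq}"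
  proof
    fix x assume "x \<in> field_K"
    then obtain x0 x1 x2 x3 where x: "x = val x0 x1 x2 x3" "x0 \<in> \<rat>" "x1 \<in> \<rat>" "x2 \<in> \<rat>" "x3 \<in> \<rat>"
      unfolding field_K_def by blast
    have "real_of_int (2 * n - 1) \<noteq> 0" using n6 by simp
    then have "sr = 1 / of_int (2 * n - 1) * (sp * sq)" using sqrt_products(1) by simp
    then have "x = x0 + x1 * sp + x2 * sq + x3 * (1 / of_int (2 * n - 1)) * (sp * sq)"
      unfolding x(1) conj_val_def by simp
    moreover have "\<dots> \<in> rat_adjoin {sp, sq}"
    proof -
      note mul = rat_adjoin_intros(4)[of _ "{sp, sq}"] and rat = rat_adjoin_intros(1)[of _ "{sp, sq}"]
      have g: "sp \<in> rat_adjoin {sp, sq}" "sq \<in> rat_adjoin {sp, sq}" by (auto intro: rat_adjoin_intros(2))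
      have "1 / of_int (2 * n - 1) \<in> (\<rat> :: real set)" by simp
      note m = mul[OF rat[OF x(3)] g(1)] mul[OF rat[OF x(4)] g(2)] mul[OF mul[OF rat[OF x(5)] rat[OF this]] mul[OF g]]
      show ?thesis by (intro rat_adjoin_intros(3) m rat[OF x(2)])
    qed
    ultimately show "x \<in> rat_adjoin {sp, sq}" by simp
  qed
qed

section \<open>An order with explicit coordinates and almost integral elements\<close>

definition order_M :: "real set" where
  "order_M = range (\<lambda>(a, b, c, d). val (of_int a) (of_int b) (of_int c) (of_int d))"

lemma order_M_I: "val (of_int a) (of_int b) (of_int c) (of_int d) \<in> order_M"
  unfolding order_M_def by (rule range_eqI[of _ _ "(a, b, c, d)"]) simp

lemma order_M_E:
  assumes "x \<in> order_M"
  obtains a b c d where "x = val (of_int a) (of_int b) (of_int c) (of_int d)"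
  using assms unfolding order_M_def by auto

lemma order_M_int: "of_int a \<in> order_M"
  using order_M_I[of a 0 0 0] by (simp add: conj_val_def)

lemma order_M_add: "x \<in> order_M \<Longrightarrow> y \<in> order_M \<Longrightarrow> x + y \<in> order_M"
proof -
  assume "x \<in> order_M" "y \<in> order_M"
  then obtain a b c d a' b' c' d' where "x = val (of_int a) (of_int b) (of_int c) (of_int d)"
    "y = val (of_int a') (of_int b') (of_int c') (of_int d')" by (metis order_M_E)
  then have "x + y = val (of_int (a + a')) (of_int (b + b')) (of_int (c + c')) (of_int (d + d'))"
    by (simp add: conj_val_def algebra_simps)
  then show ?thesis using order_M_I by metis
qed

lemma order_M_mult: "x \<in> order_M \<Longrightarrow> y \<in> order_M \<Longrightarrow> x * y \<in> order_M"
proof -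
  assume "x \<in> order_M" "y \<in> order_M"
  then obtain a b c d a' b' c' d' where "x = val (of_int a) (of_int b) (of_int c) (of_int d)"
    "y = val (of_int a') (of_int b') (of_int c') (of_int d')" by (metis order_M_E)
  then have "x * y = val (of_int (a * a' + p * b * b' + q * c * c' + r * d * d'))
      (of_int (a * b' + b * a' + (2 * n + 3) * (c * d' + d * c')))
      (of_int (a * c' + c * a' + (2 * n + 1) * (b * d' + d * b')))
      (of_int (a * d' + d * a' + (2 * n - 1) * (b * c' + c * b')))"
    by (simp add: conj_val_mult)
  then show ?thesis using order_M_I by metis
qed

lemma order_M_sum: "(\<And>i. i \<in> I \<Longrightarrow> f i \<in> order_M) \<Longrightarrow> sum f I \<in> order_M"
  using order_M_int[of 0] by (induction I rule: infinite_finite_induct) (auto intro: order_M_add)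

lemma order_M_power: "x \<in> order_M \<Longrightarrow> x ^ k \<in> order_M"
  using order_M_int[of 1] by (induction k) (auto intro: order_M_mult)

lemma order_M_rat: "x \<in> order_M \<Longrightarrow> x \<in> \<rat> \<Longrightarrow> x \<in> \<int>"
proof -
  assume x: "x \<in> order_M" "x \<in> \<rat>"
  then obtain a b c d where e: "x = val (of_int a) (of_int b) (of_int c) (of_int d)" by (metis order_M_E)
  have "val x 0 0 0 = val (of_int a) (of_int b) (of_int c) (of_int d)" using e by (simp add: conj_val_def)
  then have "x = of_int a" by (rule val_inj(1)[rotated -1]) (use x in auto)
  then show ?thesis by simp
qed

text \<open>Almost integrality, unlike integrality, is obviously preserved by sums, products and conjugation.\<close>

definition almost_integral :: "real \<Rightarrow> bool" where
  "almost_integral x \<longleftrightarrow> (\<exists>N::int. N > 0 \<and> (\<forall>k. of_int N * x ^ k \<in> order_M))"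

lemma almost_integral_mult:
  assumes "almost_integral x" "almost_integral y"
  shows "almost_integral (x * y)"
proof -
  obtain N N' :: int where N: "N > 0" "\<And>k. of_int N * x ^ k \<in> order_M" "N' > 0" "\<And>k. of_int N' * y ^ k \<in> order_M"
    using assms unfolding almost_integral_def by blast
  have "of_int (N * N') * (x * y) ^ k \<in> order_M" for k
    using order_M_mult[OF N(2)[of k] N(4)[of k]] by (simp add: power_mult_distrib mult_ac)
  then show ?thesis unfolding almost_integral_def using N by (intro exI[of _ "N * N'"]) auto
qed

lemma almost_integral_add:
  assumes "almost_integral x" "almost_integral y"
  shows "almost_integral (x + y)"
proof -
  obtain N N' :: int where N: "N > 0" "\<And>k. of_int N * x ^ k \<in> order_M" "N' > 0" "\<And>k. of_int N' * y ^ k \<in> order_M"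
    using assms unfolding almost_integral_def by blast
  have "of_int (N * N') * (x + y) ^ k \<in> order_M" for k
  proof -
    have "of_int (N * N') * (x + y) ^ k
        = (\<Sum>i\<le>k. of_int (int (k choose i)) * ((of_int N * x ^ i) * (of_int N' * y ^ (k - i))))"
      unfolding binomial_ring sum_distrib_left by (intro sum.cong refl) (simp add: mult_ac)
    also have "\<dots> \<in> order_M" by (intro order_M_sum order_M_mult order_M_int N)
    finally show ?thesis .
  qed
  then show ?thesis unfolding almost_integral_def using N by (intro exI[of _ "N * N'"]) auto
qed

lemma almost_integral_rat:
  assumes "almost_integral x" "x \<in> \<rat>"
  shows "x \<in> \<int>"
proof -
  obtain N :: int where N: "N > 0" "\<And>k. of_int N * x ^ k \<in> order_M"
    using assms unfolding almost_integral_def by blast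
  have "of_int N * x ^ k \<in> \<int>" for k using order_M_rat[OF N(2)] assms(2) by simp
  then show ?thesis using rat_powers_bounded_denominator[OF assms(2) N(1)] by blast
qed

text \<open>The powers of an element and of its conjugate have the same rational coordinates up to
  the signs \<open>s\<close>, \<open>t\<close>, and membership in \<open>order_M\<close> is
  insensitive to these signs.\<close>

lemma almost_integral_conj:
  assumes st: "s * s = 1" "t * t = 1" and x: "x0 \<in> \<rat>" "x1 \<in> \<rat>" "x2 \<in> \<rat>" "x3 \<in> \<rat>"
    and ai: "almost_integral (val x0 x1 x2 x3)"
  shows "almost_integral (conj_val s t x0 x1 x2 x3)"
proof -
  obtain N :: int where N: "N > 0" "\<And>k. of_int N * (val x0 x1 x2 x3) ^ k \<in> order_M"
    using ai unfolding almost_integral_def by blast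
  have pow: "\<exists>y0 y1 y2 y3. y0 \<in> \<rat> \<and> y1 \<in> \<rat> \<and> y2 \<in> \<rat> \<and> y3 \<in> \<rat> \<and>
      of_int N * (val x0 x1 x2 x3) ^ k = val y0 y1 y2 y3 \<and>
      of_int N * (conj_val s t x0 x1 x2 x3) ^ k = conj_val s t y0 y1 y2 y3" for k
  proof (induction k)
    case 0
    then show ?case by (intro exI[of _ "of_int N"] exI[of _ 0]) (simp add: conj_val_def)
  next
    case (Suc k)
    then obtain y0 y1 y2 y3 where y: "y0 \<in> \<rat>" "y1 \<in> \<rat>" "y2 \<in> \<rat>" "y3 \<in> \<rat>"
      "of_int N * (val x0 x1 x2 x3) ^ k = val y0 y1 y2 y3"
      "of_int N * (conj_val s t x0 x1 x2 x3) ^ k = conj_val s t y0 y1 y2 y3" by blast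
    have e1: "of_int N * (val x0 x1 x2 x3) ^ Suc k = val x0 x1 x2 x3 * val y0 y1 y2 y3"
      unfolding y(5)[symmetric] by (simp add: mult_ac)
    have e2: "of_int N * (conj_val s t x0 x1 x2 x3) ^ Suc k = conj_val s t x0 x1 x2 x3 * conj_val s t y0 y1 y2 y3"
      unfolding y(6)[symmetric] by (simp add: mult_ac)
    define z0 z1 z2 z3 where "z0 = x0 * y0 + of_int p * x1 * y1 + of_int q * x2 * y2 + of_int r * x3 * y3"
      and "z1 = x0 * y1 + x1 * y0 + of_int (2 * n + 3) * (x2 * y3 + x3 * y2)"
      and "z2 = x0 * y2 + x2 * y0 + of_int (2 * n + 1) * (x1 * y3 + x3 * y1)"
      and "z3 = x0 * y3 + x3 * y0 + of_int (2 * n - 1) * (x1 * y2 + x2 * y1)"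
    have "z0 \<in> \<rat>" "z1 \<in> \<rat>" "z2 \<in> \<rat>" "z3 \<in> \<rat>"
      unfolding z0_def z1_def z2_def z3_def by (intro Rats_add Rats_mult Rats_of_int x y(1-4))+
    moreover have "val x0 x1 x2 x3 * val y0 y1 y2 y3 = val z0 z1 z2 z3"
      "conj_val s t x0 x1 x2 x3 * conj_val s t y0 y1 y2 y3 = conj_val s t z0 z1 z2 z3"
      unfolding z0_def z1_def z2_def z3_def by (rule conj_val_mult; simp add: st)+
    ultimately show ?case unfolding e1 e2 by blast
  qed
  have "of_int N * (conj_val s t x0 x1 x2 x3) ^ k \<in> order_M" for k
  proof -
    obtain y0 y1 y2 y3 where y: "y0 \<in> \<rat>" "y1 \<in> \<rat>" "y2 \<in> \<rat>" "y3 \<in> \<rat>"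
      "of_int N * (val x0 x1 x2 x3) ^ k = val y0 y1 y2 y3"
      "of_int N * (conj_val s t x0 x1 x2 x3) ^ k = conj_val s t y0 y1 y2 y3" using pow[of k] by blast
    obtain a b c d where e: "val y0 y1 y2 y3 = val (of_int a) (of_int b) (of_int c) (of_int d)"
      using N(2)[of k] y(5) order_M_E by metis
    have ys: "y0 = of_int a" "y1 = of_int b" "y2 = of_int c" "y3 = of_int d"
      using val_inj[OF y(1-4) Rats_of_int Rats_of_int Rats_of_int Rats_of_int e] by auto
    have s: "s = 1 \<or> s = - 1" "t = 1 \<or> t = - 1" using st by (auto simp: square_eq_1_iff[symmetric])
    define S T :: int where "S = (if s = 1 then 1 else - 1)" and "T = (if t = 1 then 1 else - 1)"
    have "s = of_int S" "t = of_int T" using s by (auto simp: S_def T_def)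
    then have "conj_val s t y0 y1 y2 y3 = val (of_int a) (of_int (S * b)) (of_int (T * c)) (of_int (S * T * d))"
      unfolding ys conj_val_def by simp
    then show ?thesis unfolding y(6) using order_M_I by metis
  qed
  then show ?thesis unfolding almost_integral_def using N(1) by blast
qed

text \<open>If \<open>D\<close> clears the denominators of x, then D^d clears those of all powers
  below the degree d of a monic equation, and this equation carries the property to the higher
  powers.\<close>

lemma algebraic_int_imp_almost_integral:
  assumes x: "x \<in> field_K" and ai: "algebraic_int x"
  shows "almost_integral x"
proof -
  obtain x0 x1 x2 x3 where xv: "x = val x0 x1 x2 x3" "x0 \<in> \<rat>" "x1 \<in> \<rat>" "x2 \<in> \<rat>" "x3 \<in> \<rat>"
    using x unfolding field_K_def by blast
  have den: "\<exists>u v::int. v > 0 \<and> y = of_int u / of_int v" if "y \<in> \<rat>" for y :: real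
    using that by (metis Rats_cases')
  obtain u0 v0 u1 v1 u2 v2 u3 v3 :: int where
    uv: "v0 > 0" "x0 = of_int u0 / of_int v0" "v1 > 0" "x1 = of_int u1 / of_int v1"
      "v2 > 0" "x2 = of_int u2 / of_int v2" "v3 > 0" "x3 = of_int u3 / of_int v3"
    using den[OF xv(2)] den[OF xv(3)] den[OF xv(4)] den[OF xv(5)] by blast
  define D where "D = v0 * v1 * v2 * v3"
  have D: "D > 0" using uv by (simp add: D_def)
  have "of_int D * x = val (of_int (u0 * v1 * v2 * v3)) (of_int (u1 * v0 * v2 * v3)) (of_int (u2 * v0 * v1 * v3)) (of_int (u3 * v0 * v1 * v2))"
  proof -
    have "of_int D * x0 = of_int (u0 * v1 * v2 * v3)" "of_int D * x1 = of_int (u1 * v0 * v2 * v3)"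
      "of_int D * x2 = of_int (u2 * v0 * v1 * v3)" "of_int D * x3 = of_int (u3 * v0 * v1 * v2)"
      unfolding D_def uv(2,4,6,8) using uv(1,3,5,7) by simp_all
    moreover have "of_int D * x = val (of_int D * x0) (of_int D * x1) (of_int D * x2) (of_int D * x3)"
      unfolding xv(1) conj_val_def by (simp add: algebra_simps)
    ultimately show ?thesis by simp
  qed
  then have Dx: "of_int D * x \<in> order_M" using order_M_I by metis
  obtain f where f: "lead_coeff f = 1" "\<forall>i. coeff f i \<in> \<int>" "poly f x = 0"
    using ai by (auto elim: algebraic_int.cases)
  define d where "d = degree f"
  have "poly f x = (\<Sum>i\<le>d. coeff f i * x ^ i)" unfolding d_def by (rule poly_altdef)
  also have "\<dots> = (\<Sum>i<d. coeff f i * x ^ i) + x ^ d"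
    using f(1) by (simp add: lessThan_Suc_atMost[symmetric] d_def)
  finally have xd: "x ^ d = - (\<Sum>i<d. coeff f i * x ^ i)" using f(3) by simp
  have "of_int (D ^ d) * x ^ k \<in> order_M" for k
  proof (induction k rule: less_induct)
    case (less k)
    show ?case
    proof (cases "k < d")
      case True
      have "of_int (D ^ d) * x ^ k = of_int (D ^ (d - k)) * (of_int D * x) ^ k"
        using True by (simp add: power_mult_distrib mult.assoc[symmetric] power_add[symmetric])
      then show ?thesis using order_M_mult[OF order_M_int order_M_power[OF Dx]] by metis
    next
      case False
      have "x ^ k = x ^ (k - d) * x ^ d" using False by (simp add: power_add[symmetric])
      then have "of_int (D ^ d) * x ^ k = (\<Sum>i<d. (- coeff f i) * (of_int (D ^ d) * x ^ (k - d + i)))"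
        unfolding xd sum_distrib_left sum_negf[symmetric] by (simp add: power_add mult_ac sum_distrib_left sum_negf)
      also have "\<dots> \<in> order_M"
      proof (rule order_M_sum, rule order_M_mult)
        fix i assume i: "i \<in> {..<d}"
        obtain z where "coeff f i = of_int z" using f(2) by (metis Ints_cases)
        then show "- coeff f i \<in> order_M" using order_M_int[of "- z"] by simp
        show "of_int (D ^ d) * x ^ (k - d + i) \<in> order_M" using i False by (intro less.IH) auto
      qed
      finally show ?thesis .
    qed
  qed
  then show ?thesis unfolding almost_integral_def using D by (intro exI[of _ "D ^ d"]) auto
qed

section \<open>Explicit description of the integers of the field\<close>

lemma residues_mod_4: "p mod 4 = 3" "q mod 4 = 1" "r mod 4 = 3"
proof -
  have "p = 4 * (n * n - 1) + 3" "q = 4 * (n * n + n - 1) + 1" "r = 4 * (n * n + 2 * n) + 3"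
    unfolding p_eq q_eq r_eq by (simp_all add: algebra_simps)
  then show "p mod 4 = 3" "q mod 4 = 1" "r mod 4 = 3" by presburger+
qed

text \<open>As q is 1 and p, r are 3 modulo 4, only the quadratic subfield of \<open>sq\<close> has
  integers with halves; an integral basis is 1, sp, (1 + sq)/2, (sp + sr)/2.\<close>

definition integers_K :: "real set" where
  "integers_K = {val (of_int a / 2) (of_int b / 2) (of_int c / 2) (of_int d / 2) | a b c d.
     even (a - c) \<and> even (b - d)}"

lemma square_mod_4: "(a::int)\<^sup>2 mod 4 = (if even a then 0 else 1)"
proof (cases "even a")
  case True
  then obtain k where "a = 2 * k" by auto
  then show ?thesis by (simp add: power2_eq_square)
next
  case False
  then obtain k where "a = 2 * k + 1" by (elim oddE)
  then have "a\<^sup>2 = 4 * (k * k + k) + 1" by (simp add: power2_eq_square algebra_simps)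
  moreover have "(4 * c + 1) mod 4 = (1::int)" for c by presburger
  ultimately have "a\<^sup>2 mod 4 = 1" by (simp only:)
  then show ?thesis using False by simp
qed

lemma even_if_sum_squares_mod_4:
  assumes "((x::int)\<^sup>2 + y\<^sup>2) mod 4 = 0"
  shows "even x" "even y"
proof -
  have "(x\<^sup>2 mod 4 + y\<^sup>2 mod 4) mod 4 = 0" using assms unfolding mod_add_eq .
  then have "even x \<and> even y"
    by (cases "even x"; cases "even y") (simp_all add: square_mod_4)
  then show "even x" "even y" by auto
qed

text \<open>Relative traces to the three quadratic subfields show that the doubled coordinates are
  integers: p and r are 3 modulo 4, so the traces there have integral coefficients. The parity
  conditions come from the relative norm to the subfield of \<open>sq\<close>.\<close>

lemma ring_of_integers_subset:
  assumes x: "x \<in> field_K" and int: "algebraic_int x"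
  shows "x \<in> integers_K"
proof -
  obtain x0 x1 x2 x3 where xv: "x = val x0 x1 x2 x3" and Q: "x0 \<in> \<rat>" "x1 \<in> \<rat>" "x2 \<in> \<rat>" "x3 \<in> \<rat>"
    using x unfolding field_K_def by blast
  have ai: "almost_integral (conj_val s t x0 x1 x2 x3)" if "s * s = 1" "t * t = 1" for s t
    using almost_integral_conj[OF that Q] algebraic_int_imp_almost_integral[OF x int] xv by simp
  define y0 y1 y2 y3 where "y0 = conj_val 1 1 x0 x1 x2 x3" and "y1 = conj_val 1 (- 1) x0 x1 x2 x3"
    and "y2 = conj_val (- 1) 1 x0 x1 x2 x3" and "y3 = conj_val (- 1) (- 1) x0 x1 x2 x3"
  have y: "almost_integral y0" "almost_integral y1" "almost_integral y2" "almost_integral y3"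
    unfolding y0_def y1_def y2_def y3_def by (rule ai; simp)+
  have quad: "2 * e \<in> \<int> \<and> e\<^sup>2 - f\<^sup>2 * of_int m \<in> \<int>"
    if "almost_integral (e + f * T)" "almost_integral (e - f * T)" "T * T = of_int m" "e \<in> \<rat>" "f \<in> \<rat>" for e f T m
  proof
    have "almost_integral (2 * e)" using almost_integral_add[OF that(1,2)] by simp
    then show "2 * e \<in> \<int>" using almost_integral_rat that(4) by simp
    have "(e + f * T) * (e - f * T) = e\<^sup>2 - f\<^sup>2 * of_int m"
      unfolding that(3)[symmetric] by (simp add: power2_eq_square algebra_simps)
    then have "almost_integral (e\<^sup>2 - f\<^sup>2 * of_int m)" using almost_integral_mult[OF that(1,2)] by simp
    then show "e\<^sup>2 - f\<^sup>2 * of_int m \<in> \<int>" using almost_integral_rat that(4,5) by simp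
  qed
  have quad3: "e \<in> \<int> \<and> f \<in> \<int>"
    if "almost_integral (e + f * T)" "almost_integral (e - f * T)" "T * T = of_int m" "e \<in> \<rat>" "f \<in> \<rat>"
      "squarefree m" "m mod 4 = 3" for e f T m
  proof -
    note ints = quad[OF that(1-5)]
    obtain a where a: "2 * e = of_int a" using ints by (auto elim: Ints_cases)
    obtain z where z: "e\<^sup>2 - f\<^sup>2 * of_int m = of_int z" using ints by (auto elim: Ints_cases)
    have fm: "(2 * f)\<^sup>2 * of_int m = of_int (a\<^sup>2 - 4 * z)"
      using z by (simp add: a[symmetric] power_mult_distrib algebra_simps)
    have "2 * f \<in> \<int>" by (rule rat_square_squarefree_imp_int[OF _ that(6)]) (use that(5) fm in auto)
    then obtain b where b: "2 * f = of_int b" by (auto elim: Ints_cases)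
    have "real_of_int (b\<^sup>2 * m) = of_int (a\<^sup>2 - 4 * z)" using fm b by simp
    then have "b\<^sup>2 * m = a\<^sup>2 - 4 * z" by (simp only: of_int_eq_iff)
    then have "(b\<^sup>2 * m) mod 4 = a\<^sup>2 mod 4" by (simp add: mod_diff_eq[symmetric])
    then have "((b\<^sup>2 mod 4) * 3) mod 4 = a\<^sup>2 mod 4" using that(7) by (metis mod_mult_eq mod_mod_trivial)
    then have "even a" "even b" by (auto simp: square_mod_4 split: if_splits)
    then obtain a' b' where "a = 2 * a'" "b = 2 * b'" by blast
    then have "e = of_int a'" "f = of_int b'" using a b by simp_all
    then show ?thesis by simp
  qed
  have "2 * x0 \<in> \<int> \<and> 2 * x1 \<in> \<int>"
  proof (rule quad3[OF _ _ sqrt_squares(1)])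
    show "almost_integral (2 * x0 + 2 * x1 * sp)"
      using almost_integral_add[OF y(1,2)] by (simp add: y0_def y1_def conj_val_def algebra_simps)
    show "almost_integral (2 * x0 - 2 * x1 * sp)"
      using almost_integral_add[OF y(3,4)] by (simp add: y2_def y3_def conj_val_def algebra_simps)
  qed (use Q sqf residues_mod_4 in auto)
  then obtain a b where a: "2 * x0 = of_int a" and b: "2 * x1 = of_int b" by (auto elim!: Ints_cases)
  have "2 * x0 \<in> \<int> \<and> 2 * x3 \<in> \<int>"
  proof (rule quad3[OF _ _ sqrt_squares(3)])
    show "almost_integral (2 * x0 + 2 * x3 * sr)"
      using almost_integral_add[OF y(1,4)] by (simp add: y0_def y3_def conj_val_def algebra_simps)
    show "almost_integral (2 * x0 - 2 * x3 * sr)"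
      using almost_integral_add[OF y(2,3)] by (simp add: y1_def y2_def conj_val_def algebra_simps)
  qed (use Q sqf residues_mod_4 in auto)
  then obtain d where d: "2 * x3 = of_int d" by (auto elim!: Ints_cases)
  have "(2 * x0)\<^sup>2 - (2 * x2)\<^sup>2 * of_int q \<in> \<int>"
  proof (rule conjunct2[OF quad[OF _ _ sqrt_squares(2)]])
    show "almost_integral (2 * x0 + 2 * x2 * sq)"
      using almost_integral_add[OF y(1,3)] by (simp add: y0_def y2_def conj_val_def algebra_simps)
    show "almost_integral (2 * x0 - 2 * x2 * sq)"
      using almost_integral_add[OF y(2,4)] by (simp add: y1_def y3_def conj_val_def algebra_simps)
  qed (use Q in auto)
  then obtain z where "(2 * x0)\<^sup>2 - (2 * x2)\<^sup>2 * of_int q = of_int z" by (auto elim: Ints_cases)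
  then have "(2 * x2)\<^sup>2 * of_int q = of_int (a\<^sup>2 - z)" unfolding a by simp
  then have "(2 * x2)\<^sup>2 * of_int q \<in> \<int>" by (simp only: Ints_of_int)
  then have "2 * x2 \<in> \<int>" by (rule rat_square_squarefree_imp_int[rotated -1]) (use Q sqf in simp_all)
  then obtain c where c: "2 * x2 = of_int c" by (auto elim: Ints_cases)
  have xs: "x0 = of_int a / 2" "x1 = of_int b / 2" "x2 = of_int c / 2" "x3 = of_int d / 2" using a b c d by linarith+
  \<comment> \<open>\<open>g + h * sq\<close> is the relative norm of x to the subfield of
    \<open>sq\<close>; its integrality ties all four coordinates together.\<close>
  define g where "g = of_int (a\<^sup>2 + q * c\<^sup>2 - p * b\<^sup>2 - r * d\<^sup>2) / (4::real)"
  define h where "h = of_int (a * c - (2 * n + 1) * (b * d)) / (2::real)"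
  have gh: "(x0 + x2 * sq)\<^sup>2 - (x1 * sp + x3 * sr)\<^sup>2 = g + h * sq" "(x0 - x2 * sq)\<^sup>2 - (x1 * sp - x3 * sr)\<^sup>2 = g - h * sq"
  proof -
    have "(x0 + e * x2 * sq)\<^sup>2 - (x1 * sp + e * x3 * sr)\<^sup>2
      = x0 * x0 + e * e * x2 * x2 * (sq * sq) - x1 * x1 * (sp * sp) - e * e * x3 * x3 * (sr * sr)
        + 2 * e * x0 * x2 * sq - 2 * e * x1 * x3 * (sp * sr)" for e
      by (simp add: power2_eq_square algebra_simps)
    from this[of 1] this[of "- 1"]
    show "(x0 + x2 * sq)\<^sup>2 - (x1 * sp + x3 * sr)\<^sup>2 = g + h * sq" "(x0 - x2 * sq)\<^sup>2 - (x1 * sp - x3 * sr)\<^sup>2 = g - h * sq"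
      unfolding sqrt_squares sqrt_products xs g_def h_def by (simp_all add: power2_eq_square field_simps)
  qed
  have "2 * g \<in> \<int> \<and> g\<^sup>2 - h\<^sup>2 * of_int q \<in> \<int>"
  proof (rule quad[OF _ _ sqrt_squares(2)])
    have "y0 * y2 = (x0 + x2 * sq)\<^sup>2 - (x1 * sp + x3 * sr)\<^sup>2"
      by (simp add: y0_def y2_def conj_val_def power2_eq_square algebra_simps)
    then show "almost_integral (g + h * sq)" using almost_integral_mult[OF y(1,3)] gh by simp
    have "y1 * y3 = (x0 - x2 * sq)\<^sup>2 - (x1 * sp - x3 * sr)\<^sup>2"
      by (simp add: y1_def y3_def conj_val_def power2_eq_square algebra_simps)
    then show "almost_integral (g - h * sq)" using almost_integral_mult[OF y(2,4)] gh by simp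
  qed (auto simp: g_def h_def)
  then obtain e z where e: "2 * g = of_int e" and z: "g\<^sup>2 - h\<^sup>2 * of_int q = of_int z" by (auto elim!: Ints_cases)
  define f where "f = a * c - (2 * n + 1) * (b * d)"
  have h2: "2 * h = of_int f" by (simp add: h_def f_def)
  have "(2 * g)\<^sup>2 - (2 * h)\<^sup>2 * of_int q = 4 * of_int z" using z by (simp add: power_mult_distrib algebra_simps)
  then have "real_of_int (e\<^sup>2 - f\<^sup>2 * q) = of_int (4 * z)" unfolding e h2 by simp
  then have ef: "e\<^sup>2 - f\<^sup>2 * q = 4 * z" by (simp only: of_int_eq_iff)
  have "real_of_int (2 * e) = of_int (a\<^sup>2 + q * c\<^sup>2 - p * b\<^sup>2 - r * d\<^sup>2)" using e by (simp add: g_def)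
  then have e2: "2 * e = a\<^sup>2 + q * c\<^sup>2 - p * b\<^sup>2 - r * d\<^sup>2" by (simp only: of_int_eq_iff)
  obtain p' q' r' where pqr: "p = 4 * p' + 3" "q = 4 * q' + 1" "r = 4 * r' + 3"
    using residues_mod_4 by (metis mult_div_mod_eq)
  have "e\<^sup>2 - f\<^sup>2 = 4 * (z + f\<^sup>2 * q')" using ef pqr(2) by (simp add: algebra_simps)
  then have "even (e\<^sup>2 - f\<^sup>2)" by simp
  then have "even (e - f)" by simp
  then obtain k where k: "e = f + 2 * k" by (metis add.commute diff_add_cancel dvd_def)
  define Z where "Z = q' * c\<^sup>2 - (p' + 1) * b\<^sup>2 - (r' + 1) * d\<^sup>2"
  \<comment> \<open>Modulo 4, \<open>2 * e\<close> is a^2 + b^2 + c^2 + d^2 and also 2ac - 2bd. The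
    difference of the two is this sum of two squares, which is 0 modulo 4 only if both squares are
    even.\<close>
  have "(a - c)\<^sup>2 + (b + d)\<^sup>2 = a\<^sup>2 + c\<^sup>2 + b\<^sup>2 + d\<^sup>2 - 2 * (a * c) + 2 * (b * d)"
    by (simp add: power2_eq_square algebra_simps)
  also have "\<dots> = 2 * e - 4 * Z - 2 * (a * c) + 2 * (b * d)"
    unfolding e2 pqr Z_def by (simp add: algebra_simps)
  also have "2 * e = 2 * (a * c) - 2 * (b * d) + 4 * (k - n * (b * d))"
    unfolding k f_def by (simp add: algebra_simps)
  finally have sum4: "(a - c)\<^sup>2 + (b + d)\<^sup>2 = 4 * (k - n * (b * d) - Z)" by (simp add: right_diff_distrib)
  have "((a - c)\<^sup>2 + (b + d)\<^sup>2) mod 4 = 0" unfolding sum4 by (rule mod_mult_self1_is_0)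
  note even_if_sum_squares_mod_4[OF this]
  then have "even (a - c)" "even (b - d)" by presburger+
  then show ?thesis unfolding integers_K_def xv xs mem_Collect_eq
    by (intro exI[of _ a] exI[of _ b] exI[of _ c] exI[of _ d]) simp
qed

text \<open>The quadratic equation of x over the subfield of \<open>sq\<close> reads u = w sq with
  \<open>u\<close> and \<open>w\<close> rational polynomials in x; multiplying with its conjugate
  gives u^2 - q w^2 = 0, the monic quartic \<open>cs\<close>. The parity conditions make
  \<open>e\<close> and \<open>f\<close> congruent modulo 2, whence \<open>m\<close> is an
  integer.\<close>

lemma integers_K_subset:
  assumes "x \<in> integers_K"
  shows "x \<in> field_K" "algebraic_int x"
proof -
  obtain a b c d where x: "x = val (of_int a / 2) (of_int b / 2) (of_int c / 2) (of_int d / 2)"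
    and ev: "even (a - c)" "even (b - d)" using assms unfolding integers_K_def by blast
  show "x \<in> field_K" unfolding x by (rule field_K_I) auto
  obtain p' q' r' where pqr: "p = 4 * p' + 3" "q = 4 * q' + 1" "r = 4 * r' + 3"
    using residues_mod_4 by (metis mult_div_mod_eq)
  obtain a' b' where ab: "a = c + 2 * a'" "b = d + 2 * b'" using ev by (metis add.commute diff_add_cancel dvd_def)
  define f where "f = a * c - (2 * n + 1) * (b * d)"
  define k where "k = a'\<^sup>2 + q' * c\<^sup>2 - p' * b\<^sup>2 - r' * d\<^sup>2 - b\<^sup>2 - d\<^sup>2 + b'\<^sup>2 + (n + 1) * (b * d)"
  define e where "e = f + 2 * k"
  have e2: "2 * e = a\<^sup>2 + q * c\<^sup>2 - p * b\<^sup>2 - r * d\<^sup>2"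
    unfolding e_def k_def f_def pqr ab by (simp add: power2_eq_square algebra_simps)
  define m where "m = f * k + k\<^sup>2 - f\<^sup>2 * q'"
  have m4: "4 * m = e\<^sup>2 - q * f\<^sup>2" unfolding m_def e_def pqr by (simp add: power2_eq_square algebra_simps)
  define u where "u = x\<^sup>2 - of_int a * x + of_int e / 2"
  define w where "w = of_int c * x - of_int f / 2"
  have "u = w * sq"
  proof -
    define A B C D where "A = (of_int a / 2 :: real)" and "B = (of_int b / 2 :: real)" and "C = (of_int c / 2 :: real)" and "D = (of_int d / 2 :: real)"
    have xx: "x = A + B * sp + C * sq + D * sr" unfolding x conj_val_def A_def B_def C_def D_def by simp
    have E: "of_int e / 2 = A * A + of_int q * (C * C) - of_int p * (B * B) - of_int r * (D * D)"
    proof -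
      have "real_of_int (2 * e) = of_int (a\<^sup>2 + q * c\<^sup>2 - p * b\<^sup>2 - r * d\<^sup>2)" using e2 by simp
      then show ?thesis unfolding A_def B_def C_def D_def by (simp add: power2_eq_square field_simps)
    qed
    have F: "of_int f / 2 = 2 * (A * C) - 2 * (of_int (2 * n + 1) * (B * D))"
      unfolding f_def A_def B_def C_def D_def by simp
    have ac: "of_int a = 2 * A" "of_int c = 2 * C" by (simp_all add: A_def C_def)
    have "u - w * sq = (x - A - C * sq)\<^sup>2 - (B * sp + D * sr)\<^sup>2"
    proof -
      have "(x - A - C * sq)\<^sup>2 = x\<^sup>2 - 2 * A * x - 2 * C * x * sq + A * A + C * C * (sq * sq) + 2 * A * C * sq"
        by (simp add: power2_eq_square algebra_simps)
      moreover have "(B * sp + D * sr)\<^sup>2 = B * B * (sp * sp) + D * D * (sr * sr) + 2 * B * D * (sp * sr)"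
        by (simp add: power2_eq_square algebra_simps)
      ultimately show ?thesis unfolding u_def w_def E F ac sqrt_squares sqrt_products by (simp add: algebra_simps)
    qed
    also have "x - A - C * sq = B * sp + D * sr" using xx by simp
    finally show ?thesis by simp
  qed
  then have "u\<^sup>2 = w\<^sup>2 * of_int q" using sqrt_squares(2) by (simp add: power2_eq_square)
  define cs where "cs = [: m, q * c * f - a * e, a\<^sup>2 + e - q * c\<^sup>2, - 2 * a, 1 :]"
  have "poly (map_poly of_int cs) x = u\<^sup>2 - w\<^sup>2 * of_int q"
  proof -
    have m: "real_of_int m = (of_int e / 2)\<^sup>2 - of_int q * (of_int f / 2)\<^sup>2"
    proof -
      have "real_of_int (4 * m) = of_int (e\<^sup>2 - q * f\<^sup>2)" using m4 by simp
      then show ?thesis by (simp add: power2_eq_square)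
    qed
    show ?thesis unfolding cs_def u_def w_def by (simp add: map_poly_pCons m power2_eq_square algebra_simps)
  qed
  then have "poly (map_poly of_int cs) x = 0" using \<open>u\<^sup>2 = w\<^sup>2 * of_int q\<close> by simp
  moreover have "lead_coeff cs = 1" by (simp add: cs_def)
  ultimately show "algebraic_int x" unfolding algebraic_int_altdef_ipoly by blast
qed

lemma ring_of_integers_eq: "ring_of_integers (rat_adjoin {sp, sq}) = integers_K"
  unfolding ring_of_integers_def rat_adjoin_eq_field_K
  using ring_of_integers_subset integers_K_subset by blast

end

section \<open>The Pythagoras number\<close>

lemma sum_squares_support:
  fixes f :: "nat \<Rightarrow> int"
  assumes I: "finite I" and m: "(\<Sum>i\<in>I. (f i)\<^sup>2) = m" "m < 4"
  shows "\<And>i. i \<in> I \<Longrightarrow> f i \<in> {- 1, 0, 1}" "int (card {i \<in> I. f i \<noteq> 0}) = m"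
proof -
  have small: "f i \<in> {- 1, 0, 1}" if i: "i \<in> I" for i
  proof (rule ccontr)
    assume "f i \<notin> {- 1, 0, 1}"
    then have "2 \<le> \<bar>f i\<bar>" by auto
    then have "2\<^sup>2 \<le> \<bar>f i\<bar>\<^sup>2" by (intro power_mono) auto
    moreover have "(f i)\<^sup>2 \<le> m" unfolding m(1)[symmetric] by (rule member_le_sum) (use i I in auto)
    ultimately show False using m(2) by simp
  qed
  then show "\<And>i. i \<in> I \<Longrightarrow> f i \<in> {- 1, 0, 1}" by blast
  have "m = (\<Sum>i\<in>I. if f i \<noteq> 0 then 1 else 0)"
    unfolding m(1)[symmetric] using small by (intro sum.cong refl) force
  also have "\<dots> = (\<Sum>i\<in>{i \<in> I. f i \<noteq> 0}. 1)" by (rule sum.inter_filter[OF I, symmetric])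
  finally show "int (card {i \<in> I. f i \<noteq> 0}) = m" by simp
qed

lemma seven_not_sum_of_three_squares: "(x::int)\<^sup>2 + y\<^sup>2 + z\<^sup>2 \<noteq> 7"
proof
  assume eq: "x\<^sup>2 + y\<^sup>2 + z\<^sup>2 = 7"
  have small: "u\<^sup>2 \<in> {0, 1, 4}" if "u\<^sup>2 \<le> 7" for u :: int
  proof -
    have "\<bar>u\<bar> < 3"
    proof (rule ccontr)
      assume "\<not> \<bar>u\<bar> < 3"
      then have "3\<^sup>2 \<le> \<bar>u\<bar>\<^sup>2" by (intro power_mono) auto
      then show False using that by simp
    qed
    then have "\<bar>u\<bar> = 0 \<or> \<bar>u\<bar> = 1 \<or> \<bar>u\<bar> = 2" by linarith
    then have "\<bar>u\<bar>\<^sup>2 \<in> {0, 1, 4}" by (elim disjE) simp_all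
    then show ?thesis by simp
  qed
  have "0 \<le> x\<^sup>2" "0 \<le> y\<^sup>2" "0 \<le> z\<^sup>2" by auto
  then have "x\<^sup>2 \<le> 7" "y\<^sup>2 \<le> 7" "z\<^sup>2 \<le> 7" using eq by linarith+
  note this[THEN small]
  then show False using eq by auto
qed

context biquadratic
begin

text \<open>\<open>A\<close>, \<open>B\<close>, \<open>C\<close>, \<open>D\<close> are doubled
  coordinates of six summands; \<open>h0\<close> is the trace equation, and \<open>h1\<close>,
  \<open>h2\<close>, \<open>h3\<close> compare the coefficients of the square roots. As p, q, r have
  size 4 n^2, the trace pays for very few nonzero entries of \<open>B\<close>, \<open>C\<close>,
  \<open>D\<close>.\<close>

lemma not_sum_of_six_squares:
  fixes A B C D :: "nat \<Rightarrow> int"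
  assumes par: "\<And>i. i < 6 \<Longrightarrow> even (A i - C i)" "\<And>i. i < 6 \<Longrightarrow> even (B i - D i)"
    and h0: "(\<Sum>i<6. (A i)\<^sup>2) + p * (\<Sum>i<6. (B i)\<^sup>2) + q * (\<Sum>i<6. (C i)\<^sup>2) + r * (\<Sum>i<6. (D i)\<^sup>2)
      = 37 + 2 * p + q + 2 * r"
    and h1: "(\<Sum>i<6. A i * B i) + (2 * n + 3) * (\<Sum>i<6. C i * D i) = 0"
    and h2: "(\<Sum>i<6. A i * C i) + (2 * n + 1) * (\<Sum>i<6. B i * D i) = 1"
    and h3: "(\<Sum>i<6. A i * D i) + (2 * n - 1) * (\<Sum>i<6. B i * C i) = 4"
  shows False
proof -
  define a b c d where "a = (\<Sum>i<6. (A i)\<^sup>2)" and "b = (\<Sum>i<6. (B i)\<^sup>2)" and "c = (\<Sum>i<6. (C i)\<^sup>2)"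
    and "d = (\<Sum>i<6. (D i)\<^sup>2)"
  have nonneg: "a \<ge> 0" "b \<ge> 0" "c \<ge> 0" "d \<ge> 0" unfolding a_def b_def c_def d_def by (simp_all add: sum_nonneg)
  have H0: "a + p * b + q * c + r * d = 37 + 2 * p + q + 2 * r" using h0 by (simp only: a_def b_def c_def d_def)
  have zero: "f i = 0" if "(\<Sum>i<6. (f i)\<^sup>2) = 0" "i < 6" for f :: "nat \<Rightarrow> int" and i
  proof -
    have "\<forall>i\<in>{..<6}. (f i)\<^sup>2 = 0" using that(1) by (subst (asm) sum_nonneg_eq_0_iff) auto
    then show ?thesis using that(2) by simp
  qed
  have c1: "c \<ge> 1"
  proof (rule ccontr)
    assume "\<not> c \<ge> 1"
    then have "c = 0" using nonneg by simp
    then have "(\<Sum>i<6. A i * C i) = 0" using zero[of C] by (simp add: c_def)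
    then have "(2 * n + 1) dvd 1" using h2 by (metis add.left_neutral dvd_triv_left)
    then show False using n6 zdvd_imp_le[of "2 * n + 1" 1] by simp
  qed
  have d1: "d \<ge> 1"
  proof (rule ccontr)
    assume "\<not> d \<ge> 1"
    then have "d = 0" using nonneg by simp
    then have "(\<Sum>i<6. A i * D i) = 0" using zero[of D] by (simp add: d_def)
    then have "(2 * n - 1) dvd 4" using h3 by (metis add.left_neutral dvd_triv_left)
    then show False using n6 zdvd_imp_le[of "2 * n - 1" 4] by simp
  qed
  have pqr: "p = 4 * n\<^sup>2 - 1" "q = 4 * n\<^sup>2 + 4 * n - 3" "r = 4 * n\<^sup>2 + 8 * n + 3"
    unfolding p_eq q_eq r_eq by (simp_all add: power2_eq_square algebra_simps)
  have nn: "n\<^sup>2 \<ge> 6 * n" using n6 by (simp add: power2_eq_square)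
  \<comment> \<open>If \<open>B\<close> vanished, all entries of \<open>D\<close> would be even, so
    d \<ge> 4, and the trace cannot afford 4r.\<close>
  have b1: "b \<ge> 1"
  proof (rule ccontr)
    assume "\<not> b \<ge> 1"
    then have b0: "b = 0" using nonneg by simp
    then have "even (D i)" if "i < 6" for i using par(2)[OF that] zero[of B i] that by (simp add: b_def)
    then have "4 dvd (D i)\<^sup>2" if "i < 6" for i
      using that by (metis dvd_def mult_dvd_mono numeral_Bit0 power2_eq_square mult_2 numeral_times_numeral semiring_norm(13) semiring_norm(11))
    then have "4 dvd d" unfolding d_def by (intro dvd_sum) auto
    then have "d \<ge> 4" using d1 by (auto dest: zdvd_imp_le)
    then have "r * 4 \<le> r * d" "q * 1 \<le> q * c" using c1 gt_1 by (auto intro!: mult_left_mono)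
    then have "4 * r + q \<le> 37 + 2 * p + q + 2 * r" using H0 b0 nonneg by simp
    then show False unfolding pqr using n6 by simp
  qed
  \<comment> \<open>Otherwise the trace pays at least 5p + q, which would mean 4 n^2 \<le> 16 n +
    46. This fails exactly from n = 6 on.\<close>
  have le5: "b + c + d \<le> 5"
  proof (rule ccontr)
    assume "\<not> b + c + d \<le> 5"
    then have six: "6 \<le> b + c + d" by simp
    have "p * (b + (c - 1) + d) + q \<le> p * b + (q * (c - 1) + q) + r * d"
    proof -
      have "p * (c - 1) \<le> q * (c - 1)" using c1 n6 unfolding pqr by (intro mult_right_mono) auto
      moreover have "p * d \<le> r * d" using d1 n6 unfolding pqr by (intro mult_right_mono) auto
      ultimately show ?thesis by (simp add: distrib_left)
    qed
    moreover have "p * 5 \<le> p * (b + (c - 1) + d)" using six gt_1 by (intro mult_left_mono) auto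
    moreover have "q * (c - 1) + q = q * c" by (simp add: right_diff_distrib)
    ultimately have "p * 5 + q \<le> 37 + 2 * p + q + 2 * r" using H0 nonneg by linarith
    then show False unfolding pqr using nn n6 by simp
  qed
  have ebd: "even (b - d)"
  proof -
    have "b - d = (\<Sum>i<6. (B i)\<^sup>2 - (D i)\<^sup>2)" unfolding b_def d_def by (rule sum_subtractf[symmetric])
    moreover have "even ((B i)\<^sup>2 - (D i)\<^sup>2)" if "i < 6" for i using par(2)[OF that] by simp
    ultimately show ?thesis using dvd_sum[of "{..<6}" 2 "\<lambda>i. (B i)\<^sup>2 - (D i)\<^sup>2"] by simp
  qed
  \<comment> \<open>Equation \<open>h2\<close> modulo 2, using that \<open>A\<close> and
    \<open>C\<close> as well as \<open>B\<close> and \<open>D\<close> agree modulo 2.\<close>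
  have obc: "odd (b + c)"
  proof -
    have "(\<Sum>i<6. A i * C i) - c = (\<Sum>i<6. A i * C i - (C i)\<^sup>2)" unfolding c_def by (rule sum_subtractf[symmetric])
    moreover have "even (A i * C i - (C i)\<^sup>2)" if "i < 6" for i
      using par(1)[OF that] by (simp add: power2_eq_square left_diff_distrib[symmetric])
    ultimately have e1: "even ((\<Sum>i<6. A i * C i) - c)"
      using dvd_sum[of "{..<6}" 2 "\<lambda>i. A i * C i - (C i)\<^sup>2"] by simp
    have "b - (\<Sum>i<6. B i * D i) = (\<Sum>i<6. (B i)\<^sup>2 - B i * D i)" unfolding b_def by (rule sum_subtractf[symmetric])
    moreover have "even ((B i)\<^sup>2 - B i * D i)" if "i < 6" for i
      using par(2)[OF that] by (simp add: power2_eq_square right_diff_distrib[symmetric])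
    ultimately have e2: "even (b - (\<Sum>i<6. B i * D i))"
      using dvd_sum[of "{..<6}" 2 "\<lambda>i. (B i)\<^sup>2 - B i * D i"] by simp
    have "odd ((\<Sum>i<6. A i * C i) + (2 * n + 1) * (\<Sum>i<6. B i * D i))" unfolding h2 by simp
    then show ?thesis using e1 e2 by simp blast
  qed
  have bcd: "(b = 1 \<and> d = 1 \<and> c = 2) \<or> (b = 2 \<and> d = 2 \<and> c = 1)"
    using b1 c1 d1 le5 ebd obc by presburger
  have lt4: "b < 4" "c < 4" "d < 4" using bcd by auto
  note sB = sum_squares_support[OF finite_lessThan b_def[symmetric] lt4(1)]
  note sC = sum_squares_support[OF finite_lessThan c_def[symmetric] lt4(2)]
  note sD = sum_squares_support[OF finite_lessThan d_def[symmetric] lt4(3)]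
  have suppBD: "B i = 0 \<longleftrightarrow> D i = 0" if "i < 6" for i
    using sB(1)[of i] sD(1)[of i] par(2)[OF that] that by auto
  have Ale: "(A i)\<^sup>2 \<le> a" if "i < 6" for i
    unfolding a_def by (rule member_le_sum) (use that in auto)
  have one: "(\<Sum>j<6. f j) = f i" if "i < 6" "\<And>j. j < 6 \<Longrightarrow> j \<noteq> i \<Longrightarrow> f j = 0" for f :: "nat \<Rightarrow> int" and i
    using that by (subst sum.mono_neutral_right[of _ "{i}"]) auto
  show False
    using bcd
  proof
    \<comment> \<open>In this case \<open>h1\<close> makes the absolute value of \<open>A i\<close>
      a positive multiple of 2n + 3, and its square exceeds what the trace leaves for
      \<open>A\<close>.\<close>
    assume v: "b = 1 \<and> d = 1 \<and> c = 2"
    then have "card {i \<in> {..<6}. B i \<noteq> 0} = 1" using sB(2) by simp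
    then obtain i where "{i \<in> {..<6}. B i \<noteq> 0} = {i}" by (auto simp: card_1_singleton_iff)
    then have i: "i < 6" "B i \<noteq> 0" "\<And>j. j < 6 \<Longrightarrow> j \<noteq> i \<Longrightarrow> B j = 0" by blast+
    have D0: "\<And>j. j < 6 \<Longrightarrow> j \<noteq> i \<Longrightarrow> D j = 0" using i(3) suppBD by blast
    have sums: "(\<Sum>j<6. A j * B j) = A i * B i" "(\<Sum>j<6. C j * D j) = C i * D i"
      "(\<Sum>j<6. A j * D j) = A i * D i" "(\<Sum>j<6. B j * C j) = B i * C i"
      by (rule one[OF i(1)]; simp add: i(3) D0)+
    have Bi: "(B i)\<^sup>2 = 1" using sB(1)[of i] i by auto
    have Di: "(D i)\<^sup>2 = 1" using sD(1)[of i] suppBD[OF i(1)] i by auto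
    have e1: "A i * B i = - ((2 * n + 3) * (C i * D i))" using h1 unfolding sums by simp
    have e3: "A i * D i + (2 * n - 1) * (B i * C i) = 4" using h3 unfolding sums .
    have "C i \<noteq> 0"
    proof
      assume "C i = 0"
      then have "A i = 0" using e1 i(2) by simp
      then show False using e3 \<open>C i = 0\<close> by simp
    qed
    then have "(C i)\<^sup>2 > 0" by simp
    then have C1: "(C i)\<^sup>2 \<ge> 1" by linarith
    have "(A i * B i)\<^sup>2 = ((2 * n + 3) * (C i * D i))\<^sup>2" unfolding e1 by simp
    then have "(A i)\<^sup>2 = (2 * n + 3)\<^sup>2 * (C i)\<^sup>2" using Bi Di by (simp add: power_mult_distrib)
    then have "(A i)\<^sup>2 \<ge> (2 * n + 3)\<^sup>2 * 1" using mult_left_mono[OF C1, of "(2 * n + 3)\<^sup>2"] by simp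
    moreover have "a = 37 + p - q + r" using H0 v by simp
    ultimately have "(2 * n + 3)\<^sup>2 \<le> 37 + p - q + r" using Ale[OF i(1)] by simp
    then show False unfolding pqr using n6 by (simp add: power2_eq_square algebra_simps)
  next
    assume v: "b = 2 \<and> d = 2 \<and> c = 1"
    then have a37: "a = 37" using H0 by simp
    have A6: "\<bar>A l\<bar> \<le> 6" if "l < 6" for l
    proof (rule ccontr)
      assume "\<not> \<bar>A l\<bar> \<le> 6"
      then have "7\<^sup>2 \<le> \<bar>A l\<bar>\<^sup>2" by (intro power_mono) auto
      then show False using Ale[OF that] a37 by simp
    qed
    have "card {i \<in> {..<6}. B i \<noteq> 0} = 2" "card {i \<in> {..<6}. C i \<noteq> 0} = 1" using sB(2) sC(2) v by simp_all
    then obtain i j k where ij: "{i \<in> {..<6}. B i \<noteq> 0} = {i, j}" "i \<noteq> j" and ks: "{i \<in> {..<6}. C i \<noteq> 0} = {k}"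
      by (auto simp: card_1_singleton_iff card_2_iff)
    have i: "i < 6" "B i \<noteq> 0" and j: "j < 6" "B j \<noteq> 0" and B0: "\<And>l. l < 6 \<Longrightarrow> l \<noteq> i \<Longrightarrow> l \<noteq> j \<Longrightarrow> B l = 0"
      using ij(1) by blast+
    have k: "k < 6" "C k \<noteq> 0" and C0: "\<And>l. l < 6 \<Longrightarrow> l \<noteq> k \<Longrightarrow> C l = 0" using ks by blast+
    have D0: "\<And>l. l < 6 \<Longrightarrow> l \<noteq> i \<Longrightarrow> l \<noteq> j \<Longrightarrow> D l = 0" using B0 suppBD by blast
    have two: "(\<Sum>l<6. f l) = f i + f j" if "\<And>l. l < 6 \<Longrightarrow> l \<noteq> i \<Longrightarrow> l \<noteq> j \<Longrightarrow> f l = 0" for f :: "nat \<Rightarrow> int"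
      using that i j ij(2) by (subst sum.mono_neutral_right[of _ "{i, j}"]) auto
    have sums: "(\<Sum>l<6. A l * B l) = A i * B i + A j * B j" "(\<Sum>l<6. B l * D l) = B i * D i + B j * D j"
      "(\<Sum>l<6. A l * D l) = A i * D i + A j * D j"
      by (rule two; simp add: B0 D0)+
    have sumk: "(\<Sum>l<6. C l * D l) = C k * D k" "(\<Sum>l<6. A l * C l) = A k * C k" "(\<Sum>l<6. B l * C l) = B k * C k"
      by (rule one[OF k(1)]; simp add: C0)+
    have Bv: "B i = 1 \<or> B i = - 1" "B j = 1 \<or> B j = - 1" using sB(1)[of i] sB(1)[of j] i j by auto
    have Dv: "D i = 1 \<or> D i = - 1" "D j = 1 \<or> D j = - 1" using sD(1)[of i] sD(1)[of j] suppBD i j by auto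
    have Cv: "C k = 1 \<or> C k = - 1" using sC(1)[of k] k by auto
    \<comment> \<open>Otherwise \<open>h1\<close> would contain a term of absolute value 2n + 3
      \<ge> 15, which two entries of \<open>A\<close> of size at most 6 cannot cancel.\<close>
    have Dk: "D k = 0"
    proof (rule ccontr)
      assume "D k \<noteq> 0"
      then have "D k = 1 \<or> D k = - 1" using sD(1)[of k] k by auto
      then have "C k * D k = 1 \<or> C k * D k = - 1" using Cv by auto
      moreover have "\<bar>A i * B i + A j * B j\<bar> \<le> 12" using Bv A6[OF i(1)] A6[OF j(1)] by auto
      ultimately show False using h1 n6 unfolding sums sumk by auto
    qed
    then have kij: "k \<noteq> i" "k \<noteq> j" using Dv by auto
    have Bk: "B k = 0" using Dk suppBD k by blast
    have e1: "A i * B i + A j * B j = 0" using h1 Dk unfolding sums sumk by simp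
    have e3: "A i * D i + A j * D j = 4" using h3 Bk unfolding sums sumk by simp
    have e2: "B i * D i + B j * D j = 0" "A k * C k = 1"
    proof -
      have AC: "\<bar>A k * C k\<bar> \<le> 6" using Cv A6[OF k(1)] by auto
      have BD: "B i * D i + B j * D j \<in> {- 2, 0, 2}" using Bv Dv by auto
      have eq: "A k * C k + (2 * n + 1) * (B i * D i + B j * D j) = 1" using h2 unfolding sums sumk .
      show z: "B i * D i + B j * D j = 0"
        using BD eq AC n6 by auto
      show "A k * C k = 1" using eq z by simp
    qed
    have Ak: "(A k)\<^sup>2 = 1" using e2(2) Cv by auto
    have "\<bar>x\<bar> = 2 \<and> \<bar>y\<bar> = 2"
      if "b1 = 1 \<or> b1 = - 1" "b2 = 1 \<or> b2 = - 1" "d1 = 1 \<or> d1 = - 1" "d2 = 1 \<or> d2 = - 1"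
        "x * b1 + y * b2 = 0" "b1 * d1 + b2 * d2 = 0" "x * d1 + y * d2 = 4" for x y b1 b2 d1 d2 :: int
      using that by (elim disjE; simp)
    from this[OF Bv Dv e1 e2(1) e3] have "\<bar>A i\<bar>\<^sup>2 = 4" "\<bar>A j\<bar>\<^sup>2 = 4" by simp_all
    then have Aij: "(A i)\<^sup>2 = 4" "(A j)\<^sup>2 = 4" by simp_all
    \<comment> \<open>The entries of \<open>A\<close> at \<open>i\<close> and \<open>j\<close> are 2
      and the one at \<open>k\<close> is 1 up to sign, so 37 - 4 - 4 - 1 = 28 is left for the three
      indices of \<open>J\<close>. There \<open>C\<close> vanishes and \<open>A\<close> is
      even.\<close>
    define J where "J = {..<6} - {i, j, k}"
    have "card J = 3" unfolding J_def using i j k kij ij(2) by (simp add: card_Diff_subset)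
    then obtain x y z where xyz: "J = {x, y, z}" "x \<noteq> y" "y \<noteq> z" "x \<noteq> z" by (auto simp: card_3_iff)
    have "a = (\<Sum>l\<in>J. (A l)\<^sup>2) + (\<Sum>l\<in>{i, j, k}. (A l)\<^sup>2)"
      unfolding a_def J_def by (rule sum.subset_diff) (use i j k in auto)
    also have "(\<Sum>l\<in>{i, j, k}. (A l)\<^sup>2) = 9" using ij(2) kij Ak Aij by simp
    also have "(\<Sum>l\<in>J. (A l)\<^sup>2) = (A x)\<^sup>2 + (A y)\<^sup>2 + (A z)\<^sup>2" unfolding xyz(1) using xyz(2-4) by simp
    finally have s28: "(A x)\<^sup>2 + (A y)\<^sup>2 + (A z)\<^sup>2 = 28" using a37 by simp
    have ev: "\<exists>u. A l = 2 * u" if "l \<in> J" for l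
    proof -
      have "l < 6" "l \<noteq> k" using that by (auto simp: J_def)
      then have "even (A l)" using par(1)[of l] C0[of l] by simp
      then show ?thesis by (simp only: dvd_def)
    qed
    obtain u where u: "A x = 2 * u" using ev xyz(1) by blast
    obtain v where v: "A y = 2 * v" using ev xyz(1) by blast
    obtain w where w: "A z = 2 * w" using ev xyz(1) by blast
    have "u\<^sup>2 + v\<^sup>2 + w\<^sup>2 = 7" using s28 unfolding u v w by (simp add: power_mult_distrib)
    then show False using seven_not_sum_of_three_squares by blast
  qed
qed

definition basis_K :: "nat \<Rightarrow> real" where
  "basis_K j = (if j = 0 then 1 else if j = 1 then sp else if j = 2 then (1 + sq) / 2 else (sp + sr) / 2)"

lemma sum_basis_K: "(\<Sum>j<4. f j * basis_K j) = f 0 + f 1 * sp + f 2 * ((1 + sq) / 2) + f 3 * ((sp + sr) / 2)"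
  by (simp add: basis_K_def eval_nat_numeral)

lemma integers_K_iff: "x \<in> integers_K \<longleftrightarrow> (\<exists>z::nat \<Rightarrow> int. x = (\<Sum>j<4. of_int (z j) * basis_K j))"
proof
  assume "x \<in> integers_K"
  then obtain a b c d where x: "x = val (of_int a / 2) (of_int b / 2) (of_int c / 2) (of_int d / 2)"
    and ev: "even (a - c)" "even (b - d)" unfolding integers_K_def by blast
  obtain a' where a': "a - c = 2 * a'" using ev(1) by (rule evenE)
  obtain b' where b': "b - d = 2 * b'" using ev(2) by (rule evenE)
  have ab': "a = c + 2 * a'" "b = d + 2 * b'" using a' b' by linarith+
  define z :: "nat \<Rightarrow> int" where "z = (\<lambda>_. 0)(0 := a', 1 := b', 2 := c, 3 := d)"
  have "x = (\<Sum>j<4. of_int (z j) * basis_K j)"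
    unfolding sum_basis_K x ab' by (simp add: z_def conj_val_def add_divide_distrib distrib_left distrib_right)
  then show "\<exists>z::nat \<Rightarrow> int. x = (\<Sum>j<4. of_int (z j) * basis_K j)" by blast
next
  assume "\<exists>z::nat \<Rightarrow> int. x = (\<Sum>j<4. of_int (z j) * basis_K j)"
  then obtain z :: "nat \<Rightarrow> int" where x: "x = (\<Sum>j<4. of_int (z j) * basis_K j)" by blast
  have "x = val (of_int (2 * z 0 + z 2) / 2) (of_int (2 * z 1 + z 3) / 2) (of_int (z 2) / 2) (of_int (z 3) / 2)"
    unfolding x sum_basis_K by (simp add: conj_val_def add_divide_distrib distrib_left distrib_right)
  then show "x \<in> integers_K" unfolding integers_K_def mem_Collect_eq
    by (intro exI[of _ "2 * z 0 + z 2"] exI[of _ "2 * z 1 + z 3"] exI[of _ "z 2"] exI[of _ "z 3"]) simp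
qed

lemma eight_squares_to_seven:
  assumes "length xs = 8" "set xs \<subseteq> integers_K"
  obtains ys where "length ys \<le> 7" "set ys \<subseteq> integers_K" "(\<Sum>x\<leftarrow>ys. x\<^sup>2) = (\<Sum>x\<leftarrow>xs. x\<^sup>2)"
proof -
  have "\<forall>i<8. \<exists>z::nat \<Rightarrow> int. xs ! i = (\<Sum>j<4. of_int (z j) * basis_K j)"
    using assms by (metis integers_K_iff nth_mem subset_iff)
  then obtain z :: "nat \<Rightarrow> nat \<Rightarrow> int" where z: "\<And>i. i < 8 \<Longrightarrow> xs ! i = (\<Sum>j<4. of_int (z i j) * basis_K j)" by metis
  \<comment> \<open>\<open>gram_of_seven\<close> indexes its vectors by an eight-element type;
    \<open>h\<close> renumbers the list positions.\<close>
  obtain h :: "nat \<Rightarrow> 8" where h: "bij_betw h {0..<8} UNIV"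
    using ex_bij_betw_nat_finite[of "UNIV :: 8 set"] by auto
  define g where "g = inv_into {0..<8} h"
  define c where "c j s = z (g s) j" for j s
  obtain k :: nat and d :: "nat \<Rightarrow> nat \<Rightarrow> int" where d: "k \<le> 7" "\<forall>i<4. \<forall>j<4. (\<Sum>s\<in>UNIV. c i s * c j s) = (\<Sum>r<k. d i r * d j r)"
    by (rule gram_of_seven[of c])
  have gram: "(\<Sum>i<8. z i j * z i l) = (\<Sum>r<k. d j r * d l r)" if "j < 4" "l < 4" for j l
  proof -
    have "(\<Sum>s\<in>UNIV. c j s * c l s) = (\<Sum>i\<in>{0..<8}. c j (h i) * c l (h i))"
      by (rule sum.reindex_bij_betw[OF h, symmetric])
    also have "\<dots> = (\<Sum>i\<in>{0..<8}. z i j * z i l)"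
      using h by (intro sum.cong refl) (simp add: c_def g_def bij_betw_inv_into_left)
    finally show ?thesis using d(2) that by (simp add: lessThan_atLeast0)
  qed
  define ys where "ys = map (\<lambda>r. \<Sum>j<4. of_int (d j r) * basis_K j) [0..<k]"
  have expand: "(\<Sum>i\<in>S. (\<Sum>j<4. of_int (m i j) * basis_K j)\<^sup>2)
      = (\<Sum>j<4. \<Sum>l<4. of_int (\<Sum>i\<in>S. m i j * m i l) * (basis_K j * basis_K l))"
    for S :: "nat set" and m :: "nat \<Rightarrow> nat \<Rightarrow> int"
  proof -
    have "(\<Sum>i\<in>S. (\<Sum>j<4. of_int (m i j) * basis_K j)\<^sup>2)
        = (\<Sum>i\<in>S. \<Sum>j<4. \<Sum>l<4. of_int (m i j * m i l) * (basis_K j * basis_K l))"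
      unfolding power2_eq_square sum_product by (intro sum.cong refl) (simp add: mult_ac)
    also have "\<dots> = (\<Sum>j<4. \<Sum>i\<in>S. \<Sum>l<4. of_int (m i j * m i l) * (basis_K j * basis_K l))"
      by (rule sum.swap)
    also have "\<dots> = (\<Sum>j<4. \<Sum>l<4. \<Sum>i\<in>S. of_int (m i j * m i l) * (basis_K j * basis_K l))"
      by (intro sum.cong refl sum.swap)
    finally show ?thesis unfolding of_int_sum sum_distrib_right .
  qed
  have "(\<Sum>x\<leftarrow>xs. x\<^sup>2) = (\<Sum>i<8. (xs ! i)\<^sup>2)"
    unfolding sum_list_sum_nth using assms(1) by (simp add: lessThan_atLeast0)
  also have "\<dots> = (\<Sum>i<8. (\<Sum>j<4. of_int (z i j) * basis_K j)\<^sup>2)" using z by simp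
  also have "\<dots> = (\<Sum>j<4. \<Sum>l<4. of_int (\<Sum>r<k. d j r * d l r) * (basis_K j * basis_K l))"
    unfolding expand[of z] by (intro sum.cong refl) (simp only: gram lessThan_iff)
  also have "\<dots> = (\<Sum>r<k. (\<Sum>j<4. of_int (d j r) * basis_K j)\<^sup>2)"
    by (rule expand[of "\<lambda>r j. d j r", symmetric])
  also have "\<dots> = (\<Sum>x\<leftarrow>ys. x\<^sup>2)"
    unfolding sum_list_sum_nth by (simp add: ys_def lessThan_atLeast0)
  finally have "(\<Sum>x\<leftarrow>ys. x\<^sup>2) = (\<Sum>x\<leftarrow>xs. x\<^sup>2)" by simp
  moreover have "set ys \<subseteq> integers_K" unfolding ys_def using integers_K_iff by auto
  ultimately show ?thesis using that[of ys] d(1) by (simp add: ys_def)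
qed

lemma squares_to_seven:
  assumes "set xs \<subseteq> integers_K"
  shows "\<exists>ys. length ys \<le> 7 \<and> set ys \<subseteq> integers_K \<and> (\<Sum>x\<leftarrow>ys. x\<^sup>2) = (\<Sum>x\<leftarrow>xs. x\<^sup>2)"
  using assms
proof (induction "length xs" arbitrary: xs rule: less_induct)
  case less
  show ?case
  proof (cases "length xs \<le> 7")
    case True
    then show ?thesis using less.prems by blast
  next
    case False
    have sub: "set (take 8 xs) \<subseteq> integers_K" "set (drop 8 xs) \<subseteq> integers_K"
      using less.prems set_take_subset[of 8 xs] set_drop_subset[of 8 xs] by auto
    have "length (take 8 xs) = 8" using False by simp
    then obtain ys where ys: "length ys \<le> 7" "set ys \<subseteq> integers_K" "(\<Sum>x\<leftarrow>ys. x\<^sup>2) = (\<Sum>x\<leftarrow>take 8 xs. x\<^sup>2)"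
      using eight_squares_to_seven sub(1) by blast
    define zs where "zs = ys @ drop 8 xs"
    have "length zs < length xs" using ys(1) False by (simp add: zs_def)
    moreover have "set zs \<subseteq> integers_K" using ys(2) sub(2) by (simp add: zs_def)
    moreover have "(\<Sum>x\<leftarrow>zs. x\<^sup>2) = (\<Sum>x\<leftarrow>xs. x\<^sup>2)"
    proof -
      have "(\<Sum>x\<leftarrow>xs. x\<^sup>2) = (\<Sum>x\<leftarrow>take 8 xs. x\<^sup>2) + (\<Sum>x\<leftarrow>drop 8 xs. x\<^sup>2)"
        by (metis append_take_drop_id map_append sum_list_append)
      then show ?thesis by (simp add: zs_def ys(3))
    qed
    ultimately show ?thesis using less.hyps[of zs] by simp
  qed
qed

text \<open>The rational entries have square sum 7. The last three have doubled coordinates (1, 0,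
  1, 0), (2, -1, 0, 1), (2, 1, 0, 1): they give \<open>B\<close>, \<open>C\<close>, \<open>D\<close>
  the square sums 2, 1, 2 and produce the right-hand sides 0, 1, 4 of the mixed equations.\<close>

definition witness_list :: "real list" where
  "witness_list = [1, 1, 1, 2, (1 + sq) / 2, 1 + (sr - sp) / 2, 1 + (sr + sp) / 2]"

lemma witness_list_integers: "set witness_list \<subseteq> integers_K"
proof -
  have mem: "x \<in> integers_K" if "x = val (of_int a / 2) (of_int b / 2) (of_int c / 2) (of_int d / 2)"
    "even (a - c)" "even (b - d)" for x a b c d
    unfolding integers_K_def using that by blast
  have "1 \<in> integers_K" by (rule mem[of _ 2 0 0 0]) (simp_all add: conj_val_def)
  moreover have "2 \<in> integers_K" by (rule mem[of _ 4 0 0 0]) (simp_all add: conj_val_def)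
  moreover have "(1 + sq) / 2 \<in> integers_K" by (rule mem[of _ 1 0 1 0]) (simp_all add: conj_val_def add_divide_distrib)
  moreover have "1 + (sr - sp) / 2 \<in> integers_K"
    by (rule mem[of _ 2 "- 1" 0 1]) (simp_all add: conj_val_def diff_divide_distrib)
  moreover have "1 + (sr + sp) / 2 \<in> integers_K"
    by (rule mem[of _ 2 1 0 1]) (simp_all add: conj_val_def add_divide_distrib)
  ultimately show ?thesis by (simp add: witness_list_def)
qed

lemma witness_sum: "4 * (\<Sum>x\<leftarrow>witness_list. x\<^sup>2) = val (of_int (37 + 2 * p + q + 2 * r)) 0 2 8"
proof -
  have "4 * (\<Sum>x\<leftarrow>witness_list. x\<^sup>2) = 37 + sq * sq + 2 * (sp * sp) + 2 * (sr * sr) + 2 * sq + 8 * sr"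
    unfolding witness_list_def by (simp add: power2_eq_square field_simps)
  then show ?thesis unfolding sqrt_squares by (simp add: conj_val_def)
qed

lemma sum_conj_val: "(\<Sum>i\<in>S. conj_val s t (f i) (g i) (h i) (k i)) = conj_val s t (sum f S) (sum g S) (sum h S) (sum k S)"
  by (simp add: conj_val_def sum.distrib sum_distrib_left sum_distrib_right)

lemma witness_needs_seven:
  assumes xs: "set xs \<subseteq> integers_K" and eq: "(\<Sum>x\<leftarrow>xs. x\<^sup>2) = (\<Sum>x\<leftarrow>witness_list. x\<^sup>2)"
  shows "length xs \<ge> 7"
proof (rule ccontr)
  assume "\<not> length xs \<ge> 7"
  then have len: "length xs \<le> 6" by simp
  \<comment> \<open>Missing summands are padded with 0, so that exactly six are compared.\<close>
  define y where "y i = (if i < length xs then xs ! i else 0)" for i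
  have "0 \<in> integers_K" unfolding integers_K_iff by (intro exI[of _ "\<lambda>_. 0"]) simp
  then have "y i \<in> integers_K" for i using xs by (auto simp: y_def)
  then have "\<forall>i. \<exists>a b c d. y i = val (of_int a / 2) (of_int b / 2) (of_int c / 2) (of_int d / 2) \<and> even (a - c) \<and> even (b - d)"
    unfolding integers_K_def by blast
  then obtain A B C D :: "nat \<Rightarrow> int" where
    y: "\<And>i. y i = val (of_int (A i) / 2) (of_int (B i) / 2) (of_int (C i) / 2) (of_int (D i) / 2)"
    and par: "\<And>i. even (A i - C i)" "\<And>i. even (B i - D i)" by metis
  have "(\<Sum>x\<leftarrow>xs. x\<^sup>2) = (\<Sum>i<length xs. (y i)\<^sup>2)"
    unfolding sum_list_sum_nth by (simp add: lessThan_atLeast0 y_def)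
  also have "\<dots> = (\<Sum>i<6. (y i)\<^sup>2)"
    using len by (intro sum.mono_neutral_left) (auto simp: y_def)
  finally have "4 * (\<Sum>i<6. (y i)\<^sup>2) = val (of_int (37 + 2 * p + q + 2 * r)) 0 2 8" using eq witness_sum by simp
  moreover have "4 * (y i)\<^sup>2 = val (of_int ((A i)\<^sup>2 + p * (B i)\<^sup>2 + q * (C i)\<^sup>2 + r * (D i)\<^sup>2))
      (of_int (2 * (A i * B i) + (2 * n + 3) * (2 * (C i * D i))))
      (of_int (2 * (A i * C i) + (2 * n + 1) * (2 * (B i * D i))))
      (of_int (2 * (A i * D i) + (2 * n - 1) * (2 * (B i * C i))))" for i
  proof -
    have "2 * y i = val (of_int (A i)) (of_int (B i)) (of_int (C i)) (of_int (D i))"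
      unfolding y by (simp add: conj_val_def)
    moreover have "4 * (y i)\<^sup>2 = (2 * y i) * (2 * y i)" by (simp add: power2_eq_square)
    ultimately show ?thesis by (simp add: conj_val_mult power2_eq_square mult_ac)
  qed
  ultimately have V: "val (\<Sum>i<6. of_int ((A i)\<^sup>2 + p * (B i)\<^sup>2 + q * (C i)\<^sup>2 + r * (D i)\<^sup>2))
      (\<Sum>i<6. of_int (2 * (A i * B i) + (2 * n + 3) * (2 * (C i * D i))))
      (\<Sum>i<6. of_int (2 * (A i * C i) + (2 * n + 1) * (2 * (B i * D i))))
      (\<Sum>i<6. of_int (2 * (A i * D i) + (2 * n - 1) * (2 * (B i * C i))))
      = val (of_int (37 + 2 * p + q + 2 * r)) (of_int 0) (of_int 2) (of_int 8)"
    unfolding sum_distrib_left sum_conj_val[symmetric] by simp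
  note E = val_inj[OF _ _ _ _ _ _ _ _ V[folded of_int_sum], unfolded of_int_eq_iff, OF Rats_of_int Rats_of_int Rats_of_int Rats_of_int
      Rats_of_int Rats_of_int Rats_of_int Rats_of_int]
  show False
  proof (rule not_sum_of_six_squares[of A C B D])
    show "(\<Sum>i<6. (A i)\<^sup>2) + p * (\<Sum>i<6. (B i)\<^sup>2) + q * (\<Sum>i<6. (C i)\<^sup>2) + r * (\<Sum>i<6. (D i)\<^sup>2) = 37 + 2 * p + q + 2 * r"
      using E(1) by (simp only: sum.distrib sum_distrib_left)
    show "(\<Sum>i<6. A i * B i) + (2 * n + 3) * (\<Sum>i<6. C i * D i) = 0"
      using E(2) unfolding sum.distrib sum_distrib_left[symmetric] by simp
    show "(\<Sum>i<6. A i * C i) + (2 * n + 1) * (\<Sum>i<6. B i * D i) = 1"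
      using E(3) unfolding sum.distrib sum_distrib_left[symmetric] by simp
    show "(\<Sum>i<6. A i * D i) + (2 * n - 1) * (\<Sum>i<6. B i * C i) = 4"
      using E(4) unfolding sum.distrib sum_distrib_left[symmetric] by simp
  qed (use par in auto)
qed

theorem pythagoras_number_integers_K: "pythagoras_number integers_K = 7"
  unfolding pythagoras_number_def
proof (rule Inf_eqI)
  fix m :: enat
  assume "m \<in> {m. sums_of_squares integers_K = sums_of_at_most_squares m integers_K}"
  then have m: "sums_of_squares integers_K = sums_of_at_most_squares m integers_K" by simp
  have "(\<Sum>x\<leftarrow>witness_list. x\<^sup>2) \<in> sums_of_squares integers_K"
    unfolding sums_of_squares_def using witness_list_integers by blast
  then obtain xs where xs: "(\<Sum>x\<leftarrow>witness_list. x\<^sup>2) = (\<Sum>x\<leftarrow>xs. x\<^sup>2)" "set xs \<subseteq> integers_K" "enat (length xs) \<le> m"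
    unfolding m sums_of_at_most_squares_def by blast
  have "7 \<le> length xs" using witness_needs_seven[OF xs(2)] xs(1) by simp
  then have "enat 7 \<le> enat (length xs)" by simp
  then show "7 \<le> m" using xs(3) by (metis numeral_eq_enat order_trans)
next
  fix y :: enat
  assume y: "\<And>i. i \<in> {m. sums_of_squares integers_K = sums_of_at_most_squares m integers_K} \<Longrightarrow> y \<le> i"
  have "sums_of_squares integers_K = sums_of_at_most_squares 7 integers_K"
  proof
    show "sums_of_squares integers_K \<subseteq> sums_of_at_most_squares 7 integers_K"
    proof
      fix x assume "x \<in> sums_of_squares integers_K"
      then obtain xs where xs: "x = (\<Sum>x\<leftarrow>xs. x\<^sup>2)" "set xs \<subseteq> integers_K" unfolding sums_of_squares_def by blast
      obtain ys where ys: "length ys \<le> 7" "set ys \<subseteq> integers_K" "(\<Sum>x\<leftarrow>ys. x\<^sup>2) = (\<Sum>x\<leftarrow>xs. x\<^sup>2)"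
        using squares_to_seven[OF xs(2)] by blast
      have "enat (length ys) \<le> 7" using ys(1) by (simp add: numeral_eq_enat)
      then show "x \<in> sums_of_at_most_squares 7 integers_K"
        unfolding sums_of_at_most_squares_def xs(1) ys(3)[symmetric] using ys(2) by blast
    qed
    show "sums_of_at_most_squares 7 integers_K \<subseteq> sums_of_squares integers_K"
      unfolding sums_of_at_most_squares_def sums_of_squares_def by blast
  qed
  then show "y \<le> 7" using y by simp
qed

end

theorem theorem1p2:
  fixes n p q r :: int and K :: "real set"
  assumes "n \<ge> 6"
    and "p = (2 * n - 1) * (2 * n + 1)"
    and "q = (2 * n - 1) * (2 * n + 3)"
    and "r = (2 * n + 1) * (2 * n + 3)"
    and "squarefree p" and "squarefree q" and "squarefree r"
    and "K = rat_adjoin {sqrt (of_int p), sqrt (of_int q)}"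
  shows "pythagoras_number (ring_of_integers K) = 7"
proof -
  interpret biquadratic n p q r
    by unfold_locales (use assms in auto)
  show ?thesis
    using pythagoras_number_integers_K ring_of_integers_eq assms(8) by (simp add: sp_def sq_def)
qed

end
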